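(* Let $n$ be a positive integer and let $\nu_i=\lambda_iN$ $(i=1,\dots,n)$ with $\lambda_i\ge0$, where $0=\lambda_1\le\lambda_2\le\cdots\le\lambda_n$. Let $\rho_{n,N}$ be the corresponding normalized eigenvalue density. Then for every $z\in\mathbb{C}$, $$\lim_{N\to+\infty}\rho_{n,N}(z)=\rho_{n,\lambda}(z),$$ where the macroscopic density $\rho_{n,\lambda}$ is defined through its Mellin transform: for all $s\in(-\infty,\tfrac1n)$, $$\int_{\mathbb{C}}|z|^{2s}\rho_{n,\lambda}(z)\,d^2z=\int_0^1\prod_{i=1}^n\frac{(t+\lambda_i)^s}{(1-t)^s}\,dt .$$ In particular, for $\lambda_1=\cdots=\lambda_n=0$ (this includes a product of square matrices), $$\rho_{n,0}(z)=\frac1{\pi n}\,\frac{|z|^{\frac{2-2n}{n}}}{\big(1+|z|^{\frac2n}\big)^2}.$$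
   Context: One considers the product $X_1\cdots X_n$ of $n$ independent complex Cauchy-Lorentz random matrices, $X_i$ of size $N_i\times N_{i+1}$, with $N=N_1\le\cdots\le N_{n+1}$ and $\nu_i=N_i-N$ (so $\nu_1=0$). The weight $\omega_{n,N}$ is $$\omega_{n,N}(z)=\int_{\mathbb{C}^n}\prod_{j=1}^n\frac{|x_j|^{2\nu_j}}{(1+|x_j|^2)^{\nu_j+N+1}}\;\delta\Big(z-\prod_{j=1}^n x_j\Big)\,d^2x_1\cdots d^2x_n ,$$ where $d^2x$ is Lebesgue measure on $\mathbb{C}$ and $\delta$ is the Dirac delta on $\mathbb{C}$ (for $n=1$, $\omega_{1,N}(z)=(1+|z|^2)^{-N-1}$). The normalized density of the complex eigenvalues of the product is the rotation-invariant function $$\rho_{n,N}(z)=\frac1N\,\frac{\omega_{n,N}(z)}{\pi^n}\sum_{k=0}^{N-1}\frac1{\Gamma(N-k)^n}\prod_{i=1}^n\frac{\Gamma(\nu_i+N+1)}{\Gamma(\nu_i+k+1)}\;|z|^{2k},$$ which satisfies $\int_{\mathbb{C}}\rho_{n,N}(z)\,d^2z=1$. *)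

theory Defs
  imports "HOL-Analysis.Analysis"
begin

text \<open>
  Real powers of a nonnegative base with values in \<open>[0,\<infinity>]\<close>. In contrast to \<^const>\<open>powr\<close>, at base \<open>0\<close>
  this is the usual convention \<open>0\<^sup>0 = 1\<close>, \<open>0\<^sup>a = 0\<close> for \<open>a > 0\<close> and \<open>0\<^sup>a = \<infinity>\<close> for \<open>a < 0\<close>.
\<close>

definition epowr :: "real \<Rightarrow> real \<Rightarrow> ennreal" where
  "epowr x a = (if x = 0 then (if a = 0 then 1 else if a > 0 then 0 else \<infinity>) else ennreal (x powr a))"

definition one_weight :: "real \<Rightarrow> nat \<Rightarrow> complex \<Rightarrow> ennreal" where
  "one_weight \<nu> N x = epowr (norm x) (2 * \<nu>) / epowr (1 + (norm x)\<^sup>2) (\<nu> + real N + 1)"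

text \<open>
  The integral of \<open>\<Prod>\<^sub>j one_weight (\<nu> j) N (x j)\<close> against \<open>\<delta>(z - \<Prod>\<^sub>j x j)\<close>. The delta function on
  the complex plane is integrated out over \<open>x 1\<close>: with \<open>y = x 2 \<cdots> x n\<close>, it satisfies
  \<open>\<delta>(z - x 1 y) = \<delta>(x 1 - z / y) / \<bar>y\<bar>\<^sup>2\<close>. For \<open>z \<noteq> 0\<close> any other variable
  would give the same value; at \<open>z = 0\<close> the variable \<open>x 1\<close>, for which \<open>\<nu> 1 = 0\<close> and hence
  \<open>one_weight (\<nu> 1) N 0 = 1\<close>, is the choice that gives the continuous \<open>[0,\<infinity>]\<close>-valued function.
\<close>

definition weight :: "nat \<Rightarrow> nat \<Rightarrow> (nat \<Rightarrow> real) \<Rightarrow> complex \<Rightarrow> ennreal" where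
  "weight n N \<nu> z =
     (\<integral>\<^sup>+ x. one_weight (\<nu> 1) N (z / (\<Prod>j\<in>{2..n}. x j)) * (\<Prod>j\<in>{2..n}. one_weight (\<nu> j) N (x j))
             / ennreal ((norm (\<Prod>j\<in>{2..n}. x j))\<^sup>2)
        \<partial>(Pi\<^sub>M {2..n} (\<lambda>_. lborel :: complex measure)))"

lemma weight_1: "\<nu> 1 = 0 \<Longrightarrow> weight 1 N \<nu> z = ennreal (1 / (1 + (norm z)\<^sup>2) ^ (N + 1))"
proof -
  assume "\<nu> 1 = 0"
  have pos: "0 < 1 + (norm z)\<^sup>2"
    by (simp add: add_pos_nonneg)
  have "(1 + (norm z)\<^sup>2) powr (1 + real N) = (1 + (norm z)\<^sup>2) ^ (N + 1)"
    using pos by (metis powr_realpow of_nat_Suc Suc_eq_plus1)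
  moreover have "inverse (ennreal ((1 + (norm z)\<^sup>2) ^ (N + 1))) = ennreal (inverse ((1 + (norm z)\<^sup>2) ^ (N + 1)))"
    using pos by (intro inverse_ennreal zero_less_power)
  ultimately show ?thesis
    using \<open>\<nu> 1 = 0\<close> pos
    by (simp add: weight_def one_weight_def epowr_def PiM_empty nn_integral_count_space_finite
        divide_ennreal_def add.commute inverse_eq_divide)
qed

text \<open>
  The parameters \<open>\<nu> i\<close> are real, so that \<open>\<nu> i = lam i * N\<close> makes sense for all \<open>N\<close>. For \<open>n \<ge> 2\<close> the
  density may be infinite at the origin.
\<close>

definition eigenvalue_density :: "nat \<Rightarrow> nat \<Rightarrow> (nat \<Rightarrow> real) \<Rightarrow> complex \<Rightarrow> ennreal" where
  "eigenvalue_density n N \<nu> z =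
     ennreal (1 / real N) * (weight n N \<nu> z / ennreal (pi ^ n)) *
     (\<Sum>k<N. ennreal (1 / Gamma (real N - real k) ^ n *
        (\<Prod>i\<in>{1..n}. Gamma (\<nu> i + real N + 1) / Gamma (\<nu> i + real k + 1)) * norm z ^ (2 * k)))"

text \<open>
  A Mellin transform determines a rotation-invariant density almost everywhere; continuity
  (as a \<open>[0,\<infinity>]\<close>-valued function) singles out one representative, so that its pointwise values are
  meaningful. Both sides of the Mellin identity are taken in \<open>[0,\<infinity>]\<close>: for \<open>s\<close> sufficiently
  negative they are infinite.
\<close>

definition is_macroscopic_density :: "nat \<Rightarrow> (nat \<Rightarrow> real) \<Rightarrow> (complex \<Rightarrow> ennreal) \<Rightarrow> bool" where
  "is_macroscopic_density n lam \<rho> \<longleftrightarrow>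
     (\<forall>z w. norm z = norm w \<longrightarrow> \<rho> z = \<rho> w) \<and>
     continuous_on UNIV \<rho> \<and>
     (\<forall>z. z \<noteq> 0 \<longrightarrow> \<rho> z < \<infinity>) \<and>
     (\<forall>s::real. s < 1 / real n \<longrightarrow>
        (\<integral>\<^sup>+ z. epowr (norm z) (2 * s) * \<rho> z \<partial>lborel) =
        (\<integral>\<^sup>+ t\<in>{0<..<1}. ennreal (\<Prod>i\<in>{1..n}. (t + lam i) powr s / (1 - t) powr s) \<partial>lborel))"

definition macroscopic_density :: "nat \<Rightarrow> (nat \<Rightarrow> real) \<Rightarrow> complex \<Rightarrow> ennreal" where
  "macroscopic_density n lam = (THE \<rho>. is_macroscopic_density n lam \<rho>)"

end

theory Submission
  imports Defs "HOL-Probability.Probability" "HOL-Complex_Analysis.Complex_Analysis"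
begin

text \<open>
  Up to rotation the density at \<open>z\<close> is \<open>1/N\<close> times a sum over \<open>k < N\<close> of the densities of products
  of independent variables \<open>x\<^sub>j\<close> for which \<open>\<bar>x\<^sub>j\<bar>\<^sup>2\<close> has a beta prime distribution with parameters
  \<open>\<nu>\<^sub>j + k + 1\<close> and \<open>N - k\<close>. In the variable \<open>ln \<bar>z\<bar>\<^sup>2\<close> such a product becomes a convolution of
  log-concave densities, each of which converges to a Gaussian on the scale \<open>N\<^sup>-\<^sup>1\<^sup>/\<^sup>2\<close>; log-concavity
  gives exponential domination, so the convolutions converge as well. With \<open>G t = \<Prod>\<^sub>j (t + \<lambda>\<^sub>j) / (1 - t)\<close>, the \<open>k\<close>-th summand
  is proportional to \<open>\<bar>z\<bar>\<^sup>2\<^sup>k / (G (1/N) \<cdots> G (k/N))\<close>, so the sum over \<open>k\<close> is evaluated by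
  Laplace's method around \<open>k = N t\<close> where \<open>G t = \<bar>z\<bar>\<^sup>2\<close>. The two Gaussian constants combine to the limit
  \<open>1 / (\<pi> G' t)\<close>, the density of \<open>\<bar>z\<bar>\<^sup>2 = G t\<close> for uniform \<open>t\<close>, whose Mellin transform is as required.
  Uniqueness holds because the Mellin transform near \<open>s = 0\<close> extends analytically to a strip and thus
  determines the characteristic function of \<open>ln \<bar>z\<bar>\<^sup>2\<close>. At \<open>z = 0\<close> only \<open>k = 0\<close> contributes and the
  density does not depend on \<open>N\<close>.
\<close>

section \<open>Changes of variables and beta prime densities\<close>

text \<open>The weight is an iterated integral, and rewriting it as a convolution leaves an exponent
  free: for every \<open>\<kappa>\<close> between 0 and N + 1, multiplication by
  \<open>|z|^(2\<kappa>)\<close> turns its factors into beta prime densities. The choice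
  \<open>\<kappa> = k0 + 1\<close>, where \<open>k0\<close> indexes approximately the largest
  summand, places \<open>ln |z|^2\<close> at the centre of the tilted convolution. A central local
  limit then suffices and no large deviation estimate arises; this is the saddle point method in
  probabilistic form. The density becomes one convolution, for \<open>k0\<close>, times a sum of
  ratios to the \<open>k0\<close>-th term. Gamma asymptotics never enter: Gaussian constants come
  from total mass 1, and consecutive coefficients have the exact ratio
  \<open>1 / G ((k + 1) / N)\<close>. Both limits involve the same number S, the derivative of
  \<open>ln G\<close> at t: it is the sum of the variances of the factors and also the curvature of
  the exponent in the sum. The convolution gives \<open>1 / sqrt (2 pi S)\<close>, the sum gives
  \<open>sqrt (2 pi / S)\<close>, and the prefactor \<open>1 / (pi |z|^2)\<close> completes
  \<open>1 / (pi G' t)\<close>, because \<open>G' t = |z|^2 S\<close>.\<close>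

lemma nn_integral_exp_uminus_greaterThan:
  assumes "0 \<le> c"
  shows "(\<integral>\<^sup>+y. ennreal (c * exp (- y)) * indicator {x<..} y \<partial>lborel) = ennreal (c * exp (- x))"
proof -
  have "(\<integral>\<^sup>+y. ennreal (c * exp (- y)) * indicator {x<..} y \<partial>lborel)
      = (\<integral>\<^sup>+y. ennreal (c * exp (- y)) * indicator {x..} y \<partial>lborel)"
    by (intro nn_integral_cong_AE eventually_mono[OF AE_lborel_singleton[of x]])
      (auto simp: indicator_def)
  also have "\<dots> = 0 - (- (c * exp (- x)))"
  proof (rule nn_integral_FTC_atLeast)
    show "((\<lambda>y. - (c * exp (- y))) \<longlongrightarrow> 0) at_top"
      by real_asymp
  qed (use assms in \<open>auto intro!: derivative_eq_intros\<close>)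
  finally show ?thesis by simp
qed

text \<open>The minus sign makes upper half-lines pull back to discs around 0. These have finite
  area, as the comparison of measures on half-lines requires; with the opposite sign they would be
  complements of discs.\<close>

lemma distr_uminus_ln_norm_sq:
  "distr lborel borel (\<lambda>z::complex. - ln ((norm z)\<^sup>2)) = density lborel (\<lambda>x. ennreal (pi * exp (- x)))"
proof (rule measure_eqI_lessThan)
  have 1: "emeasure (distr lborel borel (\<lambda>z::complex. - ln ((norm z)\<^sup>2))) {x<..} = ennreal (pi * exp (- x))" for x
  proof -
    have "emeasure (distr lborel borel (\<lambda>z::complex. - ln ((norm z)\<^sup>2))) {x<..}
       = emeasure lborel {z::complex. - ln ((norm z)\<^sup>2) > x}"
      by (subst emeasure_distr) (auto simp: vimage_def)
    also have "\<dots> = emeasure lborel (ball (0::complex) (exp (- x / 2)))"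
    proof (rule emeasure_eq_AE)
      show "AE z in lborel. (z \<in> {z::complex. - ln ((norm z)\<^sup>2) > x}) = (z \<in> ball 0 (exp (- x / 2)))"
      proof (rule eventually_mono[OF AE_lborel_singleton[of 0]])
        fix z :: complex assume "z \<noteq> 0"
        then have "ln ((norm z)\<^sup>2) = 2 * ln (norm z)" by (simp add: ln_realpow)
        moreover have "ln (norm z) < - x / 2 \<longleftrightarrow> norm z < exp (- x / 2)"
          using \<open>z \<noteq> 0\<close> exp_less_cancel_iff[of "ln (norm z)" "- x / 2"] by simp
        ultimately show "(z \<in> {z::complex. - ln ((norm z)\<^sup>2) > x}) = (z \<in> ball 0 (exp (- x / 2)))"
          by (auto simp: dist_norm)
      qed
    qed auto
    also have "\<dots> = ennreal (pi * exp (- x))"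
      by (simp add: emeasure_ball unit_ball_vol_2 flip: exp_double)
    finally show ?thesis .
  qed
  show "emeasure (distr lborel borel (\<lambda>z::complex. - ln ((norm z)\<^sup>2))) {x<..} < \<infinity>" for x
    by (simp add: 1)
  show "emeasure (distr lborel borel (\<lambda>z::complex. - ln ((norm z)\<^sup>2))) {x<..}
      = emeasure (density lborel (\<lambda>x. ennreal (pi * exp (- x)))) {x<..}" for x
    unfolding 1 by (subst emeasure_density) (auto simp: nn_integral_exp_uminus_greaterThan)
qed auto

text \<open>Polar coordinates in logarithmic form: for a radial integrand the angle contributes a
  constant, and \<open>d^2z\<close> becomes \<open>pi * exp x dx\<close> with
  \<open>x = ln |z|^2\<close>.\<close>

lemma nn_integral_ln_norm_sq:
  assumes [measurable]: "F \<in> borel_measurable borel"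
  shows "(\<integral>\<^sup>+z. F (ln ((norm (z::complex))\<^sup>2)) \<partial>lborel) = (\<integral>\<^sup>+x. ennreal (pi * exp x) * F x \<partial>lborel)"
proof -
  have "(\<integral>\<^sup>+z. F (ln ((norm (z::complex))\<^sup>2)) \<partial>lborel)
      = (\<integral>\<^sup>+x. F (- x) \<partial>distr lborel borel (\<lambda>z::complex. - ln ((norm z)\<^sup>2)))"
    by (subst nn_integral_distr) auto
  also have "\<dots> = (\<integral>\<^sup>+x. ennreal (pi * exp (- x)) * F (- x) \<partial>lborel)"
    unfolding distr_uminus_ln_norm_sq by (subst nn_integral_density) auto
  also have "\<dots> = (\<integral>\<^sup>+x. ennreal (pi * exp x) * F x \<partial>lborel)"
    using nn_integral_real_affine[of "\<lambda>x. ennreal (pi * exp x) * F x" "-1" 0] by simp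
  finally show ?thesis .
qed

text \<open>The two measures are compared on half-lines, which \<open>g\<close> pulls back to the
  intervals from \<open>T x\<close> to 1. Only the inverse \<open>T\<close> is therefore
  differentiated, while \<open>g\<close> is merely measurable.\<close>

lemma nn_integral_substitution_inverse:
  fixes g T T' :: "real \<Rightarrow> real"
  assumes [measurable]: "g \<in> borel_measurable borel" "T' \<in> borel_measurable borel" "F \<in> borel_measurable borel"
    and T: "\<And>x. T x \<in> {0<..<1}" "\<And>t. t \<in> {0<..<1} \<Longrightarrow> T (g t) = t" "strict_mono T"
    and deriv: "\<And>x. (T has_real_derivative T' x) (at x)" and nonneg: "\<And>x. 0 \<le> T' x"
    and lim: "(T \<longlongrightarrow> 1) at_top"
  shows "(\<integral>\<^sup>+t\<in>{0<..<1}. F (g t) \<partial>lborel) = (\<integral>\<^sup>+x. ennreal (T' x) * F x \<partial>lborel)"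
proof -
  let ?M = "distr (density lborel (indicator {0<..<1})) borel g"
  have 1: "emeasure ?M {x<..} = ennreal (1 - T x)" for x
  proof -
    have "emeasure ?M {x<..} = emeasure lborel ({0<..<1} \<inter> {t. x < g t})"
      by (subst emeasure_distr) (auto simp: emeasure_density vimage_def indicator_inter_arith[symmetric])
    also have "{0<..<1} \<inter> {t. x < g t} = {T x<..<1}"
    proof -
      have "x < g t \<longleftrightarrow> T x < t" if "t \<in> {0<..<1}" for t
        using strict_mono_less[OF T(3), of x "g t"] T(2)[OF that] by simp
      then show ?thesis using T(1)[of x] by auto
    qed
    also have "emeasure lborel {T x<..<1} = ennreal (1 - T x)"
      using T(1)[of x] by simp
    finally show ?thesis .
  qed
  have "?M = density lborel (\<lambda>x. ennreal (T' x))"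
  proof (rule measure_eqI_lessThan)
    show "emeasure ?M {x<..} = emeasure (density lborel (\<lambda>x. ennreal (T' x))) {x<..}" for x
    proof -
      have "emeasure (density lborel (\<lambda>x. ennreal (T' x))) {x<..}
          = (\<integral>\<^sup>+y. ennreal (T' y) * indicator {x..} y \<partial>lborel)"
        by (subst emeasure_density)
          (auto simp: indicator_def intro!: nn_integral_cong_AE eventually_mono[OF AE_lborel_singleton[of x]])
      also have "\<dots> = ennreal (1 - T x)"
        by (rule nn_integral_FTC_atLeast) (use deriv nonneg lim in auto)
      finally show ?thesis unfolding 1 by simp
    qed
  qed (auto simp: 1)
  then have "(\<integral>\<^sup>+x. F x \<partial>?M) = (\<integral>\<^sup>+x. ennreal (T' x) * F x \<partial>lborel)"
    by (simp add: nn_integral_density)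
  moreover have "(\<integral>\<^sup>+x. F x \<partial>?M) = (\<integral>\<^sup>+t\<in>{0<..<1}. F (g t) \<partial>lborel)"
    by (simp add: nn_integral_distr nn_integral_density mult.commute)
  ultimately show ?thesis by simp
qed

section \<open>The density of the logarithm of a beta prime variable, equivalently of the logit of a
  beta variable\<close>

definition log_beta_prime :: "real \<Rightarrow> real \<Rightarrow> real \<Rightarrow> real" where
  "log_beta_prime a b x = exp (a * x) / (1 + exp x) powr (a + b) / Beta a b"

lemma measurable_log_beta_prime [measurable]: "log_beta_prime a b \<in> borel_measurable borel"
  unfolding log_beta_prime_def by measurable

lemma Beta_pos: "0 < a \<Longrightarrow> 0 < b \<Longrightarrow> 0 < Beta a (b::real)"
  by (simp add: Beta_def Gamma_real_pos)

lemma log_beta_prime_nonneg: "0 < a \<Longrightarrow> 0 < b \<Longrightarrow> 0 \<le> log_beta_prime a b x"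
  using Beta_pos[of a b] by (simp add: log_beta_prime_def)

lemma nn_integral_log_beta_prime:
  assumes a: "0 < a" and b: "0 < b"
  shows "(\<integral>\<^sup>+x. ennreal (log_beta_prime a b x) \<partial>lborel) = 1"
proof -
  let ?g = "\<lambda>t::real. ln (t / (1 - t))"
  let ?T = "\<lambda>x::real. exp x / (1 + exp x)"
  \<comment> \<open>This is the unnormalised density divided by
    \<open>exp x / (1 + exp x)^2\<close>, the derivative of the logistic function \<open>?T\<close>,
    so that the substitution restores it.\<close>
  let ?F = "\<lambda>x::real. ennreal (exp ((a - 1) * x) / (1 + exp x) powr (a + b - 2))"
  have pos: "0 < 1 + exp x" for x :: real by (simp add: add_pos_pos)
  have "(\<integral>\<^sup>+t\<in>{0<..<1}. ?F (?g t) \<partial>lborel)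
      = (\<integral>\<^sup>+x. ennreal (exp x / (1 + exp x)\<^sup>2) * ?F x \<partial>lborel)"
  proof (rule nn_integral_substitution_inverse[where T = ?T])
    show "(?T \<longlongrightarrow> 1) at_top" by real_asymp
    show "strict_mono ?T"
      unfolding strict_mono_def using pos by (auto simp: divide_simps algebra_simps)
    show "(?T has_real_derivative exp x / (1 + exp x)\<^sup>2) (at x)" for x
      using pos[of x] by (auto intro!: derivative_eq_intros simp: power2_eq_square field_simps)
    show "?T (?g t) = t" if "t \<in> {0<..<1}" for t
      using that by (simp add: field_simps)
    show "?T x \<in> {0<..<1}" for x using pos[of x] by (simp add: field_simps)
  qed auto
  moreover have "(\<integral>\<^sup>+x. ennreal (exp x / (1 + exp x)\<^sup>2) * ?F x \<partial>lborel)
      = (\<integral>\<^sup>+x. ennreal (Beta a b) * ennreal (log_beta_prime a b x) \<partial>lborel)"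
  proof (intro nn_integral_cong)
    fix x :: real
    have "exp x * exp ((a - 1) * x) = exp (a * x)"
      by (simp add: exp_add[symmetric] algebra_simps)
    moreover have "(1 + exp x)\<^sup>2 * (1 + exp x) powr (a + b - 2) = (1 + exp x) powr (a + b)"
      using pos[of x] by (simp add: powr_realpow[symmetric] powr_add[symmetric] del: powr_numeral)
    ultimately have "exp x / (1 + exp x)\<^sup>2 * (exp ((a - 1) * x) / (1 + exp x) powr (a + b - 2))
        = Beta a b * log_beta_prime a b x"
      using Beta_pos[OF a b] by (simp add: log_beta_prime_def)
    then show "ennreal (exp x / (1 + exp x)\<^sup>2) * ?F x = ennreal (Beta a b) * ennreal (log_beta_prime a b x)"
      using Beta_pos[OF a b] log_beta_prime_nonneg[OF a b] by (simp flip: ennreal_mult)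
  qed
  moreover have "(\<integral>\<^sup>+t\<in>{0<..<1}. ?F (?g t) \<partial>lborel) = ennreal (Beta a b)"
  proof -
    have "(\<integral>\<^sup>+t\<in>{0<..<1}. ?F (?g t) \<partial>lborel)
        = (\<integral>\<^sup>+t. ennreal (t powr (a - 1) * (1 - t) powr (b - 1)) * indicator {0..1} t \<partial>lborel)"
    proof (intro nn_integral_cong_AE)
      have eq: "exp ((a - 1) * ?g t) / (1 + exp (?g t)) powr (a + b - 2) = t powr (a - 1) * (1 - t) powr (b - 1)"
        if t: "0 < t" "t < 1" for t
      proof -
        have "exp ((a - 1) * ?g t) = (t / (1 - t)) powr (a - 1)"
          using t by (simp add: powr_def)
        also have "\<dots> = t powr (a - 1) / (1 - t) powr (a - 1)"
          by (rule powr_divide)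
        also have "\<dots> = t powr (a - 1) * (1 - t) powr (- (a - 1))"
          by (simp only: powr_minus divide_inverse)
        finally have 1: "exp ((a - 1) * ?g t) = t powr (a - 1) * (1 - t) powr (- (a - 1))" .
        have "1 + exp (?g t) = inverse (1 - t)" using t by (simp add: field_simps)
        then have 2: "(1 + exp (?g t)) powr (a + b - 2) = inverse ((1 - t) powr (a + b - 2))"
          by (simp only: inverse_powr[symmetric] powr_minus[symmetric] inverse_eq_divide powr_divide powr_one_eq_one)
        have 3: "(1 - t) powr (- (a - 1)) * (1 - t) powr (a + b - 2) = (1 - t) powr (b - 1)"
          by (simp only: powr_add[symmetric]) simp
        show ?thesis
          by (simp only: 1 2) (simp only: divide_inverse inverse_inverse_eq mult.assoc 3)
      qed
      show "AE t in lborel. ?F (?g t) * indicator {0<..<1} t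
          = ennreal (t powr (a - 1) * (1 - t) powr (b - 1)) * indicator {0..1} t"
        by (rule eventually_mono[OF eventually_conj[OF AE_lborel_singleton[of 0] AE_lborel_singleton[of 1]]])
          (use eq in \<open>auto simp: indicator_def\<close>)
    qed
    also have "\<dots> = ennreal (Beta a b)"
      by (rule nn_integral_has_integral_lebesgue'[OF _ has_integral_Beta_real[OF a b]]) simp
    finally show ?thesis .
  qed
  ultimately have "ennreal (Beta a b) * (\<integral>\<^sup>+x. ennreal (log_beta_prime a b x) \<partial>lborel) = ennreal (Beta a b) * 1"
    by (simp add: nn_integral_cmult)
  then show ?thesis
    unfolding ennreal_mult_cancel_left using Beta_pos[OF a b] by (auto simp: ennreal_eq_0_iff)
qed

section \<open>Local limits of convolutions\<close>

text \<open>A two-sided exponential lies below the sum of two reflected one-sided exponential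
  densities of mass 1. The sign of \<open>D\<close> is arbitrary, hence \<open>\<bar>D\<bar>\<close>
  in the bound.\<close>

lemma nn_integral_exp_uminus_abs_finite:
  assumes "0 < d"
  shows "(\<integral>\<^sup>+y. ennreal (D * exp (- d * \<bar>y\<bar>)) \<partial>lborel) < \<infinity>"
proof -
  let ?e = "\<lambda>y. ennreal (exponential_density d y)"
  interpret prob_space "density lborel (exponential_density d)"
    by (rule prob_space_exponential_density[OF assms])
  have 1: "(\<integral>\<^sup>+y. ?e y \<partial>lborel) = 1"
    using emeasure_space_1 by (simp add: emeasure_density)
  have 2: "(\<integral>\<^sup>+y. ?e (- y) \<partial>lborel) = 1"
    using nn_integral_real_affine[of ?e "-1" 0] 1 by simp
  have "(\<integral>\<^sup>+y. ennreal (D * exp (- d * \<bar>y\<bar>)) \<partial>lborel)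
      \<le> (\<integral>\<^sup>+y. ennreal (\<bar>D\<bar> / d) * (?e y + ?e (- y)) \<partial>lborel)"
  proof (rule nn_integral_mono)
    fix y :: real
    have "D * exp (- d * \<bar>y\<bar>) \<le> \<bar>D\<bar> * exp (- d * \<bar>y\<bar>)"
      by (intro mult_right_mono) auto
    also have "\<dots> \<le> (\<bar>D\<bar> / d) * (exponential_density d y + exponential_density d (- y))"
      using assms by (auto simp: exponential_density_def field_simps)
    finally have "ennreal (D * exp (- d * \<bar>y\<bar>))
        \<le> ennreal ((\<bar>D\<bar> / d) * (exponential_density d y + exponential_density d (- y)))"
      by (rule ennreal_leI)
    also have "\<dots> = ennreal (\<bar>D\<bar> / d) * (?e y + ?e (- y))"
      using assms exponential_density_nonneg[OF assms]
      by (subst ennreal_mult) (auto simp: ennreal_plus)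
    finally show "ennreal (D * exp (- d * \<bar>y\<bar>)) \<le> ennreal (\<bar>D\<bar> / d) * (?e y + ?e (- y))" .
  qed
  also have "\<dots> = ennreal (\<bar>D\<bar> / d) * 2"
    by (subst nn_integral_cmult, simp, subst nn_integral_add) (simp_all add: 1 2 one_add_one[symmetric] del: one_add_one)
  also have "\<dots> < \<infinity>" by (simp add: ennreal_mult_less_top)
  finally show ?thesis .
qed

lemma tendsto_inverse_ennreal:
  fixes f :: "'a \<Rightarrow> ennreal"
  assumes "(f \<longlongrightarrow> l) F"
  shows "((\<lambda>x. inverse (f x)) \<longlongrightarrow> inverse l) F"
proof -
  have "continuous_on UNIV (inverse :: ennreal \<Rightarrow> ennreal)"
    by (rule continuous_on_inverse_ennreal) (rule continuous_on_id)
  then show ?thesis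
    by (rule continuous_on_tendsto_compose[OF _ assms]) simp_all
qed

text \<open>Values at -1, 0 and 1 control a concave function everywhere. Beyond 1 it lies below the
  ray from 0 through its value at 1, which has slope at most \<open>- d\<close>; between 0 and 1 it
  lies below the prolonged chord from -1 to 0, hence below \<open>K\<close>. The constant
  \<open>K + d\<close> covers both ranges, and reflection gives the negative side.\<close>

lemma concave_le_uminus_abs:
  fixes U :: "real \<Rightarrow> real"
  assumes conc: "concave_on UNIV U" and "U 0 = 0" "0 < d" "0 \<le> K"
    and "U 1 \<le> - d" "U (-1) \<le> - d" "- K \<le> U 1" "- K \<le> U (-1)"
  shows "U y \<le> K + d - d * \<bar>y\<bar>"
proof -
  have aux: "V y \<le> K + d - d * y"
    if V: "concave_on UNIV V" "V 0 = 0" "V 1 \<le> - d" "- K \<le> V (-1)" "0 \<le> y" for V :: "real \<Rightarrow> real" and y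
  proof (cases "y \<ge> 1")
    case True
    have "V ((1 - 1 / y) *\<^sub>R 0 + (1 / y) *\<^sub>R y) \<ge> (1 - 1 / y) * V 0 + (1 / y) * V y"
      using True by (intro concave_onD[OF V(1)]) auto
    then have "V y \<le> y * V 1" using True V(2) by (simp add: field_simps)
    also have "\<dots> \<le> y * (- d)" using True V(3) by (intro mult_left_mono) auto
    finally show ?thesis using assms(3,4) by (simp add: mult.commute)
  next
    case False
    have "V ((1 - 1 / (1 + y)) *\<^sub>R (-1) + (1 / (1 + y)) *\<^sub>R y)
        \<ge> (1 - 1 / (1 + y)) * V (-1) + (1 / (1 + y)) * V y"
      using V(5) by (intro concave_onD[OF V(1)]) auto
    moreover have "(1 - 1 / (1 + y)) *\<^sub>R (-1) + (1 / (1 + y)) *\<^sub>R y = 0"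
      using V(5) by (simp add: field_simps)
    ultimately have "(1 - 1 / (1 + y)) * V (-1) + (1 / (1 + y)) * V y \<le> 0"
      using V(2) by simp
    also have "(1 - 1 / (1 + y)) * V (-1) + (1 / (1 + y)) * V y = (y * V (-1) + V y) / (1 + y)"
      using V(5) by (simp add: divide_simps)
    finally have "y * V (-1) + V y \<le> 0"
      using V(5) by (simp add: divide_le_0_iff)
    moreover have "y * (- K) \<le> y * V (-1)" by (intro mult_left_mono V)
    moreover have "y * K \<le> 1 * K" using False assms(4) by (intro mult_right_mono) auto
    moreover have "d * y \<le> d * 1" using False assms(3) by (intro mult_left_mono) auto
    ultimately show ?thesis by simp
  qed
  show ?thesis
  proof (cases "y \<ge> 0")
    case True
    then show ?thesis using aux[of U y] assms by simp
  next
    case False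
    have "concave_on UNIV (\<lambda>x. U (- x))"
      unfolding concave_on_iff
    proof (intro conjI ballI allI impI)
      fix x z u v :: real assume "0 \<le> u" "0 \<le> v" "u + v = 1"
      then show "u * U (- x) + v * U (- z) \<le> U (- (u *\<^sub>R x + v *\<^sub>R z))"
        using conc[unfolded concave_on_iff, THEN conjunct2, rule_format, of "- x" "- z" u v] by simp
    qed simp
    then show ?thesis using aux[of "\<lambda>x. U (- x)" "- y"] assms False by simp
  qed
qed

lemma nn_integral_gaussian:
  assumes "0 < \<sigma>"
  shows "(\<integral>\<^sup>+y. ennreal (exp (- y\<^sup>2 / (2 * \<sigma>\<^sup>2))) \<partial>lborel) = ennreal (sqrt (2 * pi * \<sigma>\<^sup>2))"
proof -
  interpret prob_space "density lborel (normal_density 0 \<sigma>)"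
    by (rule prob_space_normal_density[OF assms])
  have 1: "(\<integral>\<^sup>+y. ennreal (normal_density 0 \<sigma> y) \<partial>lborel) = 1"
    using emeasure_space_1 by (simp add: emeasure_density)
  have "ennreal (exp (- y\<^sup>2 / (2 * \<sigma>\<^sup>2))) = ennreal (sqrt (2 * pi * \<sigma>\<^sup>2)) * ennreal (normal_density 0 \<sigma> y)" for y
    using assms by (simp add: normal_density_def flip: ennreal_mult'')
  then show ?thesis
    by (simp add: nn_integral_cmult 1)
qed

text \<open>Concavity upgrades convergence at the two points 1 and -1 to an integrable majorant
  valid for all large N. Dominated convergence then gives the limit of the unnormalised masses, and
  since the total mass is 1 the factor \<open>A N\<close> is the reciprocal mass. Its limit is thus
  obtained without evaluating any normalising constant asymptotically.\<close>

lemma local_limit_concave: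
  fixes U :: "nat \<Rightarrow> real \<Rightarrow> real"
  assumes [measurable]: "\<And>N. U N \<in> borel_measurable borel"
    and conc: "eventually (\<lambda>N. concave_on UNIV (U N)) sequentially"
    and U0: "\<And>N. U N 0 = 0"
    and lim: "\<And>y. (\<lambda>N. U N y) \<longlonglongrightarrow> - y\<^sup>2 / (2 * \<sigma>\<^sup>2)" and \<sigma>: "0 < \<sigma>"
    and A: "eventually (\<lambda>N. (\<integral>\<^sup>+y. ennreal (A N * exp (U N y)) \<partial>lborel) = 1) sequentially"
  shows "\<exists>D d. 0 < d \<and> (\<forall>\<^sub>F N in sequentially. \<forall>y. A N * exp (U N y) \<le> D * exp (- d * \<bar>y\<bar>))"
    and "(\<lambda>N. A N * exp (U N y)) \<longlonglongrightarrow> normal_density 0 \<sigma> y"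
proof -
  \<comment> \<open>The limit of \<open>U N\<close> at 1 and -1 is
    \<open>- 1 / (2 * \<sigma>^2)\<close>. Half and twice its absolute value serve as
    \<open>d\<close> and \<open>K\<close>, so it lies strictly between \<open>- K\<close> and
    \<open>- d\<close>.\<close>
  define d where "d = 1 / (4 * \<sigma>\<^sup>2)"
  define K where "K = 1 / \<sigma>\<^sup>2"
  have d: "0 < d" and K: "0 \<le> K" using \<sigma> by (auto simp: d_def K_def)
  have lim1: "(\<lambda>N. U N 1) \<longlonglongrightarrow> - 2 * d" "(\<lambda>N. U N (-1)) \<longlonglongrightarrow> - 2 * d"
    using lim[of 1] lim[of "-1"] by (auto simp: d_def)
  have "- 2 * d < - d" "- K < - 2 * d" using \<sigma> by (auto simp: d_def K_def field_simps)
  note ev1 = order_tendstoD(2)[OF lim1(1) this(1)] order_tendstoD(2)[OF lim1(2) this(1)]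
    order_tendstoD(1)[OF lim1(1) this(2)] order_tendstoD(1)[OF lim1(2) this(2)]
  have dom: "\<forall>\<^sub>F N in sequentially. \<forall>y. exp (U N y) \<le> exp (K + d) * exp (- d * \<bar>y\<bar>)"
    using ev1 conc
  proof eventually_elim
    case (elim N)
    have "U N y \<le> K + d - d * \<bar>y\<bar>" for y
      by (rule concave_le_uminus_abs) (use elim U0 d K in auto)
    then show ?case by (simp add: exp_add[symmetric])
  qed
  define I where "I = (\<lambda>N. \<integral>\<^sup>+y. ennreal (exp (U N y)) \<partial>lborel)"
  obtain N0 where N0: "\<And>N y. N \<ge> N0 \<Longrightarrow> exp (U N y) \<le> exp (K + d) * exp (- d * \<bar>y\<bar>)"
    using dom by (auto simp: eventually_sequentially)
  have "(\<lambda>N. I (N + N0)) \<longlonglongrightarrow> (\<integral>\<^sup>+y. ennreal (exp (- y\<^sup>2 / (2 * \<sigma>\<^sup>2))) \<partial>lborel)"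
    unfolding I_def
  proof (rule nn_integral_dominated_convergence)
    show "(\<integral>\<^sup>+y. ennreal (exp (K + d) * exp (- d * \<bar>y\<bar>)) \<partial>lborel) < \<infinity>"
      by (rule nn_integral_exp_uminus_abs_finite[OF d])
    show "AE y in lborel. (\<lambda>N. ennreal (exp (U (N + N0) y))) \<longlonglongrightarrow> ennreal (exp (- y\<^sup>2 / (2 * \<sigma>\<^sup>2)))"
      by (intro AE_I2 tendsto_ennrealI tendsto_exp LIMSEQ_ignore_initial_segment lim)
  qed (use N0 in \<open>auto intro!: AE_I2 ennreal_leI\<close>)
  then have I: "I \<longlonglongrightarrow> ennreal (sqrt (2 * pi * \<sigma>\<^sup>2))"
    unfolding nn_integral_gaussian[OF \<sigma>] by (rule LIMSEQ_offset)
  have evA: "\<forall>\<^sub>F N in sequentially. A N = enn2real (inverse (I N))"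
    using A
  proof eventually_elim
    case (elim N)
    \<comment> \<open>Otherwise \<open>ennreal\<close> would truncate the integrand to 0,
      contradicting mass 1.\<close>
    have "0 < A N"
    proof (rule ccontr)
      assume "\<not> 0 < A N"
      then have "ennreal (A N * exp (U N y)) = 0" for y
        by (auto intro!: ennreal_neg mult_nonpos_nonneg)
      then show False using elim by simp
    qed
    then have "ennreal (A N) * I N = 1"
      using elim by (simp add: I_def ennreal_mult' nn_integral_cmult)
    have "ennreal (A N) = inverse (I N)"
    proof (cases "I N")
      case (real i)
      with \<open>ennreal (A N) * I N = 1\<close> \<open>0 < A N\<close> have "A N * i = 1"
        by (simp flip: ennreal_mult)
      moreover have "0 < i"
        using \<open>A N * i = 1\<close> \<open>0 < A N\<close> by (metis mult_zero_right real(1) less_le zero_neq_one)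
      moreover have "A N = inverse i"
        using \<open>A N * i = 1\<close> by (metis inverse_unique mult.commute)
      ultimately show ?thesis
        by (simp add: real inverse_ennreal)
    next
      case top
      with \<open>ennreal (A N) * I N = 1\<close> \<open>0 < A N\<close> show ?thesis
        by (simp add: ennreal_mult_top)
    qed
    then show ?case using \<open>0 < A N\<close> by (metis enn2real_ennreal less_imp_le)
  qed
  have limA: "(\<lambda>N. enn2real (inverse (I N))) \<longlonglongrightarrow> 1 / sqrt (2 * pi * \<sigma>\<^sup>2)"
  proof (rule tendsto_enn2real)
    have "(\<lambda>N. inverse (I N)) \<longlonglongrightarrow> inverse (ennreal (sqrt (2 * pi * \<sigma>\<^sup>2)))"
      by (rule tendsto_inverse_ennreal[OF I])
    then show "(\<lambda>N. inverse (I N)) \<longlonglongrightarrow> ennreal (1 / sqrt (2 * pi * \<sigma>\<^sup>2))"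
      using \<sigma> by (simp add: inverse_ennreal inverse_eq_divide)
  qed auto
  have Alim: "A \<longlonglongrightarrow> 1 / sqrt (2 * pi * \<sigma>\<^sup>2)"
    using limA unfolding tendsto_cong[OF evA] .
  show "(\<lambda>N. A N * exp (U N y)) \<longlonglongrightarrow> normal_density 0 \<sigma> y"
    unfolding normal_density_def using Alim lim[of y]
    by (intro tendsto_mult tendsto_exp) auto
  have "\<forall>\<^sub>F N in sequentially. A N < 1 / sqrt (2 * pi * \<sigma>\<^sup>2) + 1"
    by (rule order_tendstoD(2)[OF Alim]) simp
  then have "\<forall>\<^sub>F N in sequentially. \<forall>y. A N * exp (U N y)
      \<le> ((1 / sqrt (2 * pi * \<sigma>\<^sup>2) + 1) * exp (K + d)) * exp (- d * \<bar>y\<bar>)"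
    using dom
  proof eventually_elim
    case (elim N)
    have "A N * exp (U N y) \<le> (1 / sqrt (2 * pi * \<sigma>\<^sup>2) + 1) * (exp (K + d) * exp (- d * \<bar>y\<bar>))" for y
      using elim by (intro mult_mono) auto
    then show ?case by (simp add: mult.assoc)
  qed
  then show "\<exists>D d. 0 < d \<and> (\<forall>\<^sub>F N in sequentially. \<forall>y. A N * exp (U N y) \<le> D * exp (- d * \<bar>y\<bar>))"
    using d by blast
qed

section \<open>Iterated convolutions, the densities of sums of \<open>m + 1\<close> independent
  variables\<close>

primrec conv_iter :: "(nat \<Rightarrow> real \<Rightarrow> ennreal) \<Rightarrow> nat \<Rightarrow> real \<Rightarrow> ennreal" where
  "conv_iter g 0 = g 0"
| "conv_iter g (Suc m) = (\<lambda>x. \<integral>\<^sup>+y. conv_iter g m (x - y) * g (Suc m) y \<partial>lborel)"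

lemma measurable_conv_iter [measurable (raw)]:
  assumes "\<And>j. g j \<in> borel_measurable borel"
  shows "conv_iter g m \<in> borel_measurable borel"
proof (induction m)
  case (Suc m)
  note [measurable] = Suc assms
  show ?case by simp
qed (simp add: assms)

text \<open>Standardising every summand by its own centre \<open>c j\<close> and the common scale
  \<open>s\<close> standardises the sum by the total centre. Each variable of integration absorbs
  one Jacobian \<open>s\<close>, so one of the \<open>m + 1\<close> factors remains.\<close>

lemma conv_iter_scale:
  assumes [measurable]: "\<And>j. g j \<in> borel_measurable borel" and "0 < s"
  shows "conv_iter (\<lambda>j y. ennreal s * g j (c j + s * y)) m x
    = ennreal s * conv_iter g m ((\<Sum>j\<le>m. c j) + s * x)"
proof (induction m arbitrary: x)
  case (Suc m)
  have [measurable]: "conv_iter g k \<in> borel_measurable borel" for k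
    by (rule measurable_conv_iter) simp
  have "conv_iter g (Suc m) ((\<Sum>j\<le>Suc m. c j) + s * x)
      = (\<integral>\<^sup>+y. conv_iter g m ((\<Sum>j\<le>Suc m. c j) + s * x - y) * g (Suc m) y \<partial>lborel)"
    by simp
  also have "\<dots> = ennreal s * (\<integral>\<^sup>+y. conv_iter g m ((\<Sum>j\<le>Suc m. c j) + s * x - (c (Suc m) + s * y))
      * g (Suc m) (c (Suc m) + s * y) \<partial>lborel)"
    using \<open>0 < s\<close> by (subst nn_integral_real_affine[where c = s and t = "c (Suc m)"]) auto
  also have "\<dots> = (\<integral>\<^sup>+y. ennreal s * (conv_iter g m ((\<Sum>j\<le>m. c j) + s * (x - y))
      * g (Suc m) (c (Suc m) + s * y)) \<partial>lborel)"
    by (subst nn_integral_cmult[symmetric]) (auto simp: algebra_simps)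
  finally have eq: "conv_iter g (Suc m) ((\<Sum>j\<le>Suc m. c j) + s * x) = \<dots>" .
  have "conv_iter (\<lambda>j y. ennreal s * g j (c j + s * y)) (Suc m) x
      = (\<integral>\<^sup>+y. ennreal s * (ennreal s * (conv_iter g m ((\<Sum>j\<le>m. c j) + s * (x - y))
      * g (Suc m) (c (Suc m) + s * y))) \<partial>lborel)"
    by (simp only: conv_iter.simps Suc) (simp only: mult_ac)
  also have "\<dots> = ennreal s * conv_iter g (Suc m) ((\<Sum>j\<le>Suc m. c j) + s * x)"
    unfolding eq by (subst nn_integral_cmult) auto
  finally show ?case .
qed simp

text \<open>The induction must carry a uniform bound along with the pointwise limit. That bound for
  the first factors, times the exponential bound for the new one, is an integrable majorant
  independent of \<open>x\<close>; it yields both the limit and the next uniform bound. Variances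
  add because convolutions of centred normal densities are normal.\<close>

lemma tendsto_conv_iter:
  fixes g :: "nat \<Rightarrow> nat \<Rightarrow> real \<Rightarrow> ennreal"
  assumes meas[measurable]: "\<And>N j. g N j \<in> borel_measurable borel"
    and dom: "\<And>j. j \<le> m \<Longrightarrow> \<exists>D d. 0 < d \<and> (\<forall>\<^sub>F N in sequentially. \<forall>y. g N j y \<le> ennreal (D * exp (- d * \<bar>y\<bar>)))"
    and lim: "\<And>j y. j \<le> m \<Longrightarrow> (\<lambda>N. g N j y) \<longlonglongrightarrow> ennreal (normal_density 0 (\<sigma> j) y)"
    and \<sigma>: "\<And>j. 0 < \<sigma> j"
  shows "(\<exists>C. \<forall>\<^sub>F N in sequentially. \<forall>x. conv_iter (g N) m x \<le> ennreal C) \<and>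
    (\<forall>x. (\<lambda>N. conv_iter (g N) m x) \<longlonglongrightarrow> ennreal (normal_density 0 (sqrt (\<Sum>j\<le>m. (\<sigma> j)\<^sup>2)) x))"
  using dom lim
proof (induction m)
  case 0
  obtain D d where "0 < d" "\<forall>\<^sub>F N in sequentially. \<forall>y. g N 0 y \<le> ennreal (D * exp (- d * \<bar>y\<bar>))"
    using 0(1)[of 0] by auto
  then have "\<forall>\<^sub>F N in sequentially. \<forall>y. g N 0 y \<le> ennreal \<bar>D\<bar>"
  proof (elim eventually_mono, intro allI)
    fix N y assume "\<forall>y. g N 0 y \<le> ennreal (D * exp (- d * \<bar>y\<bar>))"
    moreover have "D * exp (- d * \<bar>y\<bar>) \<le> \<bar>D\<bar> * 1"
      using \<open>0 < d\<close> by (intro mult_mono) auto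
    ultimately show "g N 0 y \<le> ennreal \<bar>D\<bar>"
      by (metis ennreal_leI mult.right_neutral order_trans)
  qed
  then show ?case using 0(2)[of 0] \<sigma>[of 0] by auto
next
  case (Suc m)
  obtain C where C: "\<forall>\<^sub>F N in sequentially. \<forall>x. conv_iter (g N) m x \<le> ennreal C"
    and IH: "\<And>x. (\<lambda>N. conv_iter (g N) m x) \<longlonglongrightarrow> ennreal (normal_density 0 (sqrt (\<Sum>j\<le>m. (\<sigma> j)\<^sup>2)) x)"
    using Suc.IH Suc.prems by auto
  obtain D d where d: "0 < d"
    and D: "\<forall>\<^sub>F N in sequentially. \<forall>y. g N (Suc m) y \<le> ennreal (D * exp (- d * \<bar>y\<bar>))"
    using Suc.prems(1)[of "Suc m"] by auto
  obtain N0 where N0: "\<And>N x. N \<ge> N0 \<Longrightarrow> conv_iter (g N) m x \<le> ennreal C"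
      "\<And>N y. N \<ge> N0 \<Longrightarrow> g N (Suc m) y \<le> ennreal (D * exp (- d * \<bar>y\<bar>))"
    using eventually_conj[OF C D] by (auto simp: eventually_sequentially)
  let ?w = "\<lambda>y. ennreal C * ennreal (D * exp (- d * \<bar>y\<bar>))"
  have fin: "(\<integral>\<^sup>+y. ?w y \<partial>lborel) < \<infinity>"
    using nn_integral_exp_uminus_abs_finite[OF d, of D]
    by (subst nn_integral_cmult) (auto simp: ennreal_mult_less_top)
  have bd: "conv_iter (g N) m (x - y) * g N (Suc m) y \<le> ?w y" if "N \<ge> N0" for N x y
    using N0 that by (intro mult_mono) auto
  have "\<exists>C. \<forall>\<^sub>F N in sequentially. \<forall>x. conv_iter (g N) (Suc m) x \<le> ennreal C"
  proof (intro exI[of _ "enn2real (\<integral>\<^sup>+y. ?w y \<partial>lborel)"] eventually_sequentiallyI[of N0] allI)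
    fix N x assume "N0 \<le> N"
    then have "conv_iter (g N) (Suc m) x \<le> (\<integral>\<^sup>+y. ?w y \<partial>lborel)"
      using bd by (auto intro!: nn_integral_mono)
    then show "conv_iter (g N) (Suc m) x \<le> ennreal (enn2real (\<integral>\<^sup>+y. ?w y \<partial>lborel))"
      using fin by simp
  qed
  moreover have "(\<lambda>N. conv_iter (g N) (Suc m) x) \<longlonglongrightarrow> ennreal (normal_density 0 (sqrt (\<Sum>j\<le>Suc m. (\<sigma> j)\<^sup>2)) x)" for x
  proof -
    let ?s = "sqrt (\<Sum>j\<le>m. (\<sigma> j)\<^sup>2)"
    have [measurable]: "conv_iter (g N) k \<in> borel_measurable borel" for N k
      by (rule measurable_conv_iter) simp
    have s: "0 < ?s" by (intro real_sqrt_gt_zero sum_pos zero_less_power \<sigma>) auto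
    have "(\<lambda>N. conv_iter (g (N + N0)) (Suc m) x) \<longlonglongrightarrow>
       (\<integral>\<^sup>+y. ennreal (normal_density 0 ?s (x - y)) * ennreal (normal_density 0 (\<sigma> (Suc m)) y) \<partial>lborel)"
      unfolding conv_iter.simps
    proof (rule nn_integral_dominated_convergence[where w = ?w])
      show "AE y in lborel. (\<lambda>N. conv_iter (g (N + N0)) m (x - y) * g (N + N0) (Suc m) y) \<longlonglongrightarrow>
          ennreal (normal_density 0 ?s (x - y)) * ennreal (normal_density 0 (\<sigma> (Suc m)) y)"
        by (intro AE_I2 tendsto_mult_ennreal LIMSEQ_ignore_initial_segment IH Suc.prems(2)) auto
    qed (use fin bd in \<open>auto intro!: AE_I2\<close>)
    also have "(\<integral>\<^sup>+y. ennreal (normal_density 0 ?s (x - y)) * ennreal (normal_density 0 (\<sigma> (Suc m)) y) \<partial>lborel)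
        = ennreal (normal_density 0 (sqrt (?s\<^sup>2 + (\<sigma> (Suc m))\<^sup>2)) x)"
      using fun_cong[OF conv_normal_density_zero_mean[OF s \<sigma>[of "Suc m"]], of x]
      by (simp add: ennreal_mult)
    also have "?s\<^sup>2 + (\<sigma> (Suc m))\<^sup>2 = (\<Sum>j\<le>Suc m. (\<sigma> j)\<^sup>2)"
      by (simp add: sum_nonneg)
    finally show ?thesis by (rule LIMSEQ_offset)
  qed
  ultimately show ?case by blast
qed

section \<open>Uniqueness from the moment generating function\<close>

lemma mgf_integrable:
  assumes [measurable_cong, simp]: "sets M = sets borel"
    and fin: "\<And>s::real. \<bar>s\<bar> \<le> d \<Longrightarrow> (\<integral>\<^sup>+x. ennreal (exp (s * x)) \<partial>M) < \<infinity>"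
    and "\<bar>Re z\<bar> \<le> d"
  shows "integrable M (\<lambda>x::real. exp (z * of_real x) :: complex)"
proof (rule integrableI_bounded)
  have "(\<integral>\<^sup>+x. ennreal (norm (exp (z * of_real x) :: complex)) \<partial>M) = (\<integral>\<^sup>+x. ennreal (exp (Re z * x)) \<partial>M)"
    by simp
  also have "\<dots> < \<infinity>" by (rule fin) fact
  finally show "(\<integral>\<^sup>+x. ennreal (norm (exp (z * of_real x) :: complex)) \<partial>M) < \<infinity>" .
qed simp

text \<open>The mean value inequality on a disc. The factor \<open>norm w\<close> later cancels the
  denominator of a difference quotient.\<close>

lemma norm_exp_minus_one_le:
  fixes w :: complex
  shows "norm (exp w - 1) \<le> norm w * exp (norm w)"
proof -
  have "norm (exp w - exp 0) \<le> exp (norm w) * norm (w - 0)"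
  proof (rule field_differentiable_bound[where S = "cball 0 (norm w)" and f' = exp])
    fix u :: complex assume u: "u \<in> cball 0 (norm w)"
    show "(exp has_field_derivative exp u) (at u within cball 0 (norm w))"
      by (auto intro!: derivative_eq_intros)
    have "Re u \<le> norm w" using u complex_Re_le_cmod[of u] by simp
    then show "norm (exp u) \<le> exp (norm w)" by simp
  qed auto
  then show ?thesis by (simp add: mult.commute)
qed

text \<open>Differentiation under the integral sign by dominated convergence along an arbitrary
  sequence tending to \<open>z\<close>. The majorant is a multiple of
  \<open>exp (d * x) + exp (- d * x)\<close>, integrable by the finiteness at the two
  endpoints.\<close>

lemma mgf_has_field_derivative:
  fixes M :: "real measure" and z :: complex
  assumes sets[measurable_cong, simp]: "sets M = sets borel"
    and fin: "\<And>s::real. \<bar>s\<bar> \<le> d \<Longrightarrow> (\<integral>\<^sup>+x. ennreal (exp (s * x)) \<partial>M) < \<infinity>"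
    and z: "\<bar>Re z\<bar> < d"
  shows "((\<lambda>z. \<integral>x. exp (z * of_real x) \<partial>M) has_field_derivative (\<integral>x. of_real x * exp (z * of_real x) \<partial>M)) (at z)"
  unfolding has_field_derivative_iff tendsto_at_iff_sequentially o_def
proof (intro allI impI)
  fix y :: "nat \<Rightarrow> complex"
  assume y: "\<forall>i. y i \<in> UNIV - {z}" "y \<longlonglongrightarrow> z"
  \<comment> \<open>The distance of \<open>z\<close> from the edge of the strip is spent twice: one
    \<open>e\<close> bounds the increment \<open>h i\<close>, the other absorbs the factor
    \<open>\<bar>x\<bar>\<close> through
    \<open>\<bar>x\<bar> \<le> exp (e * \<bar>x\<bar>) / e\<close>.\<close>
  define e where "e = (d - \<bar>Re z\<bar>) / 2"
  have e: "0 < e" "\<bar>Re z\<bar> + 2 * e = d" using z by (auto simp: e_def field_simps)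
  let ?F = "\<lambda>z. \<integral>x. exp (z * of_real x) \<partial>M"
  have "\<forall>\<^sub>F i in sequentially. dist (y i) z < e"
    using y(2) e(1) by (rule tendstoD)
  then obtain i0 where i0: "\<And>i. i \<ge> i0 \<Longrightarrow> norm (y i - z) < e"
    by (auto simp: eventually_sequentially dist_norm)
  define h where "h = (\<lambda>i. y (i + i0) - z)"
  have h: "\<And>i. h i \<noteq> 0" "\<And>i. norm (h i) < e" using y(1) i0 by (auto simp: h_def)
  have hlim: "h \<longlonglongrightarrow> 0"
    unfolding h_def using LIMSEQ_ignore_initial_segment[OF y(2), of i0] by (simp add: LIM_zero)
  let ?D = "\<lambda>i x. exp (z * of_real x) * ((exp (h i * of_real x) - 1) / h i) :: complex"
  let ?w = "\<lambda>x. (1 / e) * (exp (d * x) + exp (- d * x))"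
  have int: "integrable M (\<lambda>x. exp (u * of_real x) :: complex)" if "\<bar>Re u\<bar> \<le> d" for u
    by (rule mgf_integrable[OF sets fin that])
  have lim: "(\<lambda>i. \<integral>x. ?D i x \<partial>M) \<longlonglongrightarrow> (\<integral>x. of_real x * exp (z * of_real x) \<partial>M)"
  proof (rule integral_dominated_convergence[where w = ?w])
    have "integrable M (\<lambda>x. Re (exp (of_real d * of_real x) :: complex))"
      "integrable M (\<lambda>x. Re (exp (of_real (- d) * of_real x) :: complex))"
      using e by (intro integrable_Re int; simp)+
    then show "integrable M ?w" by (simp add: Re_exp)
    show "AE x in M. (\<lambda>i. ?D i x) \<longlonglongrightarrow> of_real x * exp (z * of_real x)"
    proof (intro AE_I2)
      fix x :: real
      have "((\<lambda>w. exp (w * of_real x)) has_field_derivative of_real x) (at (0::complex))"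
        by (auto intro!: derivative_eq_intros)
      then have "((\<lambda>w. (exp (w * of_real x) - 1) / w) \<longlongrightarrow> of_real x) (at (0::complex))"
        by (simp add: has_field_derivative_iff)
      then have "(\<lambda>i. (exp (h i * of_real x) - 1) / h i) \<longlonglongrightarrow> of_real x"
        using hlim h(1) by (auto simp: tendsto_at_iff_sequentially o_def)
      then have "(\<lambda>i. ?D i x) \<longlonglongrightarrow> exp (z * of_real x) * of_real x"
        by (intro tendsto_mult tendsto_const)
      then show "(\<lambda>i. ?D i x) \<longlonglongrightarrow> of_real x * exp (z * of_real x)"
        by (simp add: mult.commute)
    qed
    show "AE x in M. norm (?D i x) \<le> ?w x" for i
    proof (intro AE_I2)
      fix x :: real
      have "norm ((exp (h i * of_real x) - 1) / h i) \<le> \<bar>x\<bar> * exp (norm (h i) * \<bar>x\<bar>)"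
        using norm_exp_minus_one_le[of "h i * of_real x"] h(1)[of i]
        by (simp add: norm_divide norm_mult divide_simps mult_ac)
      also have "\<dots> \<le> (1 / e * exp (e * \<bar>x\<bar>)) * exp (e * \<bar>x\<bar>)"
      proof (intro mult_mono)
        have "e * \<bar>x\<bar> \<le> exp (e * \<bar>x\<bar>)" using exp_ge_add_one_self[of "e * \<bar>x\<bar>"] by linarith
        then show "\<bar>x\<bar> \<le> 1 / e * exp (e * \<bar>x\<bar>)" using e by (simp add: field_simps)
        show "exp (norm (h i) * \<bar>x\<bar>) \<le> exp (e * \<bar>x\<bar>)"
          using h(2)[of i] by (simp add: mult_right_mono)
      qed (use e in auto)
      finally have 1: "norm ((exp (h i * of_real x) - 1) / h i) \<le> 1 / e * exp (2 * e * \<bar>x\<bar>)"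
        by (simp add: exp_add[symmetric] mult.assoc)
      have "Re z * x \<le> \<bar>Re z\<bar> * \<bar>x\<bar>" by (metis abs_ge_self abs_mult)
      then have 2: "norm (exp (z * of_real x)) \<le> exp (\<bar>Re z\<bar> * \<bar>x\<bar>)" by simp
      have "norm (?D i x) \<le> exp (\<bar>Re z\<bar> * \<bar>x\<bar>) * (1 / e * exp (2 * e * \<bar>x\<bar>))"
        unfolding norm_mult by (intro mult_mono 1 2) auto
      also have "\<dots> = 1 / e * exp (d * \<bar>x\<bar>)"
        by (simp add: e(2)[symmetric] exp_add[symmetric] algebra_simps)
      also have "\<dots> \<le> ?w x"
        using e by (intro mult_left_mono) (auto simp: abs_if)
      finally show "norm (?D i x) \<le> ?w x" .
    qed
  qed simp_all
  have eq: "(\<integral>x. ?D i x \<partial>M) = (?F (y (i + i0)) - ?F z) / (y (i + i0) - z)" for i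
  proof -
    have "\<bar>Re (y (i + i0))\<bar> \<le> \<bar>Re z\<bar> + \<bar>Re (h i)\<bar>" by (simp add: h_def)
    also have "\<dots> \<le> d" using abs_Re_le_cmod[of "h i"] h(2)[of i] e by linarith
    finally have "\<bar>Re (y (i + i0))\<bar> \<le> d" .
    moreover have "\<bar>Re z\<bar> \<le> d" using z by simp
    ultimately have "(?F (y (i + i0)) - ?F z) / h i
        = (\<integral>x. (exp (y (i + i0) * of_real x) - exp (z * of_real x)) / h i \<partial>M)"
      using int by (subst Bochner_Integration.integral_diff[symmetric]) auto
    also have "\<dots> = (\<integral>x. ?D i x \<partial>M)"
    proof (intro Bochner_Integration.integral_cong refl)
      fix x
      have "y (i + i0) * of_real x = z * of_real x + h i * of_real x" by (simp add: h_def algebra_simps)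
      then show "(exp (y (i + i0) * of_real x) - exp (z * of_real x)) / h i = ?D i x"
        by (simp add: exp_add algebra_simps)
    qed
    finally show ?thesis unfolding h_def by (rule sym)
  qed
  show "(\<lambda>i. (?F (y i) - ?F z) / (y i - z)) \<longlonglongrightarrow> (\<integral>x. of_real x * exp (z * of_real x) \<partial>M)"
    by (rule LIMSEQ_offset[where k = i0], rule lim[unfolded eq])
qed

text \<open>Finiteness on both sides of 0 puts the imaginary axis inside the strip of holomorphy.
  Probability is assumed of \<open>M1\<close> alone: the equality at \<open>s = 0\<close> gives
  \<open>M2\<close> mass 1.\<close>

lemma mgf_unique:
  fixes M1 M2 :: "real measure"
  assumes sets: "sets M1 = sets borel" "sets M2 = sets borel" and d: "0 < d"
    and fin: "\<And>s::real. \<bar>s\<bar> \<le> d \<Longrightarrow> (\<integral>\<^sup>+x. ennreal (exp (s * x)) \<partial>M1) < \<infinity>"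
    and eq: "\<And>s::real. \<bar>s\<bar> \<le> d \<Longrightarrow> (\<integral>\<^sup>+x. ennreal (exp (s * x)) \<partial>M1) = (\<integral>\<^sup>+x. ennreal (exp (s * x)) \<partial>M2)"
    and prob: "prob_space M1"
  shows "M1 = M2"
proof (rule Levy_uniqueness)
  have [simp]: "space M1 = UNIV" "space M2 = UNIV" using sets by (auto dest: sets_eq_imp_space_eq)
  show 1: "real_distribution M1"
    using prob sets by (simp add: real_distribution_def real_distribution_axioms_def)
  have "emeasure M2 (space M2) = 1"
    using eq[of 0] d prob_space.emeasure_space_1[OF prob] by simp
  then show "real_distribution M2"
    using sets by (auto simp: real_distribution_def real_distribution_axioms_def intro!: prob_spaceI)
  have fin2: "\<bar>s\<bar> \<le> d \<Longrightarrow> (\<integral>\<^sup>+x. ennreal (exp (s * x)) \<partial>M2) < \<infinity>" for s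
    using fin eq by metis
  let ?S = "{z. - d < Re z} \<inter> {z. Re z < d}"
  let ?F = "\<lambda>M z. \<integral>x. exp (z * of_real x) \<partial>M :: complex"
  have "open ?S" by (intro open_Int open_halfspace_Re_gt open_halfspace_Re_lt)
  have "convex ?S" by (intro convex_Int convex_halfspace_Re_gt convex_halfspace_Re_lt)
  have hol: "?F M holomorphic_on ?S"
    if "sets M = sets borel" "\<And>s::real. \<bar>s\<bar> \<le> d \<Longrightarrow> (\<integral>\<^sup>+x. ennreal (exp (s * x)) \<partial>M) < \<infinity>" for M
    unfolding holomorphic_on_open[OF \<open>open ?S\<close>]
    by (intro ballI exI, rule mgf_has_field_derivative[where d = d]) (use that in auto)
  \<comment> \<open>The identity theorem applies because the difference vanishes on a real segment
    accumulating at 0.\<close>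
  have 0: "?F M1 z - ?F M2 z = 0" if "z \<in> ?S" for z
  proof (rule analytic_continuation[of "\<lambda>z. ?F M1 z - ?F M2 z" ?S "of_real ` {-d<..<d}" 0])
    show "(\<lambda>z. ?F M1 z - ?F M2 z) holomorphic_on ?S"
      by (intro holomorphic_intros hol sets fin fin2)
    show "connected ?S" by (rule convex_connected) fact
    show "0 islimpt complex_of_real ` {-d<..<d}"
      unfolding islimpt_approachable
    proof (intro allI impI)
      fix e :: real assume "e > 0"
      obtain r where "0 < r" "r < min d e" using dense[of 0 "min d e"] d \<open>e > 0\<close> by auto
      then show "\<exists>x'\<in>complex_of_real ` {-d<..<d}. x' \<noteq> 0 \<and> dist x' 0 < e"
        by (intro bexI[of _ "of_real r"] conjI imageI) auto
    qed
    show "?F M1 w - ?F M2 w = 0" if w: "w \<in> complex_of_real ` {-d<..<d}" for w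
    proof -
      obtain s where s: "w = of_real s" "\<bar>s\<bar> \<le> d" using w by auto
      have *: "?F M w = of_real (enn2real (\<integral>\<^sup>+x. ennreal (exp (s * x)) \<partial>M))"
        if [measurable_cong]: "sets M = sets borel" for M
      proof -
        have "?F M w = (\<integral>x. of_real (exp (s * x)) \<partial>M)"
          by (simp add: s exp_of_real[symmetric])
        also have "\<dots> = of_real (\<integral>x. exp (s * x) \<partial>M)" by (rule integral_complex_of_real)
        also have "(\<integral>x. exp (s * x) \<partial>M) = enn2real (\<integral>\<^sup>+x. ennreal (exp (s * x)) \<partial>M)"
          by (rule integral_eq_nn_integral) auto
        finally show ?thesis .
      qed
      show ?thesis by (simp add: *[OF sets(1)] *[OF sets(2)] eq[OF s(2)])
    qed
  qed (use \<open>open ?S\<close> that d in auto)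
  show "char M1 = char M2"
  proof
    fix t
    have "?F M1 (\<i> * of_real t) = ?F M2 (\<i> * of_real t)"
      using 0[of "\<i> * of_real t"] d by simp
    then show "char M1 t = char M2 t"
      by (simp add: char_def mult_ac)
  qed
qed

section \<open>The weight function\<close>

lemma measurable_epowr [measurable]: "(\<lambda>x. epowr x a) \<in> borel_measurable borel"
  unfolding epowr_def by measurable

lemma measurable_one_weight [measurable]: "one_weight \<nu> N \<in> borel_measurable borel"
  unfolding one_weight_def by measurable

lemma one_weight_eq:
  assumes "z \<noteq> 0"
  shows "one_weight \<nu> N z = ennreal (((norm z)\<^sup>2) powr \<nu> / (1 + (norm z)\<^sup>2) powr (\<nu> + real N + 1))"
proof -
  have "norm z powr (2 * \<nu>) = ((norm z)\<^sup>2) powr \<nu>"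
    using assms by (simp add: powr_powr[symmetric] powr_numeral)
  moreover have "1 + (norm z)\<^sup>2 \<noteq> 0" by (metis add_pos_nonneg less_irrefl zero_le_power2 zero_less_one)
  ultimately show ?thesis
    using assms by (simp add: one_weight_def epowr_def divide_ennreal powr_gt_zero)
qed

text \<open>A multiplicative convolution: the last variable is integrated outermost, the remaining
  ones see the target \<open>z / y\<close>, and \<open>1 / |y|^2\<close> is its share of the
  Jacobian of the delta function. The point \<open>y = 0\<close> is discarded as a null set.\<close>

lemma weight_Suc:
  assumes "1 \<le> m"
  shows "weight (Suc m) N \<nu> z
    = (\<integral>\<^sup>+y. weight m N \<nu> (z / y) * (one_weight (\<nu> (Suc m)) N y / ennreal ((norm y)\<^sup>2)) \<partial>lborel)"
proof -
  interpret product_sigma_finite "\<lambda>_::nat. lborel :: complex measure" ..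
  let ?f = "\<lambda>m z x. one_weight (\<nu> 1) N (z / (\<Prod>j\<in>{2..m}. x j)) * (\<Prod>j\<in>{2..m}. one_weight (\<nu> j) N (x j))
             / ennreal ((norm (\<Prod>j\<in>{2..m}. x j))\<^sup>2)"
  have ins: "{2..Suc m} = insert (Suc m) {2..m}" using assms by auto
  have "weight (Suc m) N \<nu> z
      = (\<integral>\<^sup>+y. (\<integral>\<^sup>+x. ?f (Suc m) z (x(Suc m := y)) \<partial>Pi\<^sub>M {2..m} (\<lambda>_. lborel)) \<partial>lborel)"
    unfolding weight_def ins by (rule product_nn_integral_insert_rev) auto
  also have "\<dots> = (\<integral>\<^sup>+y. weight m N \<nu> (z / y) * (one_weight (\<nu> (Suc m)) N y / ennreal ((norm y)\<^sup>2)) \<partial>lborel)"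
  proof (rule nn_integral_cong_AE, rule eventually_mono[OF AE_lborel_singleton[of 0]])
    fix y :: complex assume y: "y \<noteq> 0"
    have *: "?f (Suc m) z (x(Suc m := y))
        = ?f m (z / y) x * (one_weight (\<nu> (Suc m)) N y / ennreal ((norm y)\<^sup>2))" for x
    proof -
      have 1: "(\<Prod>j\<in>{2..Suc m}. (x(Suc m := y)) j) = y * (\<Prod>j\<in>{2..m}. x j)"
        unfolding ins by (subst prod.insert) (auto intro!: arg_cong2[where f = "(*)"] prod.cong)
      have 2: "(\<Prod>j\<in>{2..Suc m}. one_weight (\<nu> j) N ((x(Suc m := y)) j))
          = one_weight (\<nu> (Suc m)) N y * (\<Prod>j\<in>{2..m}. one_weight (\<nu> j) N (x j))"
        unfolding ins by (subst prod.insert) (auto intro!: arg_cong2[where f = "(*)"] prod.cong)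
      have 3: "inverse (ennreal ((norm (y * (\<Prod>j\<in>{2..m}. x j)))\<^sup>2))
          = inverse (ennreal ((norm y)\<^sup>2)) * inverse (ennreal ((norm (\<Prod>j\<in>{2..m}. x j))\<^sup>2))"
        by (simp add: norm_mult power_mult_distrib ennreal_mult ennreal_inverse_mult)
      have 4: "z / (y * (\<Prod>j\<in>{2..m}. x j)) = z / y / (\<Prod>j\<in>{2..m}. x j)" by simp
      show ?thesis
        unfolding 1 2 divide_ennreal_def 3 4 by (simp only: mult_ac)
    qed
    show "(\<integral>\<^sup>+x. ?f (Suc m) z (x(Suc m := y)) \<partial>Pi\<^sub>M {2..m} (\<lambda>_. lborel))
        = weight m N \<nu> (z / y) * (one_weight (\<nu> (Suc m)) N y / ennreal ((norm y)\<^sup>2))"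
      unfolding * weight_def by (rule nn_integral_multc) measurable
  qed
  finally show ?thesis .
qed

lemma weight_one: "weight 1 N \<nu> z = one_weight (\<nu> 1) N z"
  by (simp add: weight_def PiM_empty nn_integral_count_space_finite divide_ennreal_def)

lemma measurable_weight [measurable]: "weight m N \<nu> \<in> borel_measurable borel"
proof -
  interpret product_sigma_finite "\<lambda>_::nat. lborel :: complex measure" ..
  interpret sigma_finite_measure "Pi\<^sub>M {2..m} (\<lambda>_::nat. lborel :: complex measure)"
    by (rule sigma_finite) simp
  show ?thesis
    unfolding weight_def by measurable
qed

text \<open>Exponential tilting. The power \<open>|z|^(2\<kappa>)\<close> moves
  \<open>\<kappa>\<close> from the second beta prime parameter to the first, while their sum
  \<open>\<nu> + N + 1\<close>, the exponent of \<open>1 + |z|^2\<close>, stays fixed. The strict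
  bounds on \<open>\<kappa>\<close> keep both parameters positive.\<close>

lemma one_weight_powr:
  assumes "z \<noteq> 0" "0 \<le> \<nu>" "0 < \<kappa>" "\<kappa> < real N + 1"
  shows "one_weight \<nu> N z * ennreal (((norm z)\<^sup>2) powr \<kappa> / Beta (\<nu> + \<kappa>) (real N + 1 - \<kappa>))
    = ennreal (log_beta_prime (\<nu> + \<kappa>) (real N + 1 - \<kappa>) (ln ((norm z)\<^sup>2)))"
proof -
  have "((norm z)\<^sup>2) powr \<nu> / (1 + (norm z)\<^sup>2) powr (\<nu> + real N + 1) * (((norm z)\<^sup>2) powr \<kappa> / Beta (\<nu> + \<kappa>) (real N + 1 - \<kappa>))
     = log_beta_prime (\<nu> + \<kappa>) (real N + 1 - \<kappa>) (ln ((norm z)\<^sup>2))"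
    using assms by (simp add: log_beta_prime_def powr_def exp_add[symmetric] algebra_simps)
  then show ?thesis
    using assms Beta_pos[of "\<nu> + \<kappa>" "real N + 1 - \<kappa>"]
    by (simp add: one_weight_eq flip: ennreal_mult)
qed

text \<open>Since \<open>|z|^(2\<kappa>)\<close> is \<open>|z / y|^(2\<kappa>)\<close> times
  \<open>|y|^(2\<kappa>)\<close>, every factor is tilted separately, and on the logarithmic scale
  the multiplicative convolution becomes additive. Each integration over the plane leaves one
  \<open>pi\<close>, the factor \<open>exp t\<close> of the change of variables cancelling against
  \<open>1 / |y|^2\<close>. The left-hand weight is independent of \<open>\<kappa>\<close>, which
  may thus be chosen to suit \<open>z\<close>.\<close>

lemma weight_conv_iter:
  assumes "\<And>j. j \<le> m \<Longrightarrow> 0 \<le> \<nu> (Suc j)" and \<kappa>: "0 < \<kappa>" "\<kappa> < real N + 1" and "z \<noteq> 0"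
  shows "weight (Suc m) N \<nu> z * ennreal (((norm z)\<^sup>2) powr \<kappa> / (\<Prod>j\<le>m. Beta (\<nu> (Suc j) + \<kappa>) (real N + 1 - \<kappa>)))
    = ennreal (pi ^ m) * conv_iter (\<lambda>j x. ennreal (log_beta_prime (\<nu> (Suc j) + \<kappa>) (real N + 1 - \<kappa>) x)) m (ln ((norm z)\<^sup>2))"
  using assms(1) \<open>z \<noteq> 0\<close>
proof (induction m arbitrary: z)
  case 0
  then show ?case using one_weight_powr[of z "\<nu> (Suc 0)" \<kappa> N] \<kappa> by (simp add: weight_one[simplified])
next
  let ?B = "\<lambda>j. Beta (\<nu> (Suc j) + \<kappa>) (real N + 1 - \<kappa>)"
  let ?p = "\<lambda>j x. log_beta_prime (\<nu> (Suc j) + \<kappa>) (real N + 1 - \<kappa>) x"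
  case (Suc m)
  note nu = Suc.prems(1) and z = Suc.prems(2)
  have Bp: "0 < ?B j" if "j \<le> Suc m" for j
    using Beta_pos[of "\<nu> (Suc j) + \<kappa>" "real N + 1 - \<kappa>"] nu[OF that] \<kappa> by simp
  let ?C = "conv_iter (\<lambda>j x. ennreal (?p j x))"
  have [measurable]: "?C k \<in> borel_measurable borel" for k
    by (rule measurable_conv_iter) measurable
  let ?F = "\<lambda>t. ennreal (pi ^ m) * ?C m (ln ((norm z)\<^sup>2) - t) * ennreal (?p (Suc m) t * exp (- t))"
  have "weight (Suc (Suc m)) N \<nu> z * ennreal (((norm z)\<^sup>2) powr \<kappa> / (\<Prod>j\<le>Suc m. ?B j))
      = (\<integral>\<^sup>+y. weight (Suc m) N \<nu> (z / y) * (one_weight (\<nu> (Suc (Suc m))) N y / ennreal ((norm y)\<^sup>2))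
         * ennreal (((norm z)\<^sup>2) powr \<kappa> / (\<Prod>j\<le>Suc m. ?B j)) \<partial>lborel)"
    by (subst weight_Suc, simp, rule nn_integral_multc[symmetric]) measurable
  also have "\<dots> = (\<integral>\<^sup>+y. ?F (ln ((norm (y::complex))\<^sup>2)) \<partial>lborel)"
  proof (rule nn_integral_cong_AE, rule eventually_mono[OF AE_lborel_singleton[of 0]])
    fix y :: complex assume y: "y \<noteq> 0"
    have e: "ennreal (((norm z)\<^sup>2) powr \<kappa> / (\<Prod>j\<le>Suc m. ?B j))
        = ennreal (((norm (z / y))\<^sup>2) powr \<kappa> / (\<Prod>j\<le>m. ?B j)) * ennreal (((norm y)\<^sup>2) powr \<kappa> / ?B (Suc m))"
    proof -
      have "0 < (\<Prod>j\<le>m. ?B j)" by (intro prod_pos ballI Bp) auto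
      then show ?thesis
        using y Bp[of "Suc m"] by (subst ennreal_mult[symmetric])
          (simp_all add: norm_divide power_divide powr_divide)
    qed
    have l: "ln ((norm (z / y))\<^sup>2) = ln ((norm z)\<^sup>2) - ln ((norm y)\<^sup>2)"
      using y z by (simp add: norm_divide power_divide ln_div)
    have i: "inverse (ennreal ((norm y)\<^sup>2)) = ennreal (exp (- ln ((norm y)\<^sup>2)))"
      using y by (simp add: inverse_ennreal exp_minus)
    have "weight (Suc m) N \<nu> (z / y) * (one_weight (\<nu> (Suc (Suc m))) N y / ennreal ((norm y)\<^sup>2))
         * ennreal (((norm z)\<^sup>2) powr \<kappa> / (\<Prod>j\<le>Suc m. ?B j))
       = (weight (Suc m) N \<nu> (z / y) * ennreal (((norm (z / y))\<^sup>2) powr \<kappa> / (\<Prod>j\<le>m. ?B j)))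
         * ((one_weight (\<nu> (Suc (Suc m))) N y * ennreal (((norm y)\<^sup>2) powr \<kappa> / ?B (Suc m)))
         * inverse (ennreal ((norm y)\<^sup>2)))"
      unfolding e divide_ennreal_def by (simp only: mult_ac)
    also have "\<dots> = (ennreal (pi ^ m) * ?C m (ln ((norm (z / y))\<^sup>2)))
        * (ennreal (?p (Suc m) (ln ((norm y)\<^sup>2))) * inverse (ennreal ((norm y)\<^sup>2)))"
      using y z nu by (subst Suc.IH, simp, simp, subst one_weight_powr) (simp_all add: \<kappa>)
    also have "\<dots> = ?F (ln ((norm y)\<^sup>2))"
      unfolding l i by (subst ennreal_mult'') simp_all
    finally show "weight (Suc m) N \<nu> (z / y) * (one_weight (\<nu> (Suc (Suc m))) N y / ennreal ((norm y)\<^sup>2))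
         * ennreal (((norm z)\<^sup>2) powr \<kappa> / (\<Prod>j\<le>Suc m. ?B j)) = ?F (ln ((norm y)\<^sup>2))" .
  qed
  also have "\<dots> = (\<integral>\<^sup>+t. ennreal (pi * exp t) * ?F t \<partial>lborel)"
    by (rule nn_integral_ln_norm_sq) measurable
  also have "\<dots> = (\<integral>\<^sup>+t. ennreal (pi ^ Suc m) * (?C m (ln ((norm z)\<^sup>2) - t) * ennreal (?p (Suc m) t)) \<partial>lborel)"
  proof (intro nn_integral_cong)
    fix t
    have "ennreal (pi * exp t) * ennreal (?p (Suc m) t * exp (- t)) = ennreal pi * ennreal (?p (Suc m) t)"
      using log_beta_prime_nonneg[of "\<nu> (Suc (Suc m)) + \<kappa>" "real N + 1 - \<kappa>"] nu[of "Suc m"] \<kappa>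
      by (simp add: exp_minus flip: ennreal_mult)
    moreover have "a * (p * c * q) = (e * p) * (c * r)" if "a * q = e * r" for a p c q e r :: ennreal
    proof -
      have "a * (p * c * q) = (a * q) * (p * c)" by (simp only: mult_ac)
      then show ?thesis unfolding that by (simp only: mult_ac)
    qed
    ultimately have "ennreal (pi * exp t) * ?F t
        = (ennreal pi * ennreal (pi ^ m)) * (?C m (ln ((norm z)\<^sup>2) - t) * ennreal (?p (Suc m) t))"
      by blast
    then show "ennreal (pi * exp t) * ?F t
        = ennreal (pi ^ Suc m) * (?C m (ln ((norm z)\<^sup>2) - t) * ennreal (?p (Suc m) t))"
      by (simp only: power_Suc ennreal_mult pi_ge_zero zero_le_power)
  qed
  also have "\<dots> = ennreal (pi ^ Suc m) * ?C (Suc m) (ln ((norm z)\<^sup>2))"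
    by (subst nn_integral_cmult) auto
  finally show ?case .
qed


section \<open>The weight and the density at the origin\<close>

lemma emeasure_lborel_atMost: "emeasure lborel {..a::real} = \<infinity>"
proof (rule ccontr)
  assume "emeasure lborel {..a} \<noteq> \<infinity>"
  then obtain r where r: "0 \<le> r" "emeasure lborel {..a} = ennreal r"
    by (cases "emeasure lborel {..a}") auto
  have "emeasure lborel {a - (r + 1)..a} \<le> emeasure lborel {..a}"
    by (rule emeasure_mono) auto
  then show False using r by simp
qed

text \<open>The value is \<open>pi * Beta \<nu> (N + 1)\<close>, which has a pole at
  \<open>\<nu> = 0\<close>. Splitting off \<open>inverse (ennreal \<nu>)\<close>, which is infinite
  at 0, gives one formula for both cases and leaves a factor that is always finite and
  positive.\<close>

lemma nn_integral_one_weight: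
  assumes "0 \<le> \<nu>"
  shows "(\<integral>\<^sup>+y. one_weight \<nu> N y / ennreal ((norm y)\<^sup>2) \<partial>lborel)
    = ennreal (pi * (Gamma (real N + 1) * Gamma (\<nu> + 1) / Gamma (\<nu> + real N + 1))) * inverse (ennreal \<nu>)"
proof -
  let ?h = "\<lambda>x. exp (\<nu> * x) / (1 + exp x) powr (\<nu> + real N + 1)"
  have "(\<integral>\<^sup>+y. one_weight \<nu> N y / ennreal ((norm y)\<^sup>2) \<partial>lborel)
      = (\<integral>\<^sup>+y. ennreal (exp (- ln ((norm y)\<^sup>2)) * ?h (ln ((norm (y::complex))\<^sup>2))) \<partial>lborel)"
  proof (rule nn_integral_cong_AE, rule eventually_mono[OF AE_lborel_singleton[of 0]])
    fix y :: complex assume "y \<noteq> 0"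
    then show "one_weight \<nu> N y / ennreal ((norm y)\<^sup>2)
        = ennreal (exp (- ln ((norm y)\<^sup>2)) * ?h (ln ((norm y)\<^sup>2)))"
      by (simp add: one_weight_eq divide_ennreal exp_minus powr_def field_simps)
  qed
  also have "\<dots> = (\<integral>\<^sup>+x. ennreal (pi * exp x) * ennreal (exp (- x) * ?h x) \<partial>lborel)"
    by (rule nn_integral_ln_norm_sq[of "\<lambda>x. ennreal (exp (- x) * ?h x)"]) measurable
  also have "\<dots> = (\<integral>\<^sup>+x. ennreal (pi * ?h x) \<partial>lborel)"
  proof (intro nn_integral_cong)
    fix x
    have "pi * exp x * (exp (- x) * ?h x) = pi * ?h x" by (simp add: exp_minus)
    then show "ennreal (pi * exp x) * ennreal (exp (- x) * ?h x) = ennreal (pi * ?h x)"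
      by (subst ennreal_mult[symmetric]) simp_all
  qed
  finally have eq: "(\<integral>\<^sup>+y. one_weight \<nu> N y / ennreal ((norm y)\<^sup>2) \<partial>lborel)
      = (\<integral>\<^sup>+x. ennreal (pi * ?h x) \<partial>lborel)" .
  have pos: "0 < Gamma (real N + 1)" "0 < Gamma (\<nu> + 1)" "0 < Gamma (\<nu> + real N + 1)"
    using assms by (simp_all add: Gamma_real_pos)
  show ?thesis
  proof (cases "\<nu> = 0")
    case True
    \<comment> \<open>For \<open>\<nu> = 0\<close> the integrand tends to \<open>pi\<close> at minus
      infinity; on the negative half-line it is bounded below by a positive constant.\<close>
    have "\<infinity> = (\<integral>\<^sup>+x. ennreal (pi / 2 powr (real N + 1)) * indicator {..0::real} x \<partial>lborel)"
      by (subst nn_integral_cmult) (auto simp: emeasure_lborel_atMost ennreal_mult_top)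
    also have "\<dots> \<le> (\<integral>\<^sup>+x. ennreal (pi * ?h x) \<partial>lborel)"
    proof (rule nn_integral_mono)
      fix x :: real
      have "(1 + exp x) powr (real N + 1) \<le> 2 powr (real N + 1)" if "x \<le> 0"
        using that by (intro powr_mono2) auto
      then show "ennreal (pi / 2 powr (real N + 1)) * indicator {..0} x \<le> ennreal (pi * ?h x)"
        using True less_imp_neq[OF add_pos_pos[OF zero_less_one exp_gt_zero[of x]], symmetric]
        by (auto simp: indicator_def intro!: ennreal_leI divide_left_mono)
    qed
    finally have "(\<integral>\<^sup>+x. ennreal (pi * ?h x) \<partial>lborel) = \<infinity>" by (simp add: top.extremum_unique)
    then show ?thesis
      unfolding eq using pos(1) True by (simp add: ennreal_mult_top less_imp_neq[OF pos(1), symmetric])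
  next
    case False
    then have \<nu>: "0 < \<nu>" using assms by simp
    have B: "0 < Beta \<nu> (real N + 1)" using \<nu> by (intro Beta_pos) auto
    have "ennreal (pi * ?h x) = ennreal (pi * Beta \<nu> (real N + 1)) * ennreal (log_beta_prime \<nu> (real N + 1) x)" for x
      using B by (simp add: log_beta_prime_def add.assoc flip: ennreal_mult)
    then have "(\<integral>\<^sup>+x. ennreal (pi * ?h x) \<partial>lborel) = ennreal (pi * Beta \<nu> (real N + 1))"
      using nn_integral_log_beta_prime[OF \<nu>, of "real N + 1"] by (simp add: nn_integral_cmult)
    also have "pi * Beta \<nu> (real N + 1)
        = pi * (Gamma (real N + 1) * Gamma (\<nu> + 1) / Gamma (\<nu> + real N + 1)) * inverse \<nu>"
      using \<nu> Gamma_plus1[of \<nu>] by (simp add: Beta_def add.assoc divide_simps not_le nonpos_Ints_def)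
    also have "ennreal \<dots> = ennreal (pi * (Gamma (real N + 1) * Gamma (\<nu> + 1) / Gamma (\<nu> + real N + 1))) * inverse (ennreal \<nu>)"
      by (subst ennreal_mult) (use \<nu> pos in \<open>simp_all add: inverse_ennreal less_imp_le\<close>)
    finally show ?thesis unfolding eq .
  qed
qed

lemma one_weight_0_0: "one_weight 0 N 0 = 1"
  by (simp add: one_weight_def epowr_def divide_ennreal_def)

text \<open>At 0 all quotients \<open>z / y\<close> are 0, so the nested integrals decouple. The
  first factor is \<open>one_weight 0 N 0\<close>, which is 1.\<close>

lemma weight_zero:
  assumes "\<nu> 1 = 0" "1 \<le> n"
  shows "weight n N \<nu> 0 = (\<Prod>j\<in>{2..n}. \<integral>\<^sup>+y. one_weight (\<nu> j) N y / ennreal ((norm y)\<^sup>2) \<partial>lborel)"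
  using assms(2)
proof (induction n rule: nat_induct_at_least)
  case base
  show ?case using assms(1) by (subst weight_one) (simp add: one_weight_0_0)
next
  case (Suc m)
  have "{2..Suc m} = insert (Suc m) {2..m}" using Suc.hyps by auto
  then show ?case
    using Suc by (simp add: weight_Suc nn_integral_cmult) (simp add: mult.commute)
qed

text \<open>The quotients \<open>?G i\<close> in the coefficient cancel those in the integrals of
  the weight. The remaining powers of \<open>Gamma (N + 1)\<close> and \<open>Gamma N\<close> leave
  only a power of N, one factor for each index from 2 on.\<close>

lemma eigenvalue_density_zero:
  assumes \<nu>: "\<nu> 1 = 0" "\<And>i. i \<in> {1..n} \<Longrightarrow> 0 \<le> \<nu> i" and "1 \<le> n" "0 < N"
  shows "eigenvalue_density n N \<nu> 0 = inverse (ennreal pi) * (\<Prod>i\<in>{2..n}. ennreal (real N) * inverse (ennreal (\<nu> i)))"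
proof -
  let ?G = "\<lambda>i. Gamma (\<nu> i + real N + 1) / Gamma (\<nu> i + 1)"
  let ?I = "\<lambda>i. pi * (Gamma (real N + 1) / ?G i)"
  have G: "0 < ?G i" if "i \<in> {1..n}" for i
    using \<nu>(2)[OF that] by (auto intro!: divide_pos_pos Gamma_real_pos)
  have GN: "0 < Gamma (real N)" using \<open>0 < N\<close> by (intro Gamma_real_pos) auto
  have GN1: "Gamma (real N + 1) = real N * Gamma (real N)"
    using \<open>0 < N\<close> by (intro Gamma_plus1) (auto dest: nonpos_Ints_nonpos)
  have I: "0 < ?I i" if "i \<in> {1..n}" for i
    using GN \<open>0 < N\<close> by (intro mult_pos_pos divide_pos_pos G that) (simp_all add: GN1)
  have ins: "{1..n} = insert 1 {2..n}" using \<open>1 \<le> n\<close> by auto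
  have w: "weight n N \<nu> 0 = (\<Prod>i\<in>{2..n}. ennreal (?I i) * inverse (ennreal (\<nu> i)))"
    unfolding weight_zero[where \<nu> = \<nu> and n = n, OF \<nu>(1) \<open>1 \<le> n\<close>]
    using \<nu>(2) by (intro prod.cong refl) (subst nn_integral_one_weight, auto)
  have "(\<Sum>k<N. ennreal (1 / Gamma (real N - real k) ^ n *
        (\<Prod>i\<in>{1..n}. Gamma (\<nu> i + real N + 1) / Gamma (\<nu> i + real k + 1)) * norm (0::complex) ^ (2 * k)))
      = (\<Sum>k\<in>{0}. ennreal (1 / Gamma (real N - real k) ^ n *
        (\<Prod>i\<in>{1..n}. Gamma (\<nu> i + real N + 1) / Gamma (\<nu> i + real k + 1)) * norm (0::complex) ^ (2 * k)))"
    using \<open>0 < N\<close> by (intro sum.mono_neutral_right) (auto simp: power_0_left split: if_splits)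
  also have "\<dots> = ennreal (1 / Gamma (real N) ^ n * (\<Prod>i\<in>{1..n}. ?G i))" by simp
  finally have "eigenvalue_density n N \<nu> 0
      = ennreal (1 / real N) * ((\<Prod>i\<in>{2..n}. ennreal (?I i) * inverse (ennreal (\<nu> i))) / ennreal (pi ^ n))
        * ennreal (1 / Gamma (real N) ^ n * (\<Prod>i\<in>{1..n}. ?G i))"
    unfolding eigenvalue_density_def w by simp
  also have "(\<Prod>i\<in>{2..n}. ennreal (?I i) * inverse (ennreal (\<nu> i)))
      = ennreal (\<Prod>i\<in>{2..n}. ?I i) * (\<Prod>i\<in>{2..n}. inverse (ennreal (\<nu> i)))"
    by (subst prod.distrib, subst prod_ennreal) (use I in \<open>simp_all add: less_imp_le\<close>)
  also have "ennreal (1 / real N) * (ennreal (\<Prod>i\<in>{2..n}. ?I i) * (\<Prod>i\<in>{2..n}. inverse (ennreal (\<nu> i))) / ennreal (pi ^ n))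
        * ennreal (1 / Gamma (real N) ^ n * (\<Prod>i\<in>{1..n}. ?G i))
      = (ennreal (1 / real N) * ennreal (\<Prod>i\<in>{2..n}. ?I i) * ennreal (1 / pi ^ n) * ennreal (1 / Gamma (real N) ^ n * (\<Prod>i\<in>{1..n}. ?G i)))
        * (\<Prod>i\<in>{2..n}. inverse (ennreal (\<nu> i)))"
    by (simp add: divide_ennreal_def inverse_ennreal inverse_eq_divide mult_ac)
  also have "ennreal (1 / real N) * ennreal (\<Prod>i\<in>{2..n}. ?I i) * ennreal (1 / pi ^ n) * ennreal (1 / Gamma (real N) ^ n * (\<Prod>i\<in>{1..n}. ?G i))
      = ennreal (1 / real N * (\<Prod>i\<in>{2..n}. ?I i) * (1 / pi ^ n) * (1 / Gamma (real N) ^ n * (\<Prod>i\<in>{1..n}. ?G i)))"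
  proof -
    have "0 \<le> (\<Prod>i\<in>{2..n}. ?I i)" by (intro prod_nonneg) (use I in \<open>simp add: less_imp_le\<close>)
    moreover have "0 \<le> 1 / Gamma (real N) ^ n * (\<Prod>i\<in>{1..n}. ?G i)"
      by (intro mult_nonneg_nonneg prod_nonneg) (use G GN in \<open>simp_all add: less_imp_le\<close>)
    moreover have "0 \<le> 1 / real N" "0 \<le> 1 / pi ^ n" by simp_all
    ultimately show ?thesis by (simp only: ennreal_mult mult_nonneg_nonneg)
  qed
  also have "1 / real N * (\<Prod>i\<in>{2..n}. ?I i) * (1 / pi ^ n) * (1 / Gamma (real N) ^ n * (\<Prod>i\<in>{1..n}. ?G i))
      = inverse pi * real N ^ (n - 1)"
  proof -
    have "(\<Prod>i\<in>{2..n}. ?I i) * (\<Prod>i\<in>{2..n}. ?G i) = (\<Prod>i\<in>{2..n}. pi * Gamma (real N + 1))"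
      unfolding prod.distrib[symmetric]
    proof (intro prod.cong refl)
      fix i assume "i \<in> {2..n}"
      then have "?G i \<noteq> 0" using G[of i] by auto
      then show "?I i * ?G i = pi * Gamma (real N + 1)" by (metis mult.assoc nonzero_eq_divide_eq)
    qed
    also have "\<dots> = (pi * Gamma (real N + 1)) ^ (n - 1)" using \<open>1 \<le> n\<close> by simp
    finally have pq: "(\<Prod>i\<in>{2..n}. ?I i) * (\<Prod>i\<in>{1..n}. ?G i) = (pi * Gamma (real N + 1)) ^ (n - 1) * Gamma (real N + 1)"
      unfolding ins using \<nu>(1) by (subst prod.insert) (auto simp: mult_ac)
    obtain m where n: "n = Suc m" using \<open>1 \<le> n\<close> by (cases n) auto
    have calc: "1 / N' * p * (1 / pi ^ n) * (1 / g ^ n * q) = inverse pi * N' ^ (n - 1)"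
      if "p * q = (pi * (N' * g)) ^ (n - 1) * (N' * g)" "0 < g" "0 < N'" for p q g N' :: real
    proof -
      have "1 / N' * p * (1 / pi ^ n) * (1 / g ^ n * q) = (p * q) / (N' * pi ^ n * g ^ n)" by simp
      also have "\<dots> = inverse pi * N' ^ (n - 1)"
        unfolding that(1) n using that(2,3) by (simp add: power_mult_distrib divide_simps)
      finally show ?thesis .
    qed
    show ?thesis
      by (rule calc[OF _ GN]) (use pq \<open>0 < N\<close> in \<open>simp_all only: GN1 of_nat_0_less_iff\<close>)
  qed
  also have "ennreal (inverse pi * real N ^ (n - 1)) = inverse (ennreal pi) * (\<Prod>i\<in>{2..n}. ennreal (real N))"
    using \<open>1 \<le> n\<close> by (simp add: inverse_ennreal ennreal_mult ennreal_power)
  finally show ?thesis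
    by (simp add: prod.distrib mult.assoc)
qed

text \<open>The coefficient of \<open>|z|^(2k)\<close> in the eigenvalue density, with its Gamma
  functions grouped into Beta functions. The arguments are left in the shape produced by the tilting
  exponent \<open>k + 1\<close>, so that they match the normalisation of the convolution.\<close>

definition density_coeff :: "nat \<Rightarrow> nat \<Rightarrow> (nat \<Rightarrow> real) \<Rightarrow> nat \<Rightarrow> real" where
  "density_coeff m N \<nu> k = 1 / (\<Prod>j\<le>m. Beta (\<nu> (Suc j) + (real k + 1)) (real N + 1 - (real k + 1)))"

text \<open>The reference index \<open>k0\<close> is arbitrary here. Tilting by
  \<open>k0 + 1\<close> introduces exactly the \<open>k0\<close>-th coefficient as normalisation,
  which therefore divides the sum; the surplus power of \<open>u\<close> is the prefactor
  \<open>1 / u\<close>. The factor \<open>1 / N\<close> is split into two factors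
  \<open>1 / sqrt N\<close>, one for each Gaussian limit.\<close>

lemma eigenvalue_density_nonzero:
  assumes \<nu>: "\<And>j. j \<le> m \<Longrightarrow> 0 \<le> \<nu> (Suc j)" and "k0 < N" "z \<noteq> 0"
  defines "u \<equiv> (norm z)\<^sup>2"
  shows "eigenvalue_density (Suc m) N \<nu> z = ennreal (1 / (pi * u))
    * (ennreal (1 / sqrt (real N)) * conv_iter (\<lambda>j x. ennreal (log_beta_prime (\<nu> (Suc j) + (real k0 + 1)) (real N + 1 - (real k0 + 1)) x)) m (ln u))
    * ennreal (1 / sqrt (real N) * (\<Sum>k<N. (density_coeff m N \<nu> k * u ^ k) / (density_coeff m N \<nu> k0 * u ^ k0)))"
proof -
  let ?C = "density_coeff m N \<nu>"
  have u: "0 < u" using \<open>z \<noteq> 0\<close> by (simp add: u_def)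
  have C: "0 < ?C k" if "k < N" for k
    unfolding density_coeff_def using that \<nu>
    by (intro divide_pos_pos prod_pos ballI Beta_pos) (simp_all add: add_nonneg_pos)
  have coeff: "1 / Gamma (real N - real k) ^ Suc m * (\<Prod>i\<in>{1..Suc m}. Gamma (\<nu> i + real N + 1) / Gamma (\<nu> i + real k + 1)) * norm z ^ (2 * k)
      = ?C k * u ^ k" if "k < N" for k
  proof -
    have "(\<Prod>i\<in>{1..Suc m}. Gamma (\<nu> i + real N + 1) / Gamma (\<nu> i + real k + 1))
        = (\<Prod>j\<le>m. Gamma (\<nu> (Suc j) + real N + 1) / Gamma (\<nu> (Suc j) + real k + 1))"
      using prod.atLeast1_atMost_eq[of "\<lambda>i. Gamma (\<nu> i + real N + 1) / Gamma (\<nu> i + real k + 1)" "Suc m"]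
      by (simp only: One_nat_def lessThan_Suc_atMost)
    moreover have "?C k = (\<Prod>j\<le>m. 1 / Beta (\<nu> (Suc j) + (real k + 1)) (real N + 1 - (real k + 1)))"
      by (simp add: density_coeff_def prod_dividef)
    then have "?C k = (\<Prod>j\<le>m. 1 / Gamma (real N - real k) * (Gamma (\<nu> (Suc j) + real N + 1) / Gamma (\<nu> (Suc j) + real k + 1)))"
      by (simp add: Beta_def add_ac mult.commute)
    ultimately show ?thesis
      by (simp only: prod.distrib) (simp add: u_def power_mult power_divide)
  qed
  have "(\<Sum>k<N. ennreal (1 / Gamma (real N - real k) ^ Suc m *
      (\<Prod>i\<in>{1..Suc m}. Gamma (\<nu> i + real N + 1) / Gamma (\<nu> i + real k + 1)) * norm z ^ (2 * k)))
      = (\<Sum>k<N. ennreal (?C k * u ^ k))"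
    by (intro sum.cong refl) (subst coeff, auto)
  also have "\<dots> = ennreal (\<Sum>k<N. ?C k * u ^ k)"
    using C u by (intro sum_ennreal) (simp add: less_imp_le)
  also have "(\<Sum>k<N. ?C k * u ^ k) = (?C k0 * u ^ k0) * (\<Sum>k<N. (?C k * u ^ k) / (?C k0 * u ^ k0))"
    using C[OF \<open>k0 < N\<close>] u by (subst sum_distrib_left) (intro sum.cong, auto)
  finally have sum: "(\<Sum>k<N. ennreal (1 / Gamma (real N - real k) ^ Suc m *
      (\<Prod>i\<in>{1..Suc m}. Gamma (\<nu> i + real N + 1) / Gamma (\<nu> i + real k + 1)) * norm z ^ (2 * k)))
      = ennreal ((?C k0 * u ^ k0) * (\<Sum>k<N. (?C k * u ^ k) / (?C k0 * u ^ k0)))" .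
  let ?S = "\<Sum>k<N. (?C k * u ^ k) / (?C k0 * u ^ k0)"
  have S: "0 \<le> ?S" using C u \<open>k0 < N\<close> by (intro sum_nonneg) (simp add: less_imp_le)
  let ?H = "conv_iter (\<lambda>j x. ennreal (log_beta_prime (\<nu> (Suc j) + (real k0 + 1)) (real N + 1 - (real k0 + 1)) x)) m (ln u)"
  have "weight (Suc m) N \<nu> z * ennreal (u powr (real k0 + 1) * ?C k0) = ennreal (pi ^ m) * ?H"
    using weight_conv_iter[of m \<nu> "real k0 + 1" N z] \<nu> \<open>k0 < N\<close> \<open>z \<noteq> 0\<close>
    by (simp add: density_coeff_def u_def)
  moreover have "u powr (real k0 + 1) = u ^ Suc k0"
    using u by (metis powr_realpow of_nat_Suc add.commute)
  ultimately have w: "weight (Suc m) N \<nu> z * ennreal (u ^ Suc k0 * ?C k0) = ennreal (pi ^ m) * ?H" by simp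
  have "ennreal (1 / real N) * ennreal (1 / pi ^ Suc m) * ennreal ((?C k0 * u ^ k0) * ?S)
      = ennreal (u ^ Suc k0 * ?C k0) * (ennreal (1 / (pi ^ Suc m * u)) * ennreal (1 / sqrt (real N)) * ennreal (1 / sqrt (real N) * ?S))"
    using u C[OF \<open>k0 < N\<close>] S by (simp flip: ennreal_mult) (simp add: mult_ac)
  note key = this
  have "eigenvalue_density (Suc m) N \<nu> z
      = ennreal (1 / real N) * (weight (Suc m) N \<nu> z * ennreal (1 / pi ^ Suc m)) * ennreal ((?C k0 * u ^ k0) * ?S)"
    unfolding eigenvalue_density_def sum divide_ennreal_def
    by (subst inverse_ennreal) (simp_all only: inverse_eq_divide zero_less_power pi_gt_zero)
  also have "\<dots> = weight (Suc m) N \<nu> z * (ennreal (1 / real N) * ennreal (1 / pi ^ Suc m) * ennreal ((?C k0 * u ^ k0) * ?S))"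
    by (simp only: mult_ac)
  also have "\<dots> = (weight (Suc m) N \<nu> z * ennreal (u ^ Suc k0 * ?C k0)) * (ennreal (1 / (pi ^ Suc m * u)) * ennreal (1 / sqrt (real N)) * ennreal (1 / sqrt (real N) * ?S))"
    unfolding key by (simp only: mult.assoc)
  also have "\<dots> = (ennreal (pi ^ m) * ennreal (1 / (pi ^ Suc m * u))) * (ennreal (1 / sqrt (real N)) * ?H) * ennreal (1 / sqrt (real N) * ?S)"
    unfolding w by (simp only: mult_ac)
  also have "ennreal (pi ^ m) * ennreal (1 / (pi ^ Suc m * u)) = ennreal (1 / (pi * u))"
    using u by (simp flip: ennreal_mult)
  finally show ?thesis .
qed

section \<open>Asymptotics of the sum and of the factors\<close>

lemma sum_of_nat_lessThan: "(\<Sum>i<j. real i) = real j * (real j - 1) / 2"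
  by (induction j) (auto simp: field_simps)

text \<open>The exponent \<open>E\<close> compares with the arithmetic sum \<open>0 + 1 + \<dots> + (j - 1)\<close> over \<open>N\<close>.\<close>

lemma exp_chain_ratio:
  fixes a :: "nat \<Rightarrow> real" and q :: "real \<Rightarrow> real"
  assumes step: "\<And>k. Suc k < N \<Longrightarrow> a (Suc k) = a k * exp (- q ((real k + 1) / real N))"
    and t: "0 < t" "t < 1" and "0 < N"
    and q_ge: "\<And>s. t \<le> s \<Longrightarrow> s < 1 \<Longrightarrow> s - t \<le> q s"
    and q_le: "\<And>s. 0 < s \<Longrightarrow> s \<le> t \<Longrightarrow> q s \<le> s - t"
    and q_lin: "\<And>h. \<bar>h\<bar> \<le> \<delta> \<Longrightarrow> \<bar>q (t + h) - B * h\<bar> \<le> M * h\<^sup>2"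
    and B: "0 \<le> B" and M: "0 \<le> M"
    and k0: "k0 = nat \<lfloor>real N * t\<rfloor>" and k: "k < N"
  defines "j \<equiv> \<bar>real k - real k0\<bar>"
  shows "\<exists>E. a k = a k0 * exp (- E) \<and> j * (j - 1) / (2 * real N) \<le> E \<and>
    (j / real N \<le> \<delta> \<longrightarrow> \<bar>E - B * (j * (j - 1) / (2 * real N))\<bar> \<le> j * (M * (j / real N)\<^sup>2 + B / real N))"
proof -
  have k0': "real k0 \<le> real N * t" "real N * t < real k0 + 1"
    using t \<open>0 < N\<close> unfolding k0 by (auto simp: of_nat_nat intro: floor_correct[THEN conjunct1])
  have N: "0 < real N" using \<open>0 < N\<close> by simp
  \<comment> \<open>Common to the ascent and the descent from \<open>k0\<close>: at step
    \<open>i\<close> the distance \<open>h i\<close> from \<open>t\<close> is \<open>i / N\<close>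
    up to rounding by at most \<open>1 / N\<close>. The nonlinearity costs at most
    \<open>M * (n / N)^2\<close> and the rounding at most \<open>B / N\<close> per term.\<close>
  have main: "\<bar>(\<Sum>i<n. f i) - B * (real n * (real n - 1) / (2 * real N))\<bar> \<le> real n * (M * (real n / real N)\<^sup>2 + B / real N)"
    if f: "\<And>i. i < n \<Longrightarrow> \<bar>f i - B * h i\<bar> \<le> M * (h i)\<^sup>2"
      and h: "\<And>i. i < n \<Longrightarrow> real i / real N \<le> h i" "\<And>i. i < n \<Longrightarrow> h i \<le> (real i + 1) / real N"
    for n :: nat and f h :: "nat \<Rightarrow> real"
  proof -
    have "(\<Sum>i<n. f i) - B * (real n * (real n - 1) / (2 * real N)) = (\<Sum>i<n. f i) - B * ((\<Sum>i<n. real i) / real N)"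
      by (simp add: sum_of_nat_lessThan)
    also have "\<dots> = (\<Sum>i<n. f i - B * (real i / real N))"
      by (simp add: sum_subtractf sum_distrib_left sum_divide_distrib)
    finally have "(\<Sum>i<n. f i) - B * (real n * (real n - 1) / (2 * real N)) = (\<Sum>i<n. f i - B * (real i / real N))" .
    also have "\<bar>\<Sum>i<n. f i - B * (real i / real N)\<bar> \<le> (\<Sum>i<n. \<bar>f i - B * (real i / real N)\<bar>)" by (rule sum_abs)
    also have "\<dots> \<le> (\<Sum>i<n. M * (real n / real N)\<^sup>2 + B / real N)"
    proof (rule sum_mono)
      fix i assume i: "i \<in> {..<n}"
      have hn: "0 \<le> h i" "h i \<le> real n / real N"
      proof -
        show "0 \<le> h i" using h(1)[of i] i N by (smt (verit) divide_nonneg_pos lessThan_iff of_nat_0_le_iff)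
        have "(real i + 1) / real N \<le> real n / real N" using i N by (intro divide_right_mono) auto
        then show "h i \<le> real n / real N" using h(2)[of i] i by auto
      qed
      have "M * (h i)\<^sup>2 \<le> M * (real n / real N)\<^sup>2"
        using M hn by (intro mult_left_mono power_mono) auto
      moreover have "\<bar>B * h i - B * (real i / real N)\<bar> \<le> B / real N"
      proof -
        have "B * h i - B * (real i / real N) = B * (h i - real i / real N)" by (simp add: right_diff_distrib)
        moreover have "0 \<le> h i - real i / real N" "h i - real i / real N \<le> 1 / real N"
          using h[of i] i by (auto simp: add_divide_distrib)
        ultimately show ?thesis using B mult_left_mono[of "h i - real i / real N" "1 / real N" B] by simp
      qed
      ultimately show "\<bar>f i - B * (real i / real N)\<bar> \<le> M * (real n / real N)\<^sup>2 + B / real N"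
        using f[of i] i by simp
    qed
    finally show ?thesis by simp
  qed
  show ?thesis
  proof (cases "k0 \<le> k")
    case True
    define n where "n = k - k0"
    have kn: "k = k0 + n" and j: "j = real n" using True by (auto simp: n_def j_def)
    \<comment> \<open>Upwards the first ratio sits at \<open>(k0 + 1) / N\<close>, just beyond
      \<open>t\<close>; hence the i-th distance lies between \<open>i / N\<close> and
      \<open>(i + 1) / N\<close>.\<close>
    let ?f = "\<lambda>i. q ((real k0 + real i + 1) / real N)"
    let ?h = "\<lambda>i. (real k0 + real i + 1) / real N - t"
    have "k0 + n < N \<Longrightarrow> a (k0 + n) = a k0 * exp (- (\<Sum>i<n. ?f i))"
    proof (induction n)
      case (Suc n)
      then show ?case using step[of "k0 + n"] by (simp add: exp_add[symmetric] add_ac exp_diff exp_minus divide_inverse)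
    qed simp
    then have 1: "a k = a k0 * exp (- (\<Sum>i<n. ?f i))" using k kn by simp
    have hb: "real i / real N \<le> ?h i" "?h i \<le> (real i + 1) / real N" for i
      using k0' N by (auto simp: field_simps)
    have 2: "real i / real N \<le> ?f i" if "i < n" for i
    proof -
      have "real i / real N \<ge> 0" by simp
      then have "t \<le> (real k0 + real i + 1) / real N" using hb(1)[of i] by linarith
      moreover have "real k0 + real i + 1 < real N" using that k kn by linarith
      then have "(real k0 + real i + 1) / real N < 1" using N by simp
      ultimately have "?h i \<le> ?f i" by (rule q_ge)
      with hb(1)[of i] show ?thesis by simp
    qed
    have "(\<Sum>i<n. real i / real N) \<le> (\<Sum>i<n. ?f i)" by (rule sum_mono) (use 2 in auto)
    then have 3: "real n * (real n - 1) / (2 * real N) \<le> (\<Sum>i<n. ?f i)"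
      by (simp add: sum_of_nat_lessThan sum_divide_distrib[symmetric])
    have 4: "\<bar>(\<Sum>i<n. ?f i) - B * (real n * (real n - 1) / (2 * real N))\<bar> \<le> real n * (M * (real n / real N)\<^sup>2 + B / real N)"
      if d: "real n / real N \<le> \<delta>"
    proof (rule main[OF _ hb])
      fix i assume "i < n"
      then have "(real i + 1) / real N \<le> real n / real N" using N by (intro divide_right_mono) auto
      moreover have "0 \<le> real i / real N" by simp
      ultimately have "\<bar>?h i\<bar> \<le> \<delta>" using hb[of i] d by linarith
      then show "\<bar>?f i - B * ?h i\<bar> \<le> M * (?h i)\<^sup>2" using q_lin[of "?h i"] by simp
    qed
    show ?thesis unfolding j by (intro exI[of _ "\<Sum>i<n. ?f i"] conjI impI 1 3 4)
  next
    case False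
    define n where "n = k0 - k"
    have kn: "k0 = k + n" and j: "j = real n" using False by (auto simp: n_def j_def)
    \<comment> \<open>Downwards the first ratio undone sits at \<open>k0 / N\<close>, at or just
      below \<open>t\<close>. Both the exponent and the distance change sign, so the same estimates
      apply.\<close>
    let ?f = "\<lambda>i. - q ((real k0 - real i) / real N)"
    let ?h = "\<lambda>i. t - (real k0 - real i) / real N"
    have "k0 < N"
    proof -
      have "real N * t < real N" using t N by simp
      then show ?thesis using k0'(1) by linarith
    qed
    have "n \<le> k0 \<Longrightarrow> a (k0 - n) = a k0 * exp (- (\<Sum>i<n. ?f i))" for n
    proof (induction n)
      case (Suc n)
      have e: "Suc (k0 - Suc n) = k0 - n" using Suc.prems by simp
      have "a (k0 - n) = a (k0 - Suc n) * exp (- q ((real (k0 - Suc n) + 1) / real N))"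
        using step[of "k0 - Suc n"] \<open>k0 < N\<close> unfolding e by simp
      moreover have "real (k0 - Suc n) + 1 = real k0 - real n" using Suc.prems by (simp add: of_nat_diff)
      ultimately have "a (k0 - Suc n) = a (k0 - n) * exp (q ((real k0 - real n) / real N))"
        by (simp add: exp_minus)
      then show ?case using Suc by (simp add: exp_add mult.assoc sum_negf)
    qed simp
    then have 1: "a k = a k0 * exp (- (\<Sum>i<n. ?f i))" using kn by (metis add_diff_cancel_right' le_add2)
    have h_eq: "?h i = (real N * t - real k0 + real i) / real N" for i
      using N by (simp add: field_simps)
    have hb: "real i / real N \<le> ?h i" "?h i \<le> (real i + 1) / real N" for i
      unfolding h_eq using k0' by (auto intro!: divide_right_mono)
    have 2: "real i / real N \<le> ?f i" if "i < n" for i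
    proof -
      have "real i / real N \<ge> 0" by simp
      then have "(real k0 - real i) / real N \<le> t" using hb(1)[of i] by linarith
      moreover have "0 < (real k0 - real i) / real N" using that kn N by simp
      ultimately have "?h i \<le> ?f i" using q_le[of "(real k0 - real i) / real N"] by simp
      with hb(1)[of i] show ?thesis by simp
    qed
    have "(\<Sum>i<n. real i / real N) \<le> (\<Sum>i<n. ?f i)" by (rule sum_mono) (use 2 in auto)
    then have 3: "real n * (real n - 1) / (2 * real N) \<le> (\<Sum>i<n. ?f i)"
      by (simp add: sum_of_nat_lessThan sum_divide_distrib[symmetric])
    have 4: "\<bar>(\<Sum>i<n. ?f i) - B * (real n * (real n - 1) / (2 * real N))\<bar> \<le> real n * (M * (real n / real N)\<^sup>2 + B / real N)"
      if d: "real n / real N \<le> \<delta>"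
    proof (rule main[OF _ hb])
      fix i assume "i < n"
      then have "(real i + 1) / real N \<le> real n / real N" using N by (intro divide_right_mono) auto
      moreover have "0 \<le> real i / real N" by simp
      ultimately have "\<bar>- ?h i\<bar> \<le> \<delta>" using hb[of i] d by linarith
      then have "\<bar>q (t + (- ?h i)) - B * (- ?h i)\<bar> \<le> M * (- ?h i)\<^sup>2" by (rule q_lin)
      then have "\<bar>- (?f i - B * ?h i)\<bar> \<le> M * (?h i)\<^sup>2"
        by (simp add: algebra_simps power2_commute)
      then show "\<bar>?f i - B * ?h i\<bar> \<le> M * (?h i)\<^sup>2" by (simp only: abs_minus_cancel)
    qed
    show ?thesis unfolding j by (intro exI[of _ "\<Sum>i<n. ?f i"] conjI impI 1 3 4)
  qed
qed

text \<open>A sum written as the integral of a step function with steps of length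
  \<open>1 / s\<close>, which makes dominated convergence available for sums whose range
  grows.\<close>

lemma nn_integral_floor_step:
  fixes f :: "int \<Rightarrow> ennreal"
  assumes "finite K" "0 < s" "\<And>k. k \<notin> K \<Longrightarrow> f k = 0"
  shows "(\<integral>\<^sup>+x. f \<lfloor>x * s\<rfloor> \<partial>lborel) = ennreal (1 / s) * (\<Sum>k\<in>K. f k)"
proof -
  have fl: "\<lfloor>x * s\<rfloor> = k \<longleftrightarrow> x \<in> {of_int k / s..<(of_int k + 1) / s}" for x k
    using \<open>0 < s\<close> by (simp add: floor_eq_iff field_simps)
  have "f \<lfloor>x * s\<rfloor> = (\<Sum>k\<in>K. f k * indicator {of_int k / s..<(of_int k + 1) / s} x)" for x
  proof -
    have "(\<Sum>k\<in>K. f k * indicator {of_int k / s..<(of_int k + 1) / s} x) = (\<Sum>k\<in>K. if k = \<lfloor>x * s\<rfloor> then f k else 0)"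
      by (intro sum.cong refl) (simp add: indicator_def fl[symmetric] del: atLeastLessThan_iff)
    also have "\<dots> = f \<lfloor>x * s\<rfloor>" using assms by (auto simp: sum.delta)
    finally show ?thesis by simp
  qed
  then have "(\<integral>\<^sup>+x. f \<lfloor>x * s\<rfloor> \<partial>lborel)
      = (\<integral>\<^sup>+x. (\<Sum>k\<in>K. f k * indicator {of_int k / s..<(of_int k + 1) / s} x) \<partial>lborel)" by simp
  also have "\<dots> = (\<Sum>k\<in>K. f k * emeasure lborel {of_int k / s..<(of_int k + 1) / s})"
    by (subst nn_integral_sum) (auto simp: nn_integral_cmult)
  also have "\<dots> = (\<Sum>k\<in>K. ennreal (1 / s) * f k)"
    using \<open>0 < s\<close> by (intro sum.cong refl) (simp add: divide_right_mono add_divide_distrib mult.commute)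
  finally show ?thesis by (simp add: sum_distrib_left)
qed

text \<open>With \<open>k = k0 + \<lfloor>x * sqrt N\<rfloor>\<close> the normalised sum is the
  integral of a step function in \<open>x\<close>. The growth of \<open>q\<close> at rate at least 1
  on the whole interval gives an integrable majorant, and its linearisation at \<open>t\<close>
  gives the pointwise limit \<open>exp (- B * x^2 / 2)\<close>.\<close>

lemma discrete_laplace:
  fixes a :: "nat \<Rightarrow> nat \<Rightarrow> real" and q :: "real \<Rightarrow> real"
  assumes pos: "\<And>N k. k < N \<Longrightarrow> 0 < a N k"
    and step: "\<And>N k. Suc k < N \<Longrightarrow> a N (Suc k) = a N k * exp (- q ((real k + 1) / real N))"
    and t: "0 < t" "t < 1"
    and q_ge: "\<And>s. t \<le> s \<Longrightarrow> s < 1 \<Longrightarrow> s - t \<le> q s"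
    and q_le: "\<And>s. 0 < s \<Longrightarrow> s \<le> t \<Longrightarrow> q s \<le> s - t"
    and q_lin: "\<And>h. \<bar>h\<bar> \<le> \<delta> \<Longrightarrow> \<bar>q (t + h) - B * h\<bar> \<le> M * h\<^sup>2"
    and B: "0 < B" and M: "0 \<le> M" and \<delta>: "0 < \<delta>"
  shows "(\<lambda>N. ennreal (1 / sqrt (real N) * (\<Sum>k<N. a N k / a N (nat \<lfloor>real N * t\<rfloor>)))) \<longlonglongrightarrow> ennreal (sqrt (2 * pi / B))"
proof -
  define k0 where "k0 = (\<lambda>N. nat \<lfloor>real N * t\<rfloor>)"
  have k0N: "k0 N < N" if "0 < N" for N
  proof -
    have "real N * t < real N" using t that by simp
    then show ?thesis using t unfolding k0_def by (simp add: nat_less_iff floor_less_iff)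
  qed
  have k0_bounds: "real (k0 N) \<le> real N * t" "real N * t < real (k0 N) + 1" for N
    using t unfolding k0_def by (auto simp: of_nat_nat intro: floor_correct[THEN conjunct1])
  \<comment> \<open>The ratio to the reference term as a function of the signed offset from
    \<open>k0\<close>, extended by 0 outside the range of summation.\<close>
  define F where "F = (\<lambda>N (i::int). if 0 \<le> int (k0 N) + i \<and> int (k0 N) + i < int N then a N (nat (int (k0 N) + i)) / a N (k0 N) else 0)"
  have F_nonneg: "0 \<le> F N i" for N i
  proof (cases "0 < N")
    case True
    then show ?thesis unfolding F_def using pos[of _ N] k0N[of N]
      by (auto intro!: divide_nonneg_nonneg less_imp_le)
  qed (auto simp: F_def)
  have chain: "\<exists>E. F N i = exp (- E) \<and> \<bar>of_int i\<bar> * (\<bar>of_int i\<bar> - 1) / (2 * real N) \<le> E \<and>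
     (\<bar>of_int i\<bar> / real N \<le> \<delta> \<longrightarrow> \<bar>E - B * (\<bar>of_int i\<bar> * (\<bar>of_int i\<bar> - 1) / (2 * real N))\<bar>
        \<le> \<bar>of_int i\<bar> * (M * (\<bar>of_int i\<bar> / real N)\<^sup>2 + B / real N))"
    if i: "0 \<le> int (k0 N) + i" "int (k0 N) + i < int N" for N i
  proof -
    define k where "k = nat (int (k0 N) + i)"
    have k: "k < N" "real k - real (k0 N) = of_int i" using i by (auto simp: k_def)
    then have "0 < N" by simp
    have "F N i = a N k / a N (k0 N)" using i by (simp add: F_def k_def)
    moreover obtain E where E: "a N k = a N (k0 N) * exp (- E)"
      "\<bar>of_int i\<bar> * (\<bar>of_int i\<bar> - 1) / (2 * real N) \<le> E"
      "\<bar>of_int i\<bar> / real N \<le> \<delta> \<longrightarrow> \<bar>E - B * (\<bar>of_int i\<bar> * (\<bar>of_int i\<bar> - 1) / (2 * real N))\<bar>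
        \<le> \<bar>of_int i\<bar> * (M * (\<bar>of_int i\<bar> / real N)\<^sup>2 + B / real N)"
      using exp_chain_ratio[where N = N and a = "a N" and t = t and q = q and \<delta> = \<delta> and B = B and M = M, OF step t \<open>0 < N\<close> q_ge q_le q_lin less_imp_le[OF B] M, of "k0 N" k] k
      unfolding k0_def by auto
    moreover have "0 < a N (k0 N)" using pos k0N[OF \<open>0 < N\<close>] by simp
    ultimately show ?thesis by (intro exI[of _ E]) simp
  qed
  \<comment> \<open>The quadratic lower bound \<open>(x^2 - 3 * \<bar>x\<bar>) / 2\<close> for the
    exponent exceeds \<open>\<bar>x\<bar> - 25 / 8\<close> by
    \<open>(\<bar>x\<bar> - 5 / 2)^2 / 2\<close>.\<close>
  let ?w = "\<lambda>x::real. exp (25 / 8) * exp (- 1 * \<bar>x\<bar>)"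
  have bound: "F N \<lfloor>x * sqrt (real N)\<rfloor> \<le> ?w x" if "0 < N" for N x
  proof (cases "0 \<le> int (k0 N) + \<lfloor>x * sqrt (real N)\<rfloor> \<and> int (k0 N) + \<lfloor>x * sqrt (real N)\<rfloor> < int N")
    case True
    define s where "s = sqrt (real N)"
    have s: "1 \<le> s" "s\<^sup>2 = real N" using that by (auto simp: s_def)
    define j where "j = \<bar>of_int \<lfloor>x * s\<rfloor> :: real\<bar>"
    obtain E where E: "F N \<lfloor>x * s\<rfloor> = exp (- E)" "j * (j - 1) / (2 * s\<^sup>2) \<le> E"
      using chain[of N "\<lfloor>x * s\<rfloor>"] True s(2) unfolding s_def[symmetric] j_def by auto
    have "\<bar>x\<bar> - 25 / 8 \<le> j * (j - 1) / (2 * s\<^sup>2)"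
    proof -
      have "\<bar>x * s - of_int \<lfloor>x * s\<rfloor>\<bar> \<le> 1" by linarith
      then have j1: "\<bar>x\<bar> * s - 1 \<le> j" using s(1) by (auto simp: j_def abs_mult abs_if split: if_splits)
      have jj: "0 \<le> j * (j - 1)"
      proof (cases "\<lfloor>x * s\<rfloor> = 0")
        case False
        then have "1 \<le> \<bar>\<lfloor>x * s\<rfloor>\<bar>" by linarith
        then have "1 \<le> j" unfolding j_def by linarith
        then show ?thesis by simp
      qed (simp add: j_def)
      show ?thesis
      proof (cases "\<bar>x\<bar> \<le> 2")
        case True
        moreover have "0 \<le> j * (j - 1) / (2 * s\<^sup>2)" using jj by (intro divide_nonneg_nonneg) auto
        ultimately show ?thesis by linarith
      next
        case False
        \<comment> \<open>Beyond 2 both factors \<open>\<bar>x\<bar> * s - 1\<close> and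
          \<open>\<bar>x\<bar> * s - 2\<close> are nonnegative, so their product may be compared
          with \<open>j * (j - 1)\<close>. Up to 2 the claimed lower bound is negative.\<close>
        have "2 * 1 \<le> \<bar>x\<bar> * s" using False s(1) by (intro mult_mono) auto
        then have "(\<bar>x\<bar> * s - 1) * (\<bar>x\<bar> * s - 2) \<le> j * (j - 1)"
          using j1 by (intro mult_mono) auto
        moreover have "(\<bar>x\<bar> * s - 1) * (\<bar>x\<bar> * s - 2) \<ge> (\<bar>x\<bar>\<^sup>2 - 3 * \<bar>x\<bar>) * s\<^sup>2"
        proof -
          have "s * \<bar>x\<bar> \<le> s * s * \<bar>x\<bar>" using s(1) by (intro mult_right_mono) auto
          then show ?thesis by (simp add: power2_eq_square algebra_simps)
        qed
        ultimately have "(\<bar>x\<bar>\<^sup>2 - 3 * \<bar>x\<bar>) * s\<^sup>2 \<le> j * (j - 1)" by linarith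
        then have "(\<bar>x\<bar>\<^sup>2 - 3 * \<bar>x\<bar>) / 2 \<le> j * (j - 1) / (2 * s\<^sup>2)"
          using s(1) by (simp add: field_simps)
        moreover have "\<bar>x\<bar> - 25 / 8 \<le> (\<bar>x\<bar>\<^sup>2 - 3 * \<bar>x\<bar>) / 2"
          using zero_le_power2[of "\<bar>x\<bar> - 5 / 2"] by (simp only: power2_diff) (simp add: power2_eq_square)
        ultimately show ?thesis by linarith
      qed
    qed
    then have "- E \<le> 25 / 8 - \<bar>x\<bar>" using E(2) by linarith
    then show ?thesis unfolding s_def[symmetric] E(1) by (simp add: exp_add[symmetric])
  next
    case False
    then show ?thesis unfolding F_def by (subst if_not_P) auto
  qed
  have lim: "(\<lambda>N. F N \<lfloor>x * sqrt (real N)\<rfloor>) \<longlonglongrightarrow> exp (- x\<^sup>2 / (2 * (1 / sqrt B)\<^sup>2))" for x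
  proof -
    define i where "i = (\<lambda>N::nat. \<lfloor>x * sqrt (real N)\<rfloor>)"
    define j where "j = (\<lambda>N::nat. \<bar>of_int (i N) :: real\<bar>)"
    have inv: "(\<lambda>N. 1 / sqrt (real N)) \<longlonglongrightarrow> 0" by real_asymp
    have i_lim: "(\<lambda>N. of_int (i N) / sqrt (real N)) \<longlonglongrightarrow> x"
    proof (rule LIM_zero_cancel, rule Lim_null_comparison[OF _ inv])
      show "\<forall>\<^sub>F N in sequentially. norm (of_int (i N) / sqrt (real N) - x) \<le> 1 / sqrt (real N)"
        using eventually_gt_at_top[of 0]
      proof eventually_elim
        case (elim N)
        then have "of_int (i N) / sqrt (real N) - x = (of_int (i N) - x * sqrt (real N)) / sqrt (real N)"
          by (simp add: field_simps)
        moreover have "\<bar>of_int (i N) - x * sqrt (real N)\<bar> \<le> 1" unfolding i_def by linarith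
        ultimately show ?case by (simp add: abs_divide divide_right_mono)
      qed
    qed
    have j_lim: "(\<lambda>N. j N / sqrt (real N)) \<longlonglongrightarrow> \<bar>x\<bar>"
      unfolding j_def using tendsto_rabs[OF i_lim] by (simp add: abs_divide)
    have jN: "(\<lambda>N. j N / real N) \<longlonglongrightarrow> 0"
    proof -
      have "(\<lambda>N. (j N / sqrt (real N)) * (1 / sqrt (real N))) \<longlonglongrightarrow> \<bar>x\<bar> * 0"
        by (intro tendsto_mult j_lim inv)
      then show ?thesis by simp
    qed
    have j2: "(\<lambda>N. j N * (j N - 1) / (2 * real N)) \<longlonglongrightarrow> x\<^sup>2 / 2"
    proof -
      have "(\<lambda>N. (j N / sqrt (real N)) * (j N / sqrt (real N)) / 2 - (j N / real N) / 2) \<longlonglongrightarrow> \<bar>x\<bar> * \<bar>x\<bar> / 2 - 0 / 2"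
        by (intro tendsto_intros j_lim jN) auto
      then show ?thesis by (simp add: power2_eq_square algebra_simps diff_divide_distrib)
    qed
    have err: "(\<lambda>N. j N * (M * (j N / real N)\<^sup>2 + B / real N)) \<longlonglongrightarrow> 0"
    proof -
      have "(\<lambda>N. M * ((j N / sqrt (real N)) * (j N / sqrt (real N))) * (j N / real N) + B * (j N / real N))
          \<longlonglongrightarrow> M * (\<bar>x\<bar> * \<bar>x\<bar>) * 0 + B * 0"
        by (intro tendsto_intros j_lim jN)
      then show ?thesis by (simp add: power2_eq_square algebra_simps)
    qed
    have r_lim: "(\<lambda>N. real (k0 N) / real N) \<longlonglongrightarrow> t"
    proof (rule LIM_zero_cancel, rule Lim_null_comparison[OF _ lim_1_over_n])
      show "\<forall>\<^sub>F N in sequentially. norm (real (k0 N) / real N - t) \<le> 1 / real N"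
        using eventually_gt_at_top[of 0]
      proof eventually_elim
        case (elim N)
        then have "real (k0 N) / real N - t = (real (k0 N) - real N * t) / real N"
          by (simp add: field_simps)
        moreover have "\<bar>real (k0 N) - real N * t\<bar> \<le> 1" using k0_bounds[of N] by linarith
        ultimately show ?case by (simp add: abs_divide divide_right_mono)
      qed
    qed
    have iN: "(\<lambda>N. (real (k0 N) + of_int (i N)) / real N) \<longlonglongrightarrow> t"
    proof -
      have "(\<lambda>N. real (k0 N) / real N + (of_int (i N) / sqrt (real N)) * (1 / sqrt (real N))) \<longlonglongrightarrow> t + x * 0"
        by (intro tendsto_intros r_lim i_lim inv)
      then show ?thesis by (simp add: add_divide_distrib)
    qed
    have ev: "\<forall>\<^sub>F N in sequentially. 0 \<le> int (k0 N) + i N \<and> int (k0 N) + i N < int N"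
      using order_tendstoD(1)[OF iN t(1)] order_tendstoD(2)[OF iN t(2)] eventually_gt_at_top[of 0]
    proof eventually_elim
      case (elim N)
      then have "0 < real (k0 N) + of_int (i N)" "real (k0 N) + of_int (i N) < real N"
        by (auto simp: zero_less_divide_iff divide_less_eq)
      then show ?case by linarith
    qed
    have ev2: "\<forall>\<^sub>F N in sequentially. j N / real N \<le> \<delta>"
      using order_tendstoD(2)[OF jN \<delta>] by eventually_elim simp
    \<comment> \<open>The exponents supplied by \<open>chain\<close> exist separately for each N;
      the logarithm selects them as one sequence.\<close>
    define E where "E = (\<lambda>N. - ln (F N (i N)))"
    have ev3: "\<forall>\<^sub>F N in sequentially. F N (i N) = exp (- E N) \<and>
       \<bar>E N - B * (j N * (j N - 1) / (2 * real N))\<bar> \<le> j N * (M * (j N / real N)\<^sup>2 + B / real N)"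
      using ev ev2
    proof eventually_elim
      case (elim N)
      obtain e where "F N (i N) = exp (- e)"
        "\<bar>e - B * (j N * (j N - 1) / (2 * real N))\<bar> \<le> j N * (M * (j N / real N)\<^sup>2 + B / real N)"
        using chain[of N "i N"] elim unfolding j_def by auto
      then show ?case by (simp add: E_def)
    qed
    have "(\<lambda>N. E N - B * (j N * (j N - 1) / (2 * real N))) \<longlonglongrightarrow> 0"
      by (rule Lim_null_comparison[OF _ err]) (use ev3 in \<open>auto elim: eventually_mono\<close>)
    then have "(\<lambda>N. (E N - B * (j N * (j N - 1) / (2 * real N))) + B * (j N * (j N - 1) / (2 * real N))) \<longlonglongrightarrow> 0 + B * (x\<^sup>2 / 2)"
      by (intro tendsto_add tendsto_mult tendsto_const j2)
    then have "E \<longlonglongrightarrow> B * (x\<^sup>2 / 2)" by simp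
    then have "(\<lambda>N. exp (- E N)) \<longlonglongrightarrow> exp (- (B * (x\<^sup>2 / 2)))" by (intro tendsto_intros)
    moreover have "\<forall>\<^sub>F N in sequentially. exp (- E N) = F N (i N)"
      using ev3 by eventually_elim simp
    ultimately have "(\<lambda>N. F N (i N)) \<longlonglongrightarrow> exp (- (B * (x\<^sup>2 / 2)))"
      by (rule Lim_transform_eventually)
    moreover have "- (B * (x\<^sup>2 / 2)) = - x\<^sup>2 / (2 * (1 / sqrt B)\<^sup>2)"
      using B by (simp add: power_divide field_simps)
    ultimately show ?thesis unfolding i_def by (simp only:)
  qed
  have "(\<lambda>N. \<integral>\<^sup>+x. ennreal (F (Suc N) \<lfloor>x * sqrt (real (Suc N))\<rfloor>) \<partial>lborel)
      \<longlonglongrightarrow> (\<integral>\<^sup>+x. ennreal (exp (- x\<^sup>2 / (2 * (1 / sqrt B)\<^sup>2))) \<partial>lborel)"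
  proof (rule nn_integral_dominated_convergence)
    show "(\<lambda>x. ennreal (F (Suc N) \<lfloor>x * sqrt (real (Suc N))\<rfloor>)) \<in> borel_measurable lborel" for N
      by measurable
    show "AE x in lborel. ennreal (F (Suc N) \<lfloor>x * sqrt (real (Suc N))\<rfloor>) \<le> ennreal (?w x)" for N
      by (intro AE_I2 ennreal_leI bound) simp
    show "(\<integral>\<^sup>+x. ennreal (?w x) \<partial>lborel) < \<infinity>"
      by (rule nn_integral_exp_uminus_abs_finite) simp
    show "AE x in lborel. (\<lambda>N. ennreal (F (Suc N) \<lfloor>x * sqrt (real (Suc N))\<rfloor>)) \<longlonglongrightarrow> ennreal (exp (- x\<^sup>2 / (2 * (1 / sqrt B)\<^sup>2)))"
      by (intro AE_I2 tendsto_ennrealI LIMSEQ_Suc lim)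
  qed measurable
  also have "(\<integral>\<^sup>+x. ennreal (exp (- x\<^sup>2 / (2 * (1 / sqrt B)\<^sup>2))) \<partial>lborel) = ennreal (sqrt (2 * pi / B))"
    using B by (subst nn_integral_gaussian) (auto simp: power_divide)
  also have "(\<lambda>N. \<integral>\<^sup>+x. ennreal (F (Suc N) \<lfloor>x * sqrt (real (Suc N))\<rfloor>) \<partial>lborel)
      = (\<lambda>N. ennreal (1 / sqrt (real (Suc N)) * (\<Sum>k<Suc N. a (Suc N) k / a (Suc N) (k0 (Suc N)))))"
  proof
    fix N
    let ?N = "Suc N" and ?K = "(\<lambda>k. int k - int (k0 (Suc N))) ` {..<Suc N}"
    have "(\<integral>\<^sup>+x. ennreal (F ?N \<lfloor>x * sqrt (real ?N)\<rfloor>) \<partial>lborel) = ennreal (1 / sqrt (real ?N)) * (\<Sum>i\<in>?K. ennreal (F ?N i))"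
    proof (rule nn_integral_floor_step[where f = "\<lambda>i. ennreal (F ?N i)"])
      fix i assume "i \<notin> ?K"
      then have "\<not> (0 \<le> int (k0 ?N) + i \<and> int (k0 ?N) + i < int ?N)"
      proof (rule contrapos_nn)
        assume *: "0 \<le> int (k0 ?N) + i \<and> int (k0 ?N) + i < int ?N"
        show "i \<in> ?K"
          by (rule image_eqI[of _ _ "nat (int (k0 ?N) + i)"]) (use * in auto)
      qed
      then show "ennreal (F ?N i) = 0" unfolding F_def by (subst if_not_P) auto
    qed auto
    also have "(\<Sum>i\<in>?K. ennreal (F ?N i)) = (\<Sum>k<?N. ennreal (F ?N (int k - int (k0 ?N))))"
      by (subst sum.reindex) (auto simp: inj_on_def)
    also have "\<dots> = (\<Sum>k<?N. ennreal (a ?N k / a ?N (k0 ?N)))"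
      by (intro sum.cong refl) (auto simp: F_def)
    also have "\<dots> = ennreal (\<Sum>k<?N. a ?N k / a ?N (k0 ?N))"
      using pos[of _ ?N] k0N[of ?N] by (intro sum_ennreal) (auto intro!: divide_nonneg_nonneg less_imp_le)
    also have "ennreal (1 / sqrt (real ?N)) * \<dots> = ennreal (1 / sqrt (real ?N) * (\<Sum>k<?N. a ?N k / a ?N (k0 ?N)))"
      using pos[of _ ?N] k0N[of ?N]
      by (intro ennreal_mult''[symmetric] sum_nonneg) (auto intro!: divide_nonneg_nonneg less_imp_le)
    finally show "(\<integral>\<^sup>+x. ennreal (F ?N \<lfloor>x * sqrt (real ?N)\<rfloor>) \<partial>lborel)
        = ennreal (1 / sqrt (real ?N) * (\<Sum>k<?N. a ?N k / a ?N (k0 ?N)))" .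
  qed
  finally show ?thesis
    unfolding k0_def by (rule LIMSEQ_imp_Suc)
qed


text \<open>\<open>ln (1 + p * (exp h - 1))\<close> is the cumulant generating function of a
  Bernoulli variable, so its second-order term is half the variance
  \<open>p * (1 - p)\<close>.\<close>

lemma tendsto_ln_one_plus_expm1_quotient:
  fixes p :: real
  assumes "0 < p" "p < 1"
  shows "((\<lambda>h. (p * h - ln (1 + p * (exp h - 1))) / h\<^sup>2) \<longlongrightarrow> - (p * (1 - p) / 2)) (at 0)"
  using assms by (real_asymp simp: field_simps)

text \<open>The general shape of the logarithm of a rescaled beta prime density on the logarithmic
  scale. It is linear minus a nonnegative multiple of the convex function
  \<open>ln (1 + exp x)\<close> at an affine argument.\<close>

lemma concave_on_log_beta_prime_exponent:
  assumes "0 \<le> c"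
  shows "concave_on UNIV (\<lambda>y. a * y - c * ln (1 + exp (b + s * y)) + d)"
proof -
  have "convex_on UNIV (\<lambda>y. - (a * y - c * ln (1 + exp (b + s * y)) + d))"
  proof (rule f''_ge0_imp_convex)
    fix x :: real
    have pos: "0 < 1 + exp (b + s * x)" by (simp add: add_pos_pos)
    show "((\<lambda>y. - (a * y - c * ln (1 + exp (b + s * y)) + d)) has_real_derivative
        (- a + c * (s * exp (b + s * x) / (1 + exp (b + s * x))))) (at x)"
      using pos by (auto intro!: derivative_eq_intros simp: field_simps)
    show "((\<lambda>x. - a + c * (s * exp (b + s * x) / (1 + exp (b + s * x)))) has_real_derivative
        c * (s\<^sup>2 * exp (b + s * x) / (1 + exp (b + s * x))\<^sup>2)) (at x)"
    proof -
      have "((\<lambda>x. s * exp (b + s * x) / (1 + exp (b + s * x))) has_real_derivative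
          s\<^sup>2 * exp (b + s * x) / (1 + exp (b + s * x))\<^sup>2) (at x)"
        using pos by (auto intro!: derivative_eq_intros simp: power2_eq_square field_simps)
      from DERIV_add[OF DERIV_const[of "- a"] DERIV_cmult[OF this, of c]] show ?thesis by simp
    qed
    show "0 \<le> c * (s\<^sup>2 * exp (b + s * x) / (1 + exp (b + s * x))\<^sup>2)"
      using assms by simp
  qed simp
  then show ?thesis unfolding concave_on_def by simp
qed

text \<open>The mode \<open>ln (a N / b N)\<close> tends to the centre
  \<open>ln (\<alpha> / \<beta>)\<close>. Parameters known only up to a bounded error suffice: on
  the scale \<open>1 / sqrt N\<close> that error changes the exponent by a null sequence. This
  tolerates the rounding of the saddle point to an integer.\<close>

lemma log_beta_prime_local_limit:
  fixes a b :: "nat \<Rightarrow> real"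
  assumes \<alpha>: "0 < \<alpha>" and \<beta>: "0 < \<beta>"
    and ab: "\<And>N. \<bar>a N - real N * \<alpha>\<bar> \<le> C" "\<And>N. \<bar>b N - real N * \<beta>\<bar> \<le> C"
  defines "g \<equiv> (\<lambda>N y. 1 / sqrt (real N) * log_beta_prime (a N) (b N) (ln (\<alpha> / \<beta>) + 1 / sqrt (real N) * y))"
  shows "\<exists>D d. 0 < d \<and> (\<forall>\<^sub>F N in sequentially. \<forall>y. g N y \<le> D * exp (- d * \<bar>y\<bar>))"
    and "(\<lambda>N. g N y) \<longlonglongrightarrow> normal_density 0 (sqrt (1 / \<alpha> + 1 / \<beta>)) y"
proof -
  define c where "c = ln (\<alpha> / \<beta>)"
  define p where "p = \<alpha> / (\<alpha> + \<beta>)"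
  define s where "s = (\<lambda>N. 1 / sqrt (real N))"
  define \<phi> where "\<phi> = (\<lambda>h. ln (1 + exp (c + h)) - ln (1 + exp c))"
  \<comment> \<open>For N > 0, the logarithm of the density at \<open>c + y / sqrt N\<close>
    relative to its value at \<open>c\<close>. The linear terms cancel in the limit because
    \<open>(\<alpha> + \<beta>) * p = \<alpha>\<close>, and
    \<open>(\<alpha> + \<beta>) * p * (1 - p)\<close> is the reciprocal of
    \<open>1 / \<alpha> + 1 / \<beta>\<close>.\<close>
  define U where "U = (\<lambda>N y. a N * (s N * y) - (a N + b N) * \<phi> (s N * y))"
  let ?\<sigma> = "sqrt (1 / \<alpha> + 1 / \<beta>)"
  have p: "0 < p" "p < 1" using \<alpha> \<beta> by (auto simp: p_def)
  have \<sigma>: "0 < ?\<sigma>" "?\<sigma>\<^sup>2 = 1 / \<alpha> + 1 / \<beta>" using \<alpha> \<beta> by (auto simp: add_pos_pos)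
  have expc: "exp c = \<alpha> / \<beta>" using \<alpha> \<beta> by (simp add: c_def)
  have pos: "0 < 1 + exp x" for x :: real by (simp add: add_pos_pos)
  have s: "s \<longlonglongrightarrow> 0" unfolding s_def by real_asymp
  have ns: "real N * (s N)\<^sup>2 = 1" if "0 < N" for N using that by (simp add: s_def power_divide)
  have \<phi>_eq: "\<phi> h = ln (1 + p * (exp h - 1))" for h
  proof -
    have "\<phi> h = ln ((1 + exp (c + h)) / (1 + exp c))" using pos[of c] pos[of "c + h"] unfolding \<phi>_def by (simp add: ln_div)
    also have "(1 + exp (c + h)) / (1 + exp c) = 1 + p * (exp h - 1)"
      using \<alpha> \<beta> add_pos_pos[OF \<alpha> \<beta>] by (simp add: exp_add expc p_def divide_simps) (simp add: algebra_simps)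
    finally show ?thesis .
  qed
  have \<phi>_lim: "(\<phi> \<longlongrightarrow> 0) (at 0)"
  proof -
    have "isCont \<phi> 0" unfolding \<phi>_def using pos[of c] by (intro continuous_intros) auto
    then show ?thesis by (simp add: isCont_def) (simp add: \<phi>_def)
  qed
  have U_lim: "(\<lambda>N. U N y) \<longlonglongrightarrow> - y\<^sup>2 / (2 * ?\<sigma>\<^sup>2)" for y
  proof (cases "y = 0")
    case True
    then show ?thesis by (simp add: U_def \<phi>_def)
  next
    case False
    define h where "h = (\<lambda>N. s N * y)"
    have h0: "h \<longlonglongrightarrow> 0" using tendsto_mult[OF s tendsto_const[of y]] by (simp add: h_def)
    have "\<forall>\<^sub>F N in sequentially. h N \<noteq> 0"
      using eventually_gt_at_top[of 0] by eventually_elim (simp add: h_def s_def False)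
    then have h: "filterlim h (at 0) sequentially"
      using h0 by (simp add: filterlim_at)
    have 1: "(\<lambda>N. (p * h N - \<phi> (h N)) / (h N)\<^sup>2) \<longlonglongrightarrow> - (p * (1 - p) / 2)"
      using filterlim_compose[OF tendsto_ln_one_plus_expm1_quotient[OF p] h] by (simp add: \<phi>_eq)
    have \<phi>h: "(\<lambda>N. \<phi> (h N)) \<longlonglongrightarrow> 0" by (rule filterlim_compose[OF \<phi>_lim h])
    have 2: "(\<lambda>N. (a N - real N * \<alpha>) * h N) \<longlonglongrightarrow> 0" "(\<lambda>N. ((a N + b N) - real N * (\<alpha> + \<beta>)) * \<phi> (h N)) \<longlonglongrightarrow> 0"
    proof -
      have null: "(\<lambda>N. d N * e N) \<longlonglongrightarrow> 0" if "\<And>N. \<bar>d N\<bar> \<le> K" "e \<longlonglongrightarrow> 0" for d e :: "nat \<Rightarrow> real" and K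
      proof (rule Lim_null_comparison[where g = "\<lambda>N. K * \<bar>e N\<bar>"])
        show "(\<lambda>N. K * \<bar>e N\<bar>) \<longlonglongrightarrow> 0"
          using tendsto_mult[OF tendsto_const tendsto_rabs[OF that(2)], of K] by simp
      qed (use that(1) in \<open>auto simp: abs_mult intro!: always_eventually mult_right_mono\<close>)
      show "(\<lambda>N. (a N - real N * \<alpha>) * h N) \<longlonglongrightarrow> 0" by (rule null[OF ab(1) h0])
      have "\<bar>(a N + b N) - real N * (\<alpha> + \<beta>)\<bar> \<le> 2 * C" for N
        using ab[of N] unfolding distrib_left by linarith
      then show "(\<lambda>N. ((a N + b N) - real N * (\<alpha> + \<beta>)) * \<phi> (h N)) \<longlonglongrightarrow> 0"
        by (rule null[OF _ \<phi>h])
    qed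
    have L: "(\<lambda>N. (\<alpha> + \<beta>) * y\<^sup>2 * ((p * h N - \<phi> (h N)) / (h N)\<^sup>2) + (a N - real N * \<alpha>) * h N
        - ((a N + b N) - real N * (\<alpha> + \<beta>)) * \<phi> (h N)) \<longlonglongrightarrow> (\<alpha> + \<beta>) * y\<^sup>2 * (- (p * (1 - p) / 2)) + 0 - 0"
      by (intro tendsto_intros 1 2)
    have v: "(\<alpha> + \<beta>) * y\<^sup>2 * (- (p * (1 - p) / 2)) + 0 - 0 = - y\<^sup>2 / (2 * ?\<sigma>\<^sup>2)"
      unfolding \<sigma>(2) p_def using \<alpha> \<beta> add_pos_pos[OF \<alpha> \<beta>] by (simp add: divide_simps)
    have ev: "\<forall>\<^sub>F N in sequentially. (\<alpha> + \<beta>) * y\<^sup>2 * ((p * h N - \<phi> (h N)) / (h N)\<^sup>2) + (a N - real N * \<alpha>) * h N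
        - ((a N + b N) - real N * (\<alpha> + \<beta>)) * \<phi> (h N) = U N y"
      using eventually_gt_at_top[of 0]
    proof eventually_elim
      case (elim N)
      have "y\<^sup>2 / (h N)\<^sup>2 = real N"
        using ns[OF elim] False elim by (simp add: h_def s_def power_mult_distrib power_divide)
      then have "(\<alpha> + \<beta>) * y\<^sup>2 * ((p * h N - \<phi> (h N)) / (h N)\<^sup>2) = (\<alpha> + \<beta>) * real N * (p * h N - \<phi> (h N))"
        by (metis times_divide_eq_left times_divide_eq_right mult.assoc mult.commute)
      also have "\<dots> = real N * \<alpha> * h N - real N * (\<alpha> + \<beta>) * \<phi> (h N)"
      proof -
        have "(\<alpha> + \<beta>) * p = \<alpha>" using add_pos_pos[OF \<alpha> \<beta>] by (simp add: p_def)
        then have "real N * ((\<alpha> + \<beta>) * p) * h N = real N * \<alpha> * h N" by simp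
        then show ?thesis by (simp add: algebra_simps)
      qed
      finally show ?case unfolding U_def h_def[symmetric] by (simp add: h_def algebra_simps)
    qed
    show ?thesis by (rule Lim_transform_eventually[OF L[unfolded v] ev])
  qed
  have ab_pos: "\<forall>\<^sub>F N in sequentially. 0 < a N \<and> 0 < b N \<and> 0 < N"
  proof -
    have "filterlim (\<lambda>N. real N * \<alpha>) at_top sequentially" "filterlim (\<lambda>N. real N * \<beta>) at_top sequentially"
      using \<alpha> \<beta> by real_asymp+
    then have "\<forall>\<^sub>F N in sequentially. C < real N * \<alpha>" "\<forall>\<^sub>F N in sequentially. C < real N * \<beta>"
      by (simp_all add: filterlim_at_top_dense)
    then show ?thesis using eventually_gt_at_top[of 0]
    proof eventually_elim
      case (elim N)
      then show ?case using ab[of N] by linarith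
    qed
  qed
  define A where "A = (\<lambda>N. 1 / sqrt (real N) * log_beta_prime (a N) (b N) c)"
  have g_eq: "g N y = A N * exp (U N y)" for N y
  proof -
    have "exp (a N * (c + s N * y)) / (1 + exp (c + s N * y)) powr (a N + b N)
        = (exp (a N * c) / (1 + exp c) powr (a N + b N)) * exp (U N y)"
      using pos[of c] pos[of "c + s N * y"]
      by (simp add: U_def \<phi>_def powr_def exp_diff exp_add distrib_left right_diff_distrib field_simps)
    then show ?thesis
      unfolding g_def A_def log_beta_prime_def by (simp add: c_def s_def)
  qed
  have meas: "U N \<in> borel_measurable borel" for N unfolding U_def \<phi>_def by measurable
  have conc: "\<forall>\<^sub>F N in sequentially. concave_on UNIV (U N)"
    using ab_pos
  proof eventually_elim
    case (elim N)
    have "U N = (\<lambda>y. (a N * s N) * y - (a N + b N) * ln (1 + exp (c + s N * y)) + (a N + b N) * ln (1 + exp c))"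
      by (simp add: U_def \<phi>_def fun_eq_iff algebra_simps)
    then show ?case using concave_on_log_beta_prime_exponent[of "a N + b N"] elim by simp
  qed
  have int: "\<forall>\<^sub>F N in sequentially. (\<integral>\<^sup>+y. ennreal (A N * exp (U N y)) \<partial>lborel) = 1"
    using ab_pos
  proof eventually_elim
    case (elim N)
    have "1 = (\<integral>\<^sup>+x. ennreal (log_beta_prime (a N) (b N) x) \<partial>lborel)"
      using elim by (simp add: nn_integral_log_beta_prime)
    also have "\<dots> = ennreal (s N) * (\<integral>\<^sup>+y. ennreal (log_beta_prime (a N) (b N) (c + s N * y)) \<partial>lborel)"
      using elim by (subst nn_integral_real_affine[where c = "s N" and t = c]) (auto simp: s_def)
    also have "\<dots> = (\<integral>\<^sup>+y. ennreal (g N y) \<partial>lborel)"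
      using elim by (subst nn_integral_cmult[symmetric])
        (auto simp: g_def s_def c_def simp flip: ennreal_mult' intro!: nn_integral_cong)
    finally show ?case by (simp add: g_eq)
  qed
  have U0: "U N 0 = 0" for N by (simp add: U_def \<phi>_def)
  show "\<exists>D d. 0 < d \<and> (\<forall>\<^sub>F N in sequentially. \<forall>y. g N y \<le> D * exp (- d * \<bar>y\<bar>))"
    unfolding g_eq by (rule local_limit_concave(1)[OF meas conc U0 U_lim \<sigma>(1) int])
  show "(\<lambda>N. g N y) \<longlonglongrightarrow> normal_density 0 ?\<sigma> y"
    unfolding g_eq by (rule local_limit_concave(2)[OF meas conc U0 U_lim \<sigma>(1) int])
qed

section \<open>The macroscopic density\<close>

text \<open>The set of disagreement is open, and a nonempty open set contains an interval of
  positive length.\<close>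

lemma AE_lborel_eq_imp_eq_of_continuous:
  fixes f g :: "real \<Rightarrow> ennreal"
  assumes "continuous_on UNIV f" "continuous_on UNIV g" and ae: "AE x in lborel. f x = g x"
  shows "f x = g x"
proof (rule ccontr)
  let ?S = "{x. f x \<noteq> g x}"
  assume "f x \<noteq> g x"
  moreover have S: "open ?S" by (rule open_Collect_neq) fact+
  ultimately obtain e where e: "0 < e" "ball x e \<subseteq> ?S"
    by (auto simp: open_contains_ball)
  have "emeasure lborel ?S = 0"
    using ae S by (subst (asm) AE_iff_null) (auto simp: null_sets_def)
  moreover have "emeasure lborel {x - e<..<x + e} \<le> emeasure lborel ?S"
    using e S by (intro emeasure_mono) (auto simp: ball_eq_greaterThanLessThan)
  ultimately show False using e by simp
qed

text \<open>Zero factors are permitted: the inverse of 0 is infinite and inverses of finite numbers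
  are positive, so the undetermined product of 0 and infinity never occurs.\<close>

lemma prod_inverse_ennreal:
  assumes "finite A" "\<And>i. i \<in> A \<Longrightarrow> 0 \<le> f i"
  shows "(\<Prod>i\<in>A. inverse (ennreal (f i))) = inverse (ennreal (\<Prod>i\<in>A. f i))"
  using assms
proof (induction rule: finite_induct)
  case (insert i A)
  then have "0 \<le> f i" "0 \<le> prod f A" by (auto intro: prod_nonneg)
  then show ?case using insert by (simp add: ennreal_mult ennreal_inverse_mult)
qed simp

text \<open>Indices start at 0 here: \<open>l j\<close> stands for \<open>lam (Suc j)\<close> and
  \<open>m + 1\<close> for the number of matrices.\<close>

locale dilation_parameters =
  fixes m :: nat and l :: "nat \<Rightarrow> real"
  assumes l_0: "l 0 = 0" and l_nonneg: "j \<le> m \<Longrightarrow> 0 \<le> l j"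
begin

definition G :: "real \<Rightarrow> real" where
  "G t = (\<Prod>j\<le>m. (t + l j) / (1 - t))"

definition lnG :: "real \<Rightarrow> real" where
  "lnG t = (\<Sum>j\<le>m. ln (t + l j) - ln (1 - t))"

text \<open>The derivative of \<open>lnG\<close>. Its j-th summand is also the limiting variance of
  the j-th beta prime factor when the saddle point is \<open>t\<close>.\<close>

definition slope :: "real \<Rightarrow> real" where
  "slope t = (\<Sum>j\<le>m. 1 / (t + l j) + 1 / (1 - t))"

text \<open>The derivative of \<^const>\<open>G\<close>, in a form that is continuous up to \<open>0\<close>.\<close>

definition G' :: "real \<Rightarrow> real" where
  "G' t = (\<Sum>i\<le>m. (1 + l i) / (1 - t)\<^sup>2 * (\<Prod>j\<in>{..m}-{i}. (t + l j) / (1 - t)))"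

lemma shift_pos: "j \<le> m \<Longrightarrow> 0 < t \<Longrightarrow> 0 < t + l j"
  using l_nonneg[of j] by simp

lemma exp_lnG:
  assumes "0 < t" "t < 1"
  shows "exp (lnG t) = G t"
  unfolding lnG_def G_def exp_sum[OF finite_atMost]
  using assms shift_pos by (intro prod.cong refl) (simp add: exp_diff)

lemma slope_ge: "0 < t \<Longrightarrow> t < 1 \<Longrightarrow> 1 \<le> slope t"
proof -
  assume t: "0 < t" "t < 1"
  have "1 \<le> 1 / (1 - t)" "0 \<le> 1 / (t + l 0)" using t by (simp_all add: l_0)
  then have "1 \<le> 1 / (t + l 0) + 1 / (1 - t)" by linarith
  also have "\<dots> \<le> slope t"
    unfolding slope_def
  proof (rule member_le_sum)
    fix j assume "j \<in> {..m} - {0}"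
    then have "0 < t + l j" using t shift_pos by simp
    then show "0 \<le> 1 / (t + l j) + 1 / (1 - t)" using t by simp
  qed auto
  finally show ?thesis .
qed

lemma G'_eq:
  assumes "0 < t" "t < 1"
  shows "G' t = G t * slope t"
  unfolding G'_def slope_def sum_distrib_left
proof (intro sum.cong refl)
  fix i assume i: "i \<in> {..m}"
  then have p: "0 < t + l i" using shift_pos assms by simp
  have "G t = (t + l i) / (1 - t) * (\<Prod>j\<in>{..m}-{i}. (t + l j) / (1 - t))"
    unfolding G_def using i by (intro prod.remove) auto
  moreover have "(1 + l i) / (1 - t)\<^sup>2 = (t + l i) / (1 - t) * (1 / (t + l i) + 1 / (1 - t))"
    using p assms by (simp add: divide_simps power2_eq_square)
  ultimately show "(1 + l i) / (1 - t)\<^sup>2 * (\<Prod>j\<in>{..m}-{i}. (t + l j) / (1 - t)) = G t * (1 / (t + l i) + 1 / (1 - t))"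
    by simp
qed

text \<open>Every summand but the one for index 0 contains the factor \<open>l 0 = 0\<close>. The
  value vanishes as soon as a second parameter is 0, and then the density is infinite at the
  origin.\<close>

lemma G'_0: "G' 0 = (\<Prod>j\<in>{1..m}. l j)"
proof -
  have "G' 0 = (\<Sum>i\<le>m. (1 + l i) * (\<Prod>j\<in>{..m}-{i}. l j))" by (simp add: G'_def)
  also have "\<dots> = (\<Sum>i\<in>{0}. (1 + l i) * (\<Prod>j\<in>{..m}-{i}. l j))"
    by (rule sum.mono_neutral_right) (auto simp: l_0 intro!: prod_zero bexI[of _ 0])
  also have "\<dots> = (\<Prod>j\<in>{..m}-{0}. l j)" by (simp add: l_0)
  also have "{..m} - {0} = {1..m}" by auto
  finally show ?thesis .
qed

lemma continuous_on_G': "continuous_on {0..<1} G'"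
  unfolding G'_def by (intro continuous_intros) auto

lemma continuous_on_G: "continuous_on {0..<1} G"
  unfolding G_def by (intro continuous_intros) auto

lemma DERIV_lnG:
  assumes "0 < t" "t < 1"
  shows "(lnG has_real_derivative slope t) (at t)"
  unfolding lnG_def slope_def
proof (rule DERIV_sum)
  fix j assume "j \<in> {..m}"
  then have "0 < t + l j" using assms shift_pos by simp
  then show "((\<lambda>t. ln (t + l j) - ln (1 - t)) has_real_derivative 1 / (t + l j) + 1 / (1 - t)) (at t)"
    using assms by (auto intro!: derivative_eq_intros)
qed

text \<open>The summand \<open>- ln (1 - t)\<close> of index 0 already grows at rate at least 1, and
  all other contributions are nondecreasing. This global rate supplies both the domination in
  Laplace's method and the monotonicity of \<open>G\<close>.\<close>

lemma lnG_diff_ge: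
  assumes "0 < s" "s \<le> t" "t < 1"
  shows "t - s \<le> lnG t - lnG s"
proof -
  let ?f = "\<lambda>j. (ln (t + l j) - ln (1 - t)) - (ln (s + l j) - ln (1 - s))"
  have f: "t - s \<le> ?f j" if "j \<le> m" for j
  proof -
    have "ln (s + l j) \<le> ln (t + l j)" using assms shift_pos[OF that, of s] by simp
    moreover have "t - s \<le> ln (1 - s) - ln (1 - t)"
    proof -
      have "ln ((1 - t) / (1 - s)) \<le> (1 - t) / (1 - s) - 1" using assms by (intro ln_le_minus_one) simp
      also have "\<dots> = - ((t - s) / (1 - s))" using assms by (simp add: field_simps)
      also have "\<dots> \<le> - (t - s)"
      proof -
        have "(t - s) * (1 - s) \<le> t - s" using assms mult_left_mono[of "1 - s" 1 "t - s"] by simp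
        then have "t - s \<le> (t - s) / (1 - s)" using assms by (simp add: pos_le_divide_eq)
        then show ?thesis by simp
      qed
      finally show ?thesis using assms by (simp add: ln_div)
    qed
    ultimately show ?thesis by simp
  qed
  have "t - s \<le> ?f 0" using f[of 0] by simp
  also have "\<dots> \<le> (\<Sum>j\<le>m. ?f j)"
  proof (rule member_le_sum)
    fix j assume "j \<in> {..m} - {0}"
    then show "0 \<le> ?f j" using f[of j] assms by auto
  qed auto
  also have "\<dots> = lnG t - lnG s" unfolding lnG_def by (simp only: sum_subtractf)
  finally show ?thesis .
qed

text \<open>Half the distance from \<open>t\<close> to the ends of the interval keeps every relative
  increment below 1/2 in absolute value, where \<open>ln (1 + x)\<close> differs from
  \<open>x\<close> by at most \<open>2 * x^2\<close>.\<close>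

lemma lnG_quadratic_bound:
  assumes "0 < t" "t < 1"
  obtains \<delta> M where "0 < \<delta>" "0 \<le> M"
    "\<And>h. \<bar>h\<bar> \<le> \<delta> \<Longrightarrow> \<bar>lnG (t + h) - lnG t - slope t * h\<bar> \<le> M * h\<^sup>2"
proof (rule that)
  define M where "M = (\<Sum>j\<le>m. 2 / (t + l j)\<^sup>2 + 2 / (1 - t)\<^sup>2)"
  show "0 < min t (1 - t) / 2" using assms by simp
  show "0 \<le> M" unfolding M_def by (intro sum_nonneg) simp
  fix h assume h: "\<bar>h\<bar> \<le> min t (1 - t) / 2"
  have eq: "lnG (t + h) - lnG t - slope t * h
      = (\<Sum>j\<le>m. (ln (1 + h / (t + l j)) - h / (t + l j)) - (ln (1 + - h / (1 - t)) - - h / (1 - t)))"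
    unfolding lnG_def slope_def sum_distrib_right sum_subtractf[symmetric]
  proof (intro sum.cong refl)
    fix j assume "j \<in> {..m}"
    then have p: "0 < t + l j" "t \<le> t + l j" using shift_pos l_nonneg assms by auto
    have "0 < t + h + l j" "0 < 1 - (t + h)" using h p assms by auto
    note p' = this
    have ln_quot: "ln (x / y) = ln x - ln y" if "0 < x" "0 < y" for x y :: real
      using that by (simp add: ln_div)
    have e: "1 + h / (t + l j) = (t + h + l j) / (t + l j)" "1 + - h / (1 - t) = (1 - (t + h)) / (1 - t)"
      using p assms by (auto simp: field_simps)
    have "ln (1 + h / (t + l j)) = ln (t + h + l j) - ln (t + l j)"
      unfolding e by (rule ln_quot) (use p p' in auto)
    moreover have "ln (1 + - h / (1 - t)) = ln (1 - (t + h)) - ln (1 - t)"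
      unfolding e by (rule ln_quot) (use assms p' in auto)
    ultimately show "(ln (t + h + l j) - ln (1 - (t + h))) - (ln (t + l j) - ln (1 - t)) - (1 / (t + l j) + 1 / (1 - t)) * h
        = (ln (1 + h / (t + l j)) - h / (t + l j)) - (ln (1 + - h / (1 - t)) - - h / (1 - t))"
      by (simp only:) (simp add: algebra_simps)
  qed
  have "\<bar>lnG (t + h) - lnG t - slope t * h\<bar> \<le> (\<Sum>j\<le>m. (2 / (t + l j)\<^sup>2 + 2 / (1 - t)\<^sup>2) * h\<^sup>2)"
    unfolding eq
  proof (rule order_trans[OF sum_abs sum_mono])
    fix j assume "j \<in> {..m}"
    then have p: "0 < t + l j" "t \<le> t + l j" using shift_pos l_nonneg assms by auto
    have "\<bar>h / (t + l j)\<bar> \<le> 1 / 2" "\<bar>- h / (1 - t)\<bar> \<le> 1 / 2"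
      using h p assms by (auto simp: abs_divide divide_le_eq)
    from this[THEN abs_ln_one_plus_x_minus_x_bound]
    have "\<bar>(ln (1 + h / (t + l j)) - h / (t + l j)) - (ln (1 + - h / (1 - t)) - - h / (1 - t))\<bar>
        \<le> 2 * (h / (t + l j))\<^sup>2 + 2 * (- h / (1 - t))\<^sup>2" by linarith
    also have "\<dots> = (2 / (t + l j)\<^sup>2 + 2 / (1 - t)\<^sup>2) * h\<^sup>2"
      by (simp add: power_divide algebra_simps)
    finally show "\<bar>(ln (1 + h / (t + l j)) - h / (t + l j)) - (ln (1 + - h / (1 - t)) - - h / (1 - t))\<bar>
        \<le> (2 / (t + l j)\<^sup>2 + 2 / (1 - t)\<^sup>2) * h\<^sup>2" .
  qed
  also have "\<dots> = M * h\<^sup>2" unfolding M_def by (rule sum_distrib_right[symmetric])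
  finally show "\<bar>lnG (t + h) - lnG t - slope t * h\<bar> \<le> M * h\<^sup>2" .
qed

section \<open>\<open>G\<close> as a homeomorphism of half-open intervals, and its inverse\<close>

lemma G_0: "G 0 = 0"
  unfolding G_def by (rule prod_zero, simp, rule bexI[of _ 0]) (simp_all add: l_0)

lemma G_pos: "0 < t \<Longrightarrow> t < 1 \<Longrightarrow> 0 < G t"
  using exp_lnG[of t] exp_gt_zero[of "lnG t"] by simp

lemma G_strict_mono:
  assumes "0 \<le> s" "s < t" "t < 1"
  shows "G s < G t"
proof (cases "s = 0")
  case True
  then show ?thesis using G_pos[of t] assms by (simp add: G_0)
next
  case False
  then have "lnG s < lnG t" using lnG_diff_ge[of s t] assms by simp
  then show ?thesis using assms False exp_lnG[of s] exp_lnG[of t] by (metis exp_less_mono less_le less_le_trans order.strict_trans)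
qed

lemma image_G: "G ` {0..<1} = {0..}"
proof (intro equalityI subsetI)
  fix u assume "u \<in> G ` {0..<1}"
  then show "u \<in> {0..}" using G_0 G_pos by (force simp: le_less)
next
  fix u :: real assume u: "u \<in> {0..}"
  \<comment> \<open>The solution of \<open>s / (1 - s) = 1 + u\<close>. It is at least 1/2, so all
    factors of \<open>G s\<close> other than the one of index 0 are at least 1.\<close>
  define s where "s = (1 + u) / (2 + u)"
  have s: "1 / 2 \<le> s" "s < 1" "s / (1 - s) = 1 + u" using u by (auto simp: s_def field_simps)
  have "G s = (s + l 0) / (1 - s) * (\<Prod>j\<in>{..m}-{0}. (s + l j) / (1 - s))"
    unfolding G_def by (intro prod.remove) auto
  moreover have "1 \<le> (\<Prod>j\<in>{..m}-{0}. (s + l j) / (1 - s))"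
  proof (rule prod_ge_1)
    fix j assume "j \<in> {..m} - {0}"
    then show "1 \<le> (s + l j) / (1 - s)" using l_nonneg[of j] s by (simp add: le_divide_eq)
  qed
  ultimately have "1 + u \<le> G s" using s u mult_left_mono[of 1 _ "1 + u"] by (simp add: l_0)
  then have "\<exists>t\<ge>0. t \<le> s \<and> G t = u"
    using u s by (intro IVT') (auto simp: G_0 intro: continuous_on_subset[OF continuous_on_G])
  then show "u \<in> G ` {0..<1}" using s by auto
qed

lemma ex_homeomorphism_G: "\<exists>g. homeomorphism {0..<1} {0..} G g"
proof (rule homeomorphism_into_1d)
  show "inj_on G {0..<1}"
  proof (rule linorder_inj_onI)
    fix s t :: real assume "s < t" "s \<in> {0..<1}" "t \<in> {0..<1}"
    then show "G s \<noteq> G t" using G_strict_mono[of s t] by simp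
  qed auto
  show "path_connected {0..<1::real}" by (rule convex_imp_path_connected) simp
qed (rule continuous_on_G, rule image_G)

text \<open>The inverse of \<open>G\<close>, chosen as a homeomorphism so that continuity up to 0
  comes with it; the continuity of the density at the origin rests on this.\<close>

definition \<tau> :: "real \<Rightarrow> real" where
  "\<tau> = (SOME g. homeomorphism {0..<1} {0..} G g)"

lemma homeomorphism_\<tau>: "homeomorphism {0..<1} {0..} G \<tau>"
  unfolding \<tau>_def using ex_homeomorphism_G by (rule someI_ex)

lemma \<tau>_G: "t \<in> {0..<1} \<Longrightarrow> \<tau> (G t) = t"
  and G_\<tau>: "0 \<le> u \<Longrightarrow> G (\<tau> u) = u"
  and \<tau>_range: "0 \<le> u \<Longrightarrow> \<tau> u \<in> {0..<1}"
  and continuous_on_\<tau>: "continuous_on {0..} \<tau>"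
  using homeomorphism_apply1[OF homeomorphism_\<tau>, of t] homeomorphism_apply2[OF homeomorphism_\<tau>, of u]
    homeomorphism_image2[OF homeomorphism_\<tau>] homeomorphism_cont2[OF homeomorphism_\<tau>]
  by (simp, simp, blast, simp)

lemma \<tau>_0: "\<tau> 0 = 0"
  using \<tau>_G[of 0] by (simp add: G_0)

lemma \<tau>_pos: "0 < u \<Longrightarrow> 0 < \<tau> u \<and> \<tau> u < 1"
proof -
  assume u: "0 < u"
  then have "\<tau> u \<noteq> 0" using G_\<tau>[of u] G_0 by auto
  with \<tau>_range[of u] u show ?thesis by auto
qed

text \<open>The inverse of \<open>lnG\<close>, which is also the distribution function of
  \<open>lnG\<close> at a uniform variable on the unit interval.\<close>

definition T :: "real \<Rightarrow> real" where
  "T x = \<tau> (exp x)"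

lemma T_range: "0 < T x" "T x < 1"
  unfolding T_def using \<tau>_pos[of "exp x"] by auto

lemma T_lnG: "0 < t \<Longrightarrow> t < 1 \<Longrightarrow> T (lnG t) = t"
  unfolding T_def by (simp add: exp_lnG \<tau>_G)

lemma lnG_T: "lnG (T x) = x"
proof -
  have "exp (lnG (T x)) = exp x" using exp_lnG[OF T_range] by (simp add: T_def G_\<tau>)
  then show ?thesis by simp
qed

lemma strict_mono_T: "strict_mono T"
proof (rule strict_monoI, rule ccontr)
  fix x y :: real assume "x < y" "\<not> T x < T y"
  then have "lnG (T y) \<le> lnG (T x)"
    using lnG_diff_ge[of "T y" "T x"] T_range[of x] T_range[of y] by simp
  then show False using \<open>x < y\<close> by (simp add: lnG_T)
qed

lemma continuous_on_T: "continuous_on UNIV T"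
  unfolding T_def by (intro continuous_on_compose2[OF continuous_on_\<tau>] continuous_intros) auto

lemma DERIV_T: "(T has_real_derivative 1 / slope (T x)) (at x)"
proof -
  have "(T has_real_derivative inverse (slope (T x))) (at x)"
  proof (rule DERIV_inverse_function[where f = lnG])
    show "slope (T x) \<noteq> 0" using slope_ge[OF T_range[of x]] by simp
    show "x - 1 < x" "x < x + 1" by auto
    show "isCont T x" using continuous_on_T by (simp add: continuous_on_eq_continuous_at)
  qed (auto simp: lnG_T intro: DERIV_lnG T_range)
  then show ?thesis by (simp add: inverse_eq_divide)
qed

lemma T_tendsto_1: "(T \<longlongrightarrow> 1) at_top"
proof (rule order_tendstoI)
  fix a :: real assume "a < 1"
  define t where "t = max a (1 / 2)"
  have t: "0 < t" "t < 1" "a \<le> t" using \<open>a < 1\<close> by (auto simp: t_def)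
  show "\<forall>\<^sub>F x in at_top. a < T x"
    using eventually_gt_at_top[of "lnG t"]
  proof eventually_elim
    case (elim x)
    then have "T (lnG t) < T x" by (rule strict_monoD[OF strict_mono_T])
    then show ?case using T_lnG[OF t(1,2)] t(3) by simp
  qed
next
  fix a :: real assume "1 < a"
  then show "\<forall>\<^sub>F x in at_top. T x < a"
    using T_range(2) by (intro always_eventually allI) (meson less_trans)
qed

lemma measurable_slope [measurable]: "slope \<in> borel_measurable borel"
  unfolding slope_def by measurable

lemma measurable_lnG [measurable]: "lnG \<in> borel_measurable borel"
  unfolding lnG_def by measurable

lemma measurable_T [measurable]: "T \<in> borel_measurable borel"
  using continuous_on_T by (rule borel_measurable_continuous_onI)

lemma nn_integral_lnG:
  assumes [measurable]: "F \<in> borel_measurable borel"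
  shows "(\<integral>\<^sup>+t\<in>{0<..<1}. F (lnG t) \<partial>lborel) = (\<integral>\<^sup>+x. ennreal (1 / slope (T x)) * F x \<partial>lborel)"
proof (rule nn_integral_substitution_inverse[where T = T])
  show "0 \<le> 1 / slope (T x)" for x
    using slope_ge[OF T_range[of x]] by simp
  show "T x \<in> {0<..<1}" for x using T_range by simp
  show "T (lnG t) = t" if "t \<in> {0<..<1}" for t using that T_lnG by simp
qed (measurable, rule strict_mono_T, rule DERIV_T, rule T_tendsto_1)

text \<open>The inverse is taken in the extended nonnegative reals, where it is continuous also at
  0. A zero of \<open>G'\<close> at the origin thus becomes the value infinity without breaking
  continuity.\<close>

definition radial_density :: "complex \<Rightarrow> ennreal" where
  "radial_density z = inverse (ennreal (pi * G' (\<tau> ((norm z)\<^sup>2))))"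

lemma radial_density_nonzero:
  assumes "z \<noteq> 0"
  shows "radial_density z = ennreal (1 / (pi * (norm z)\<^sup>2 * slope (T (ln ((norm z)\<^sup>2)))))"
proof -
  have u: "0 < (norm z)\<^sup>2" using assms by simp
  let ?t = "T (ln ((norm z)\<^sup>2))"
  have t: "\<tau> ((norm z)\<^sup>2) = ?t" using u by (simp add: T_def)
  have "G' ?t = (norm z)\<^sup>2 * slope ?t"
    using G'_eq[OF T_range] G_\<tau>[of "(norm z)\<^sup>2"] t by simp
  moreover have "0 < slope ?t" using slope_ge[OF T_range, of "ln ((norm z)\<^sup>2)"] by simp
  ultimately show ?thesis
    unfolding radial_density_def t using u by (subst inverse_ennreal) (auto simp: inverse_eq_divide mult.assoc)
qed

lemma continuous_on_radial_density: "continuous_on UNIV radial_density"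
proof -
  have "continuous_on UNIV (\<lambda>z::complex. \<tau> ((norm z)\<^sup>2))"
    by (rule continuous_on_compose2[OF continuous_on_\<tau>]) (auto intro!: continuous_intros)
  then have "continuous_on UNIV (\<lambda>z::complex. G' (\<tau> ((norm z)\<^sup>2)))"
    by (rule continuous_on_compose2[OF continuous_on_G']) (rule image_subsetI, rule \<tau>_range, simp)
  then have "continuous_on UNIV (\<lambda>z::complex. ennreal (pi * G' (\<tau> ((norm z)\<^sup>2))))"
    by (intro continuous_on_ennreal continuous_on_mult continuous_on_const)
  then show ?thesis
    unfolding radial_density_def by (rule continuous_on_inverse_ennreal)
qed

lemma nn_integral_radial_density:
  "(\<integral>\<^sup>+z. epowr (norm z) (2 * s) * radial_density z \<partial>lborel) = (\<integral>\<^sup>+t\<in>{0<..<1}. ennreal (exp (s * lnG t)) \<partial>lborel)"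
proof -
  let ?F = "\<lambda>x. ennreal (exp (s * x)) * ennreal (1 / (pi * exp x * slope (T x)))"
  have "(\<integral>\<^sup>+z. epowr (norm z) (2 * s) * radial_density z \<partial>lborel) = (\<integral>\<^sup>+z. ?F (ln ((norm (z::complex))\<^sup>2)) \<partial>lborel)"
  proof (rule nn_integral_cong_AE, rule eventually_mono[OF AE_lborel_singleton[of 0]])
    fix z :: complex assume z: "z \<noteq> 0"
    have "norm z powr (2 * s) = exp (s * ln ((norm z)\<^sup>2))"
      using z by (simp add: powr_def ln_realpow)
    then show "epowr (norm z) (2 * s) * radial_density z = ?F (ln ((norm z)\<^sup>2))"
      using z by (simp add: epowr_def radial_density_nonzero)
  qed
  also have "\<dots> = (\<integral>\<^sup>+x. ennreal (pi * exp x) * ?F x \<partial>lborel)"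
    by (rule nn_integral_ln_norm_sq) measurable
  also have "\<dots> = (\<integral>\<^sup>+x. ennreal (1 / slope (T x)) * ennreal (exp (s * x)) \<partial>lborel)"
  proof (intro nn_integral_cong)
    fix x
    have "0 < slope (T x)" using slope_ge[OF T_range, of x] by simp
    then show "ennreal (pi * exp x) * ?F x = ennreal (1 / slope (T x)) * ennreal (exp (s * x))"
      by (simp flip: ennreal_mult)
  qed
  also have "\<dots> = (\<integral>\<^sup>+t\<in>{0<..<1}. ennreal (exp (s * lnG t)) \<partial>lborel)"
    by (rule nn_integral_lnG[symmetric]) measurable
  finally show ?thesis .
qed

text \<open>For nonnegative \<open>s\<close> the only singularity is at 1, for negative
  \<open>s\<close> only at 0, and the restriction on \<open>s\<close> keeps its order at most 1/2.
  The exponents are left unsimplified because the two summands are the integrands of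
  \<open>Beta (1 / 2) 1\<close> and \<open>Beta 1 (1 / 2)\<close>.\<close>

lemma exp_lnG_bound:
  assumes t: "0 < t" "t < 1" and s: "\<bar>s\<bar> \<le> 1 / (2 * (real m + 1))"
  shows "exp (s * lnG t) \<le> (\<Prod>j\<le>m. 1 + l j) * (t powr (1 / 2 - 1) * (1 - t) powr (1 - 1) + t powr (1 - 1) * (1 - t) powr (1 / 2 - 1))"
proof -
  have l1: "1 \<le> 1 + l j" if "j \<le> m" for j using l_nonneg[OF that] by simp
  have K: "1 \<le> (\<Prod>j\<le>m. 1 + l j)" using l1 by (intro prod_ge_1) auto
  have lnt: "ln t < 0" "ln (1 - t) < 0" using t by auto
  have sm: "\<bar>s\<bar> * (real m + 1) \<le> 1 / 2" using s by (simp add: field_simps)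
  show ?thesis
  proof (cases "0 \<le> s")
    case True
    have s1: "s \<le> 1" using s True by (smt (verit) divide_le_eq_1 of_nat_0_le_iff)
    have "s * lnG t = (\<Sum>j\<le>m. s * ln (t + l j)) + (s * (real m + 1)) * (- ln (1 - t))"
      unfolding lnG_def by (simp add: sum_subtractf right_diff_distrib sum_distrib_left algebra_simps)
    also have "\<dots> \<le> (\<Sum>j\<le>m. ln (1 + l j)) + 1 / 2 * (- ln (1 - t))"
    proof (intro add_mono sum_mono mult_right_mono)
      fix j assume "j \<in> {..m}"
      then have "s * ln (t + l j) \<le> s * ln (1 + l j)"
        using shift_pos[of j t] t True by (intro mult_left_mono) auto
      also have "\<dots> \<le> 1 * ln (1 + l j)" using l1[of j] \<open>j \<in> {..m}\<close> s1 by (intro mult_right_mono) auto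
      finally show "s * ln (t + l j) \<le> ln (1 + l j)" by simp
    qed (use sm True lnt in auto)
    finally have "exp (s * lnG t) \<le> exp ((\<Sum>j\<le>m. ln (1 + l j)) + 1 / 2 * (- ln (1 - t)))" by simp
    also have "\<dots> = (\<Prod>j\<le>m. 1 + l j) * (1 - t) powr (1 / 2 - 1)"
    proof -
      have "exp (\<Sum>j\<le>m. ln (1 + l j)) = (\<Prod>j\<le>m. 1 + l j)"
        unfolding exp_sum[OF finite_atMost] by (intro prod.cong refl exp_ln) (use l1 in force)
      then show ?thesis using t by (simp only: exp_add) (simp add: powr_def)
    qed
    also have "\<dots> \<le> (\<Prod>j\<le>m. 1 + l j) * (t powr (1 / 2 - 1) * (1 - t) powr (1 - 1) + t powr (1 - 1) * (1 - t) powr (1 / 2 - 1))"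
      using K t by (intro mult_left_mono) auto
    finally show ?thesis .
  next
    case False
    have "s * lnG t = (\<Sum>j\<le>m. s * ln (t + l j)) + (- s * (real m + 1)) * ln (1 - t)"
      unfolding lnG_def by (simp add: sum_subtractf right_diff_distrib sum_distrib_left algebra_simps)
    also have "\<dots> \<le> (\<Sum>j\<le>m. s * ln t) + 0"
    proof (intro add_mono sum_mono)
      fix j assume "j \<in> {..m}"
      then have "ln t \<le> ln (t + l j)" using l_nonneg[of j] t by simp
      then show "s * ln (t + l j) \<le> s * ln t" using False by (simp add: mult_left_mono_neg)
    next
      have "0 \<le> - s * (real m + 1)" using False by (intro mult_nonneg_nonneg) auto
      then show "- s * (real m + 1) * ln (1 - t) \<le> 0" using lnt(2) by (intro mult_nonneg_nonpos) auto
    qed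
    also have "\<dots> = (- s * (real m + 1)) * (- ln t)" by (simp add: algebra_simps)
    also have "\<dots> \<le> 1 / 2 * (- ln t)" using sm False lnt by (intro mult_right_mono) auto
    finally have "exp (s * lnG t) \<le> t powr (1 / 2 - 1)" using t by (simp add: powr_def)
    also have "\<dots> \<le> 1 * (t powr (1 / 2 - 1) * (1 - t) powr (1 - 1) + t powr (1 - 1) * (1 - t) powr (1 / 2 - 1))"
      using t by simp
    also have "\<dots> \<le> (\<Prod>j\<le>m. 1 + l j) * (t powr (1 / 2 - 1) * (1 - t) powr (1 - 1) + t powr (1 - 1) * (1 - t) powr (1 / 2 - 1))"
      using K by (intro mult_right_mono) auto
    finally show ?thesis .
  qed
qed

lemma nn_integral_exp_lnG_finite:
  assumes s: "\<bar>s\<bar> \<le> 1 / (2 * (real m + 1))"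
  shows "(\<integral>\<^sup>+t\<in>{0<..<1}. ennreal (exp (s * lnG t)) \<partial>lborel) < \<infinity>"
proof -
  let ?K = "\<Prod>j\<le>m. 1 + l j"
  let ?h = "\<lambda>a b t. t powr (a - 1) * (1 - t) powr (b - 1) :: real"
  have K: "0 \<le> ?K" using l_nonneg by (intro prod_nonneg) auto
  have B: "(\<integral>\<^sup>+t. ennreal (?h a b t) * indicator {0..1} t \<partial>lborel) = ennreal (Beta a b)" if "0 < a" "0 < b" for a b
    by (rule nn_integral_has_integral_lebesgue'[OF _ has_integral_Beta_real[OF that]]) simp
  have "(\<integral>\<^sup>+t\<in>{0<..<1}. ennreal (exp (s * lnG t)) \<partial>lborel)
      \<le> (\<integral>\<^sup>+t. ennreal ?K * (ennreal (?h (1 / 2) 1 t) * indicator {0..1} t + ennreal (?h 1 (1 / 2) t) * indicator {0..1} t) \<partial>lborel)"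
  proof (rule nn_integral_mono)
    fix t :: real
    show "ennreal (exp (s * lnG t)) * indicator {0<..<1} t
        \<le> ennreal ?K * (ennreal (?h (1 / 2) 1 t) * indicator {0..1} t + ennreal (?h 1 (1 / 2) t) * indicator {0..1} t)"
    proof (cases "t \<in> {0<..<1}")
      case True
      then have "ennreal (exp (s * lnG t)) \<le> ennreal (?K * (?h (1 / 2) 1 t + ?h 1 (1 / 2) t))"
        using exp_lnG_bound[OF _ _ s] by (intro ennreal_leI) auto
      also have "\<dots> = ennreal ?K * (ennreal (?h (1 / 2) 1 t) + ennreal (?h 1 (1 / 2) t))"
        using K by (subst ennreal_mult) (auto intro!: ennreal_plus arg_cong2[where f = "(*)"])
      finally show ?thesis using True by (simp add: indicator_def)
    qed simp
  qed
  also have "\<dots> = ennreal ?K * (ennreal (Beta (1 / 2) 1) + ennreal (Beta 1 (1 / 2)))"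
    using B[of "1 / 2" 1] B[of 1 "1 / 2"] by (simp add: nn_integral_cmult nn_integral_add)
  also have "\<dots> < \<infinity>" by (simp add: ennreal_mult_less_top)
  finally show ?thesis .
qed

section \<open>Convergence\<close>

lemma mellin_integrand:
  assumes lam: "\<And>j. j \<le> m \<Longrightarrow> lam (Suc j) = l j" and t: "0 < t" "t < 1"
  shows "(\<Prod>i\<in>{1..Suc m}. (t + lam i) powr s / (1 - t) powr s) = exp (s * lnG t)"
proof -
  have "(\<Prod>i\<in>{1..Suc m}. (t + lam i) powr s / (1 - t) powr s) = (\<Prod>j\<le>m. (t + lam (Suc j)) powr s / (1 - t) powr s)"
    using prod.atLeast1_atMost_eq[of "\<lambda>i. (t + lam i) powr s / (1 - t) powr s" "Suc m"]
    by (simp only: One_nat_def lessThan_Suc_atMost)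
  also have "\<dots> = (\<Prod>j\<le>m. exp (s * (ln (t + l j) - ln (1 - t))))"
  proof (intro prod.cong refl)
    fix j assume "j \<in> {..m}"
    then have "0 < t + l j" "lam (Suc j) = l j" using shift_pos[of j t] t lam by auto
    then show "(t + lam (Suc j)) powr s / (1 - t) powr s = exp (s * (ln (t + l j) - ln (1 - t)))"
      using t by (simp add: powr_def exp_diff right_diff_distrib)
  qed
  also have "\<dots> = exp (s * lnG t)"
    unfolding lnG_def sum_distrib_left exp_sum[OF finite_atMost] ..
  finally show ?thesis .
qed

lemma nn_integral_mellin_integrand:
  assumes "\<And>j. j \<le> m \<Longrightarrow> lam (Suc j) = l j"
  shows "(\<integral>\<^sup>+t\<in>{0<..<1}. ennreal (\<Prod>i\<in>{1..Suc m}. (t + lam i) powr s / (1 - t) powr s) \<partial>lborel)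
    = (\<integral>\<^sup>+t\<in>{0<..<1}. ennreal (exp (s * lnG t)) \<partial>lborel)"
proof (intro nn_integral_cong)
  fix t :: real
  show "ennreal (\<Prod>i\<in>{1..Suc m}. (t + lam i) powr s / (1 - t) powr s) * indicator {0<..<1} t
      = ennreal (exp (s * lnG t)) * indicator {0<..<1} t"
  proof (cases "t \<in> {0<..<1}")
    case True
    then have "(\<Prod>i\<in>{1..Suc m}. (t + lam i) powr s / (1 - t) powr s) = exp (s * lnG t)"
      by (intro mellin_integrand assms) auto
    then show ?thesis by (simp only:)
  qed (simp only: indicator_simps mult_zero_right simp_thms)
qed

lemma is_macroscopic_density_radial_density:
  assumes lam: "\<And>j. j \<le> m \<Longrightarrow> lam (Suc j) = l j"
  shows "is_macroscopic_density (Suc m) lam radial_density"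
  unfolding is_macroscopic_density_def
proof (intro conjI allI impI)
  show "radial_density z = radial_density w" if "norm z = norm w" for z w
    using that by (simp add: radial_density_def)
  show "continuous_on UNIV radial_density" by (rule continuous_on_radial_density)
  show "radial_density z < \<infinity>" if "z \<noteq> 0" for z
    using that by (simp add: radial_density_nonzero)
next
  fix s
  show "(\<integral>\<^sup>+z. epowr (norm z) (2 * s) * radial_density z \<partial>lborel)
      = (\<integral>\<^sup>+t\<in>{0<..<1}. ennreal (\<Prod>i\<in>{1..Suc m}. (t + lam i) powr s / (1 - t) powr s) \<partial>lborel)"
    by (rule trans[OF nn_integral_radial_density nn_integral_mellin_integrand[where lam = lam, OF lam, symmetric]])
qed

text \<open>For a radial density the Mellin transform is the moment generating function of the law
  of \<open>ln |z|^2\<close>. Equality of laws gives equality almost everywhere, and continuity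
  extends it to every point.\<close>

lemma macroscopic_density_unique:
  assumes lam: "\<And>j. j \<le> m \<Longrightarrow> lam (Suc j) = l j"
    and \<rho>: "is_macroscopic_density (Suc m) lam \<rho>"
  shows "\<rho> = radial_density"
proof -
  \<comment> \<open>The law of \<open>ln |z|^2\<close> under \<open>\<rho>\<close>, with
    \<open>\<rho>\<close> evaluated at the positive real point of modulus
    \<open>exp (x / 2)\<close>. The radius \<open>d\<close> below is half of \<open>1 / n\<close>,
    strictly inside the range of the Mellin identity.\<close>
  define M where "M = (\<lambda>\<rho>::complex \<Rightarrow> ennreal. density lborel (\<lambda>x. ennreal (pi * exp x) * \<rho> (of_real (exp (x / 2)))))"
  define d where "d = 1 / (2 * (real m + 1))"
  have d: "0 < d" "\<And>s. \<bar>s\<bar> \<le> d \<Longrightarrow> s < 1 / real (Suc m)"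
  proof -
    show "0 < d" by (simp add: d_def)
    have "d < 1 / real (Suc m)" by (simp add: d_def field_simps)
    then show "s < 1 / real (Suc m)" if "\<bar>s\<bar> \<le> d" for s using that by linarith
  qed
  have cont: "continuous_on UNIV \<rho>'" if "is_macroscopic_density (Suc m) lam \<rho>'" for \<rho>'
    using that unfolding is_macroscopic_density_def by (elim conjE)
  have rot: "\<rho>' z = \<rho>' w" if "is_macroscopic_density (Suc m) lam \<rho>'" "norm z = norm w" for \<rho>' z w
    using that unfolding is_macroscopic_density_def by blast
  have contx: "continuous_on UNIV (\<lambda>x::real. \<rho>' (of_real (exp (x / 2))))"
    if "is_macroscopic_density (Suc m) lam \<rho>'" for \<rho>'
    by (rule continuous_on_compose2[OF cont[OF that]]) (auto intro!: continuous_intros)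
  have measx: "(\<lambda>x::real. \<rho>' (of_real (exp (x / 2)))) \<in> borel_measurable borel"
    if "is_macroscopic_density (Suc m) lam \<rho>'" for \<rho>'
    by (rule borel_measurable_continuous_onI[OF contx[OF that]])
  have mgf: "(\<integral>\<^sup>+x. ennreal (exp (s * x)) \<partial>M \<rho>') = (\<integral>\<^sup>+t\<in>{0<..<1}. ennreal (exp (s * lnG t)) \<partial>lborel)"
    if \<rho>': "is_macroscopic_density (Suc m) lam \<rho>'" and s: "\<bar>s\<bar> \<le> d" for \<rho>' s
  proof -
    note [measurable] = measx[OF \<rho>']
    have "(\<integral>\<^sup>+x. ennreal (exp (s * x)) \<partial>M \<rho>')
        = (\<integral>\<^sup>+x. ennreal (pi * exp x) * (ennreal (exp (s * x)) * \<rho>' (of_real (exp (x / 2)))) \<partial>lborel)"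
      unfolding M_def by (subst nn_integral_density) (auto simp: mult_ac)
    also have "\<dots> = (\<integral>\<^sup>+z. ennreal (exp (s * ln ((norm (z::complex))\<^sup>2))) * \<rho>' (of_real (exp (ln ((norm z)\<^sup>2) / 2))) \<partial>lborel)"
      by (rule nn_integral_ln_norm_sq[symmetric]) measurable
    also have "\<dots> = (\<integral>\<^sup>+z. epowr (norm z) (2 * s) * \<rho>' z \<partial>lborel)"
    proof (rule nn_integral_cong_AE, rule eventually_mono[OF AE_lborel_singleton[of 0]])
      fix z :: complex assume z: "z \<noteq> 0"
      have "norm z powr (2 * s) = exp (s * ln ((norm z)\<^sup>2))" "exp (ln ((norm z)\<^sup>2) / 2) = norm z"
        using z by (simp_all add: powr_def ln_realpow)
      moreover have "\<rho>' (of_real (norm z)) = \<rho>' z" by (rule rot[OF \<rho>']) simp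
      ultimately show "ennreal (exp (s * ln ((norm z)\<^sup>2))) * \<rho>' (of_real (exp (ln ((norm z)\<^sup>2) / 2)))
          = epowr (norm z) (2 * s) * \<rho>' z"
        using z by (simp add: epowr_def)
    qed
    also have "\<dots> = (\<integral>\<^sup>+t\<in>{0<..<1}. ennreal (\<Prod>i\<in>{1..Suc m}. (t + lam i) powr s / (1 - t) powr s) \<partial>lborel)"
      using \<rho>' d(2)[OF s] unfolding is_macroscopic_density_def by blast
    also have "\<dots> = (\<integral>\<^sup>+t\<in>{0<..<1}. ennreal (exp (s * lnG t)) \<partial>lborel)"
      by (rule nn_integral_mellin_integrand[where lam = lam, OF lam])
    finally show ?thesis .
  qed
  note rd = is_macroscopic_density_radial_density[OF lam]
  have "M radial_density = M \<rho>"
  proof (rule mgf_unique[OF _ _ d(1)])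
    show "(\<integral>\<^sup>+x. ennreal (exp (s * x)) \<partial>M radial_density) < \<infinity>" if "\<bar>s\<bar> \<le> d" for s
      using mgf[OF rd that] nn_integral_exp_lnG_finite[of s] that by (simp add: d_def)
    show "(\<integral>\<^sup>+x. ennreal (exp (s * x)) \<partial>M radial_density) = (\<integral>\<^sup>+x. ennreal (exp (s * x)) \<partial>M \<rho>)" if "\<bar>s\<bar> \<le> d" for s
      using mgf[OF rd that] mgf[OF \<rho> that] by simp
    show "prob_space (M radial_density)"
    proof (rule prob_spaceI)
      have "emeasure (M radial_density) (space (M radial_density)) = (\<integral>\<^sup>+x. ennreal (exp (0 * x)) \<partial>M radial_density)"
        by simp
      also have "\<dots> = 1" using mgf[OF rd, of 0] d(1) by simp
      finally show "emeasure (M radial_density) (space (M radial_density)) = 1" .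
    qed
  qed (simp_all add: M_def)
  then have "AE x in lborel. ennreal (pi * exp x) * radial_density (of_real (exp (x / 2)))
      = ennreal (pi * exp x) * \<rho> (of_real (exp (x / 2)))"
    unfolding M_def using measx[OF rd] measx[OF \<rho>]
    by (intro sigma_finite_measure.density_unique sigma_finite_lborel) auto
  then have "AE x in lborel. radial_density (of_real (exp (x / 2))) = \<rho> (of_real (exp (x / 2)))"
    by eventually_elim (simp add: ennreal_mult_cancel_left)
  note ae = this
  have eq: "radial_density (of_real (exp (x / 2))) = \<rho> (of_real (exp (x / 2)))" for x
    using AE_lborel_eq_imp_eq_of_continuous[OF contx[OF rd] contx[OF \<rho>] ae] .
  have nz: "\<rho> z = radial_density z" if "z \<noteq> 0" for z
  proof -
    have "exp (ln ((norm z)\<^sup>2) / 2) = norm z" using that by (simp add: ln_realpow)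
    then have "radial_density (of_real (norm z)) = \<rho> (of_real (norm z))" using eq[of "ln ((norm z)\<^sup>2)"] by simp
    moreover have "\<rho> (of_real (norm z)) = \<rho> z" by (rule rot[OF \<rho>]) simp
    moreover have "radial_density (of_real (norm z)) = radial_density z" by (simp add: radial_density_def)
    ultimately show ?thesis by simp
  qed
  \<comment> \<open>The origin corresponds to no real \<open>x\<close>, so its value is recovered as
    the limit along nonzero points.\<close>
  have lims: "(\<rho> \<longlongrightarrow> \<rho> 0) (at 0)" "(radial_density \<longlongrightarrow> radial_density 0) (at 0)"
    using cont[OF \<rho>] cont[OF rd] by (auto simp: continuous_on_def)
  have "\<forall>\<^sub>F z in at 0. \<rho> z = radial_density z"
    using nz by (auto simp: eventually_at_filter)
  then have "(radial_density \<longlongrightarrow> \<rho> 0) (at 0)"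
    by (rule Lim_transform_eventually[OF lims(1)])
  then have z0: "\<rho> 0 = radial_density 0"
    by (rule tendsto_unique[OF at_neq_bot _ lims(2)])
  show ?thesis
  proof
    show "\<rho> z = radial_density z" for z
      using nz z0 by (cases "z = 0") auto
  qed
qed

text \<open>\<open>Beta (a + 1) b / Beta a (b + 1)\<close> is \<open>a / b\<close>, and with
  \<open>s = (k + 1) / N\<close> the parameters divided by N are \<open>s + l j\<close> and
  \<open>1 - s\<close>. The product over \<open>j\<close> is therefore exactly
  \<open>G s\<close>.\<close>

lemma density_coeff_Suc:
  assumes lam: "\<And>j. j \<le> m \<Longrightarrow> lam (Suc j) = l j" and k: "Suc k < N"
  shows "density_coeff m N (\<lambda>i. lam i * real N) (Suc k)
    = density_coeff m N (\<lambda>i. lam i * real N) k * exp (- lnG ((real k + 1) / real N))"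
proof -
  let ?s = "(real k + 1) / real N"
  have N: "0 < real N" and kN: "real k + 1 < real N" using k by auto
  have s: "0 < ?s" "?s < 1" using N kN by auto
  let ?B = "\<lambda>k j. Beta (lam (Suc j) * real N + (real k + 1)) (real N + 1 - (real k + 1))"
  have "(\<Prod>j\<le>m. ?B (Suc k) j) = (\<Prod>j\<le>m. ?B k j * ((?s + l j) / (1 - ?s)))"
  proof (intro prod.cong refl)
    fix j assume "j \<in> {..m}"
    then have lj: "lam (Suc j) = l j" "0 \<le> l j" using lam l_nonneg by auto
    define a where "a = l j * real N + real k + 1"
    define b where "b = real N - real k - 1"
    have ab: "0 < a" "0 < b" using lj kN by (auto simp: a_def b_def add_nonneg_pos)
    have nz: "a \<notin> \<int>\<^sub>\<le>\<^sub>0" "b \<notin> \<int>\<^sub>\<le>\<^sub>0" using ab by (auto dest: nonpos_Ints_nonpos)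
    have B1: "?B (Suc k) j = Beta (a + 1) b" and B0: "?B k j = Beta a (b + 1)"
      by (simp_all add: a_def b_def lj algebra_simps)
    have q: "(?s + l j) / (1 - ?s) = a / b" using N kN by (simp add: a_def b_def divide_simps) (simp add: algebra_simps)
    have "Gamma (a + 1) = a * Gamma a" "Gamma (b + 1) = b * Gamma b" using nz by (simp_all add: Gamma_plus1)
    then show "?B (Suc k) j = ?B k j * ((?s + l j) / (1 - ?s))"
      unfolding B1 B0 q unfolding Beta_def using ab by (simp add: add_ac)
  qed
  also have "\<dots> = (\<Prod>j\<le>m. ?B k j) * exp (lnG ?s)"
    unfolding exp_lnG[OF s] G_def by (rule prod.distrib)
  finally show ?thesis
    unfolding density_coeff_def by (simp only: exp_minus) (simp add: divide_inverse mult.commute)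
qed

lemma eigenvalue_density_tendsto_nonzero:
  assumes lam: "\<And>j. j \<le> m \<Longrightarrow> lam (Suc j) = l j" and z: "z \<noteq> 0"
  shows "(\<lambda>N. eigenvalue_density (Suc m) N (\<lambda>i. lam i * real N) z) \<longlonglongrightarrow> radial_density z"
proof -
  define u where "u = (norm z)\<^sup>2"
  \<comment> \<open>The saddle point: consecutive summands have ratio
    \<open>u / G ((k + 1) / N)\<close>, which crosses 1 where \<open>G t = u\<close>.\<close>
  define t where "t = T (ln u)"
  define k0 where "k0 = (\<lambda>N. nat \<lfloor>real N * t\<rfloor>)"
  have u: "0 < u" using z by (simp add: u_def)
  have t: "0 < t" "t < 1" using T_range by (auto simp: t_def)
  have lnGt: "lnG t = ln u" by (simp add: t_def lnG_T)
  have sl: "0 < slope t" using slope_ge[OF t] by simp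
  have k0: "real (k0 N) \<le> real N * t" "real N * t < real (k0 N) + 1" for N
    using t unfolding k0_def by (auto simp: of_nat_nat intro: floor_correct[THEN conjunct1])
  let ?C = "\<lambda>N. density_coeff m N (\<lambda>i. lam i * real N)"
  let ?a = "\<lambda>N k. ?C N k * u ^ k"
  let ?p = "\<lambda>N j. log_beta_prime (lam (Suc j) * real N + (real (k0 N) + 1)) (real N + 1 - (real (k0 N) + 1))"
  obtain \<delta> M where \<delta>: "0 < \<delta>" "0 \<le> M"
    "\<And>h. \<bar>h\<bar> \<le> \<delta> \<Longrightarrow> \<bar>lnG (t + h) - lnG t - slope t * h\<bar> \<le> M * h\<^sup>2"
    using lnG_quadratic_bound[OF t] by blast
  have sum_lim: "(\<lambda>N. ennreal (1 / sqrt (real N) * (\<Sum>k<N. ?a N k / ?a N (nat \<lfloor>real N * t\<rfloor>)))) \<longlonglongrightarrow> ennreal (sqrt (2 * pi / slope t))"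
  proof (rule discrete_laplace[where q = "\<lambda>s. lnG s - lnG t" and a = ?a, OF _ _ t _ _ _ sl \<delta>(2,1)])
    fix N k :: nat assume "k < N"
    then show "0 < ?a N k"
      unfolding density_coeff_def using u lam l_nonneg
      by (intro mult_pos_pos divide_pos_pos prod_pos ballI Beta_pos) (auto intro!: add_nonneg_pos)
  next
    fix N k :: nat assume k: "Suc k < N"
    have mult4: "c * x * (v * w) = c * w * (x * v)" for c x v w :: real by simp
    have e: "exp (- (lnG ((real k + 1) / real N) - lnG t)) = exp (- lnG ((real k + 1) / real N)) * u"
      using u by (simp add: lnGt exp_diff exp_minus field_simps)
    have dc: "?C N (Suc k) = ?C N k * exp (- lnG ((real k + 1) / real N))"
      by (rule density_coeff_Suc) (use lam k in auto)
    show "?a N (Suc k) = ?a N k * exp (- (lnG ((real k + 1) / real N) - lnG t))"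
      unfolding dc e power_Suc by (rule mult4)
  next
    fix s assume "t \<le> s" "s < 1" then show "s - t \<le> lnG s - lnG t" using lnG_diff_ge[of t s] t by simp
  next
    fix s assume "0 < s" "s \<le> t" then show "lnG s - lnG t \<le> s - t" using lnG_diff_ge[of s t] t by simp
  next
    fix h assume "\<bar>h\<bar> \<le> \<delta>" then show "\<bar>(lnG (t + h) - lnG t) - slope t * h\<bar> \<le> M * h\<^sup>2" by (rule \<delta>(3))
  qed
  \<comment> \<open>These centres add up to \<open>lnG t = ln u\<close> exactly, so the standardised
    convolution is evaluated at 0 for every positive N.\<close>
  let ?c = "\<lambda>j. ln ((t + l j) / (1 - t))"
  let ?s = "\<lambda>N. 1 / sqrt (real N)"
  let ?\<sigma> = "\<lambda>j. sqrt (1 / (t + l j) + 1 / (1 - t))"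
  let ?g = "\<lambda>N j y. ennreal (?s N) * ennreal (?p N j (?c j + ?s N * y))"
  \<comment> \<open>The error is that of rounding \<open>N * t\<close> down to \<open>k0 N\<close>,
    at most 1 for every N.\<close>
  have ab: "\<bar>(lam (Suc j) * real N + (real (k0 N) + 1)) - real N * (t + l j)\<bar> \<le> 1"
      "\<bar>(real N + 1 - (real (k0 N) + 1)) - real N * (1 - t)\<bar> \<le> 1" if "j \<le> m" for j N
    using k0[of N] lam[OF that] by (auto simp: algebra_simps abs_if)
  have g_eq: "?g N j y = ennreal (?s N * ?p N j (?c j + ?s N * y))" for N j y
    by (rule ennreal_mult'[symmetric]) simp
  have sig: "0 < ?\<sigma> j" if "j \<le> m" for j
    using shift_pos[OF that t(1)] t by (auto intro!: add_pos_pos)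
  \<comment> \<open>Positivity of the deviations is asked for at all indices, so they are set to 1
    beyond \<open>m\<close>.\<close>
  have "(\<lambda>N. conv_iter (?g N) m 0) \<longlonglongrightarrow> ennreal (normal_density 0 (sqrt (\<Sum>j\<le>m. (if j \<le> m then ?\<sigma> j else 1)\<^sup>2)) 0)"
  proof (rule tendsto_conv_iter[THEN conjunct2, rule_format])
    show "?g N j \<in> borel_measurable borel" for N j by measurable
    show "\<exists>D d. 0 < d \<and> (\<forall>\<^sub>F N in sequentially. \<forall>y. ?g N j y \<le> ennreal (D * exp (- d * \<bar>y\<bar>)))" if j: "j \<le> m" for j
    proof -
      obtain D d where d: "0 < d" and D: "\<forall>\<^sub>F N in sequentially. \<forall>y. ?s N * ?p N j (?c j + ?s N * y) \<le> D * exp (- d * \<bar>y\<bar>)"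
        using log_beta_prime_local_limit(1)[OF shift_pos[OF j t(1)] _ ab[OF j]] t by auto
      have "\<forall>\<^sub>F N in sequentially. \<forall>y. ?g N j y \<le> ennreal (D * exp (- d * \<bar>y\<bar>))"
        unfolding g_eq using D by eventually_elim (intro allI ennreal_leI, blast)
      with d show ?thesis by blast
    qed
    show "(\<lambda>N. ?g N j y) \<longlonglongrightarrow> ennreal (normal_density 0 (if j \<le> m then ?\<sigma> j else 1) y)" if j: "j \<le> m" for j y
      unfolding g_eq using log_beta_prime_local_limit(2)[OF shift_pos[OF j t(1)] _ ab[OF j]] t j
      by (intro tendsto_ennrealI) simp
    show "0 < (if j \<le> m then ?\<sigma> j else 1)" for j using sig[of j] by simp
  qed
  also have "(\<Sum>j\<le>m. (if j \<le> m then ?\<sigma> j else 1)\<^sup>2) = slope t"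
    unfolding slope_def using shift_pos[of _ t] t by (intro sum.cong refl) (simp add: add_nonneg_nonneg less_imp_le)
  also have "normal_density 0 (sqrt (slope t)) 0 = 1 / sqrt (2 * pi * slope t)"
    using sl by (simp add: normal_density_def)
  finally have conv_lim: "(\<lambda>N. conv_iter (?g N) m 0) \<longlonglongrightarrow> ennreal (1 / sqrt (2 * pi * slope t))" .
  have "(\<lambda>N. ennreal (1 / (pi * u)) * conv_iter (?g N) m 0 * ennreal (1 / sqrt (real N) * (\<Sum>k<N. ?a N k / ?a N (nat \<lfloor>real N * t\<rfloor>))))
      \<longlonglongrightarrow> ennreal (1 / (pi * u)) * ennreal (1 / sqrt (2 * pi * slope t)) * ennreal (sqrt (2 * pi / slope t))"
    by (intro tendsto_mult_ennreal tendsto_const conv_lim sum_lim) (auto simp: ennreal_mult_eq_top_iff)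
  also have "ennreal (1 / (pi * u)) * ennreal (1 / sqrt (2 * pi * slope t)) * ennreal (sqrt (2 * pi / slope t))
      = radial_density z"
  proof -
    have "1 / sqrt (2 * pi * slope t) * sqrt (2 * pi / slope t) = 1 / slope t"
      using sl by (simp add: real_sqrt_mult real_sqrt_divide)
    then show ?thesis
      unfolding radial_density_nonzero[OF z] u_def[symmetric] t_def[symmetric] mult.assoc
      using u sl by (simp flip: ennreal_mult)
  qed
  finally show ?thesis
  proof (rule Lim_transform_eventually)
    show "\<forall>\<^sub>F N in sequentially. ennreal (1 / (pi * u)) * conv_iter (?g N) m 0
        * ennreal (1 / sqrt (real N) * (\<Sum>k<N. ?a N k / ?a N (nat \<lfloor>real N * t\<rfloor>)))
        = eigenvalue_density (Suc m) N (\<lambda>i. lam i * real N) z"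
      using eventually_gt_at_top[of 0]
    proof eventually_elim
      case (elim N)
      have "real N * t < real N" using t elim by simp
      then have "real (k0 N) < real N" using k0(1)[of N] by linarith
      then have k: "k0 N < N" by simp
      have "conv_iter (?g N) m 0 = ennreal (?s N) * conv_iter (\<lambda>j x. ennreal (?p N j x)) m ((\<Sum>j\<le>m. ?c j) + ?s N * 0)"
        by (rule conv_iter_scale) (use elim in auto)
      also have "(\<Sum>j\<le>m. ?c j) + ?s N * 0 = ln u"
      proof -
        have "?c j = ln (t + l j) - ln (1 - t)" if "j \<le> m" for j
          using shift_pos[OF that t(1)] t by (simp add: ln_div)
        then show ?thesis unfolding lnGt[symmetric] lnG_def by simp
      qed
      finally show ?case
        using eigenvalue_density_nonzero[of m "\<lambda>i. lam i * real N" "k0 N" N z] k z lam l_nonneg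
        by (simp add: u_def k0_def)
    qed
  qed
qed

section \<open>The limit at the origin and the closed form for vanishing parameters\<close>

lemma radial_density_0: "radial_density 0 = inverse (ennreal (pi * (\<Prod>j\<in>{1..m}. l j)))"
  by (simp add: radial_density_def \<tau>_0 G'_0)

lemma eigenvalue_density_tendsto_zero:
  assumes lam: "\<And>j. j \<le> m \<Longrightarrow> lam (Suc j) = l j"
  shows "(\<lambda>N. eigenvalue_density (Suc m) N (\<lambda>i. lam i * real N) 0) \<longlonglongrightarrow> radial_density 0"
proof (rule Lim_transform_eventually[OF tendsto_const])
  have lam': "0 \<le> lam i" if "i \<in> {1..Suc m}" for i
    using lam[of "i - 1"] l_nonneg[of "i - 1"] that by (cases i) auto
  have nn: "0 \<le> (\<Prod>j\<in>{1..m}. l j)" using l_nonneg by (intro prod_nonneg) auto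
  show "\<forall>\<^sub>F N in sequentially. radial_density 0 = eigenvalue_density (Suc m) N (\<lambda>i. lam i * real N) 0"
    using eventually_gt_at_top[of 0]
  proof eventually_elim
    case (elim N)
    have "eigenvalue_density (Suc m) N (\<lambda>i. lam i * real N) 0
        = inverse (ennreal pi) * (\<Prod>i\<in>{2..Suc m}. ennreal (real N) * inverse (ennreal (lam i * real N)))"
      using lam[of 0] l_0 lam' elim by (intro eigenvalue_density_zero) auto
    \<comment> \<open>The factor N cancels also for a vanishing parameter, where both sides are
      infinite.\<close>
    also have "(\<Prod>i\<in>{2..Suc m}. ennreal (real N) * inverse (ennreal (lam i * real N))) = (\<Prod>i\<in>{2..Suc m}. inverse (ennreal (lam i)))"
    proof (intro prod.cong refl)
      fix i assume "i \<in> {2..Suc m}"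
      then have "0 \<le> lam i" using lam' by simp
      moreover have "ennreal (real N) * inverse (ennreal (real N)) = 1"
        using elim by (simp add: inverse_ennreal flip: ennreal_mult)
      ultimately show "ennreal (real N) * inverse (ennreal (lam i * real N)) = inverse (ennreal (lam i))"
        by (simp add: ennreal_mult ennreal_inverse_mult) (metis mult.assoc mult.commute mult.right_neutral)
    qed
    also have "\<dots> = inverse (ennreal (\<Prod>i\<in>{2..Suc m}. lam i))"
      using lam' by (intro prod_inverse_ennreal) auto
    also have "(\<Prod>i\<in>{2..Suc m}. lam i) = (\<Prod>j\<in>{1..m}. lam (Suc j))"
      using prod.shift_bounds_cl_Suc_ivl[of lam 1 m] by (simp add: numeral_2_eq_2)
    also have "\<dots> = (\<Prod>j\<in>{1..m}. l j)" using lam by (intro prod.cong) auto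
    also have "inverse (ennreal pi) * inverse (ennreal (\<Prod>j\<in>{1..m}. l j)) = radial_density 0"
      unfolding radial_density_0 using nn by (simp add: ennreal_mult ennreal_inverse_mult)
    finally show ?case by simp
  qed
qed

text \<open>With all parameters 0, \<open>G t\<close> is a power of \<open>t / (1 - t)\<close>, so
  the saddle point equation is solved explicitly by \<open>t / (1 - t) = |z|^(2 / n)\<close>. At the
  origin the convention of \<open>epowr\<close> matters: the exponent is 0 for one matrix, giving 1,
  and negative otherwise, giving infinity.\<close>

lemma radial_density_square:
  assumes l: "\<And>j. j \<le> m \<Longrightarrow> l j = 0"
  shows "radial_density z = ennreal (1 / (pi * real (Suc m))) * epowr (norm z) ((2 - 2 * real (Suc m)) / real (Suc m))
           / (1 + epowr (norm z) (2 / real (Suc m)))\<^sup>2"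
proof (cases "z = 0")
  case True
  show ?thesis
  proof (cases "m = 0")
    case True
    have "radial_density 0 = inverse (ennreal pi)"
      unfolding radial_density_0 by (simp add: True)
    then show ?thesis
      unfolding \<open>z = 0\<close> by (simp add: True epowr_def inverse_ennreal inverse_eq_divide divide_ennreal_def)
  next
    case False
    have p0: "(\<Prod>j\<in>{1..m}. l j) = 0" using False l by (intro prod_zero bexI[of _ 1]) auto
    have r0: "radial_density 0 = \<infinity>" unfolding radial_density_0 p0 by simp
    have "epowr 0 a = \<infinity>" if "a < 0" for a using that by (simp add: epowr_def)
    moreover have "(2 - 2 * real (Suc m)) / real (Suc m) < 0" by (intro divide_neg_pos) (use False in auto)
    ultimately have e1: "epowr (norm (0::complex)) ((2 - 2 * real (Suc m)) / real (Suc m)) = \<infinity>"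
      unfolding norm_zero by blast
    have e2: "epowr (norm (0::complex)) (2 / real (Suc m)) = 0"
      by (simp add: epowr_def)
    show ?thesis
      unfolding \<open>z = 0\<close> r0 e1 e2 by (simp add: ennreal_mult_top divide_ennreal_def ennreal_top_mult)
  qed
next
  case False
  define n where "n = real (Suc m)"
  define r where "r = norm z"
  define t where "t = T (ln (r\<^sup>2))"
  define y where "y = r powr (2 / n)"
  have r: "0 < r" and n: "0 < n" using False by (auto simp: r_def n_def)
  have t: "0 < t" "t < 1" using T_range by (auto simp: t_def)
  have y: "0 < y" using r by (simp add: y_def)
  have "ln (r\<^sup>2) = lnG t" by (simp add: t_def lnG_T)
  also have "\<dots> = n * (ln t - ln (1 - t))" unfolding lnG_def using l by (simp add: n_def)
  finally have "ln (t / (1 - t)) = 2 / n * ln r" using t r n by (simp add: ln_div ln_realpow field_simps)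
  then have "t / (1 - t) = exp (2 / n * ln r)" using t by (metis exp_ln divide_pos_pos diff_gt_0_iff_gt)
  then have ty: "t / (1 - t) = y" using r by (simp add: y_def powr_def)
  have "slope t = n * (1 / t + 1 / (1 - t))" unfolding slope_def using l by (simp add: n_def)
  also have "\<dots> = n * ((1 + y)\<^sup>2 / y)"
    unfolding ty[symmetric] using t by (simp add: divide_simps power2_eq_square)
  finally have sl: "slope t = n * ((1 + y)\<^sup>2 / y)" .
  have "r powr ((2 - 2 * n) / n) = r powr (2 / n - 2)" using n by (simp add: diff_divide_distrib)
  also have "\<dots> = y / r\<^sup>2" using r by (simp add: powr_diff y_def powr_numeral)
  finally have e: "r powr ((2 - 2 * n) / n) = y / r\<^sup>2" .
  have "radial_density z = ennreal (1 / (pi * r\<^sup>2 * slope t))"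
    unfolding r_def t_def by (rule radial_density_nonzero[OF False])
  also have "1 / (pi * r\<^sup>2 * slope t) = 1 / (pi * n) * (y / r\<^sup>2) / (1 + y)\<^sup>2"
    unfolding sl using r n y by (simp add: field_simps)
  also have "ennreal \<dots> = ennreal (1 / (pi * n)) * ennreal (y / r\<^sup>2) / (1 + ennreal y)\<^sup>2"
  proof -
    have "(1 + ennreal y)\<^sup>2 = ennreal ((1 + y)\<^sup>2)"
      using y by (simp add: ennreal_plus[symmetric] ennreal_power ennreal_1[symmetric] del: ennreal_plus ennreal_1)
    then show ?thesis using n y by (simp add: divide_ennreal flip: ennreal_mult)
  qed
  finally show ?thesis
    unfolding n_def[symmetric] r_def[symmetric] using r by (simp add: epowr_def e y_def)
qed

end

theorem proposition4p2:
  fixes n :: nat and lam :: "nat \<Rightarrow> real"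
  assumes "n \<ge> 1"
    and "\<forall>i\<in>{1..n}. 0 \<le> lam i"
    and "lam 1 = 0"
    and "\<forall>i\<in>{1..n}. \<forall>j\<in>{1..n}. i \<le> j \<longrightarrow> lam i \<le> lam j"
  shows "(\<exists>!\<rho>. is_macroscopic_density n lam \<rho>) \<and>
    (\<forall>z::complex. (\<lambda>N. eigenvalue_density n N (\<lambda>i. lam i * real N) z)
        \<longlonglongrightarrow> macroscopic_density n lam z) \<and>
    ((\<forall>i\<in>{1..n}. lam i = 0) \<longrightarrow>
      (\<forall>z::complex. macroscopic_density n lam z =
         ennreal (1 / (pi * real n)) * epowr (norm z) ((2 - 2 * real n) / real n)
           / (1 + epowr (norm z) (2 / real n))\<^sup>2))"
proof -
  obtain m where n: "n = Suc m" using assms(1) by (cases n) auto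
  interpret dilation_parameters m "\<lambda>j. lam (Suc j)"
    by unfold_locales (use assms(2,3) n in auto)
  have ex: "\<exists>!\<rho>. is_macroscopic_density n lam \<rho>"
    unfolding n using is_macroscopic_density_radial_density macroscopic_density_unique by metis
  have eq: "macroscopic_density n lam = radial_density"
    unfolding macroscopic_density_def n
    by (rule the_equality) (use is_macroscopic_density_radial_density macroscopic_density_unique in auto)
  have lim: "(\<lambda>N. eigenvalue_density n N (\<lambda>i. lam i * real N) z) \<longlonglongrightarrow> macroscopic_density n lam z" for z
    unfolding eq unfolding n
    using eigenvalue_density_tendsto_nonzero[of lam z] eigenvalue_density_tendsto_zero[of lam]
    by (cases "z = 0") auto
  have sq: "macroscopic_density n lam z =
         ennreal (1 / (pi * real n)) * epowr (norm z) ((2 - 2 * real n) / real n)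
           / (1 + epowr (norm z) (2 / real n))\<^sup>2" if "\<forall>i\<in>{1..n}. lam i = 0" for z
    unfolding eq unfolding n by (rule radial_density_square) (use that n in auto)
  show ?thesis using ex lim sq by blast
qed

end
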